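(* Let $q$ be a prime power and $G=GL(3,\mathbb F_q)$. Let $\alpha,\beta,\gamma,\delta,\varepsilon,\eta$ denote characters of $\mathbb F_q^\times$, $\lambda,\mu$ characters of $\mathbb F_{q^2}^\times$, and $\varphi,\psi$ characters of $\mathbb F_{q^3}^\times$. With the notation for the class functions $\chi$, the tori $T_i,T_m,T_a$ and the induced characters given in the context, the following identities of class functions on $G$ hold; in each of them the parameters are assumed to be such that the two factors of the tensor product on the left-hand side are irreducible characters of $G$ (that is, they satisfy the irreducibility conditions listed in the context). 1. (i) $\chi_{\alpha,\lambda}^{q^3-1}\otimes\chi_{\beta,\gamma,\delta}^{(q+1)(q^2+q+1)}=\mathrm{Ind}_{T_m}^G(\widetilde{\gamma\delta}\,\lambda,\alpha\beta)+\chi_{\alpha\beta,\widetilde{\gamma\delta}\lambda}^{q^3-1}+\left(\chi_{\alpha\gamma,\widetilde{\beta\delta}\lambda}^{q^3-1}+\chi_{\alpha\delta,\widetilde{\beta\gamma}\lambda}^{q^3-1}\right)\otimes\chi_1^{q^2+q}$, where $\widetilde{\gamma\delta},\widetilde{\beta\delta},\widetilde{\beta\gamma}$ are any characters of $\mathbb F_{q^2}^\times$ extending $\gamma\delta,\beta\delta,\beta\gamma$ (the same extension $\widetilde{\gamma\delta}$ being used in both places). (ii) $\chi_{\alpha\lambda,(\alpha\circ\mathbf N_2)\lambda^2}^{q^3-1}\otimes\chi_{\beta,\gamma,\delta}^{(q+1)(q^2+q+1)}=\mathrm{Ind}_{T_i}^G(\alpha\lambda\beta,\alpha\lambda\gamma,\alpha\lambda\delta)-\chi_{\alpha\lambda\beta,\alpha\lambda\gamma,\alpha\lambda\delta}^{(q+1)(q^2+q+1)}$,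 where in $\alpha\lambda$, $\alpha\lambda\beta$, $\alpha\lambda\gamma$, $\alpha\lambda\delta$ the symbol $\lambda$ stands for $\lambda_{|}=\lambda|_{\mathbb F_q^\times}$. 2. $\chi_{\alpha,\lambda}^{q^3-1}\otimes\chi_{\beta,\mu}^{q^3-1}=\mathrm{Ind}_{T_m}^G(\lambda\mu,\alpha\beta)-\chi_{\alpha\beta,\lambda\mu^q}^{q^3-1}$. 3. (i) $\chi_{\alpha,\lambda}^{q^3-1}\otimes\chi_\varphi^{(q-1)(q^2-1)}=\mathrm{Ind}_{T_a}^G\left(\widetilde\alpha\,\widetilde{\lambda_{|}}\,\varphi\right)-\chi_{\widetilde\alpha\,\widetilde{\lambda_{|}}\,\varphi}^{(q-1)(q^2-1)}$, where $\widetilde\alpha,\widetilde{\lambda_{|}}$ are any characters of $\mathbb F_{q^3}^\times$ extending $\alpha$ and $\lambda_{|}=\lambda|_{\mathbb F_q^\times}$ (the same in both terms). (ii) $\chi_{\alpha,\lambda}^{q^3-1}\otimes\chi_\varphi^{(q-1)(q^2-1)}=\mathrm{Ind}_{T_m}^G(\lambda,\alpha\varphi)+\chi_{\alpha\varphi,\lambda}^{q^3-1}\otimes\left(\chi_1^1-\chi_1^{q^2+q}\right)$, where $\alpha\varphi$ means $\alpha\cdot\varphi|_{\mathbb F_q^\times}$. 4. $\chi_\delta^{q^3}\otimes\chi_{\alpha,\beta,\gamma}^{(q+1)(q^2+q+1)}=\mathrm{Ind}_{T_i}^G(\alpha\delta,\beta\delta,\gamma\delta)$. 5. $\chi_\alpha^{q^3}\otimes\chi_\varphi^{(q-1)(q^2-1)}=\mathrm{Ind}_{T_a}^G\left((\alpha\circ\mathbf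 N_3)\varphi\right)$. 6. $\chi_\alpha^{q^3}\otimes\chi_{\beta,\lambda}^{q^3-1}=\mathrm{Ind}_{T_m}^G\left((\alpha\circ\mathbf N_2)\lambda,\alpha\beta\right)$. 7. (i) $\chi_\alpha^{q^3}\otimes\chi_\beta^{q^3}=\mathrm{Ind}_{T_m}^G\left((\alpha\beta)\circ\mathbf N_2,\alpha\beta\right)+\chi_{\alpha\beta}^{q^3}$. (ii) $\chi_\alpha^{q^3}\otimes\chi_\beta^{q^3}=\mathrm{Ind}_{T_i}^G(\alpha\beta,\alpha\beta,\alpha\beta)-\chi_{\alpha\beta}^{q^3}\otimes\left(2\chi_1^{q^2+q}+\chi_1^1\right)$. (iii) $\chi_\alpha^{q^3}\otimes\chi_\beta^{q^3}=\mathrm{Ind}_{T_a}^G\left((\alpha\beta)\circ\mathbf N_3\right)+\chi_{\alpha\beta}^{q^3}\otimes\left(\chi_1^{q^2+q}-\chi_1^1\right)$. 8. (i) $\chi_\varphi^{(q-1)(q^2-1)}\otimes\chi_{\alpha,\beta,\gamma}^{(q+1)(q^2+q+1)}=\mathrm{Ind}_{T_a}^G\left(\varphi\,\widetilde{\alpha\beta\gamma}\right)+\chi_{\varphi\,\widetilde{\alpha\beta\gamma}}^{(q-1)(q^2-1)}\otimes\left(2\chi_1^{q^2+q}+\chi_1^1\right)$, where $\widetilde{\alpha\beta\gamma}$ is any character of $\mathbb F_{q^3}^\times$ extending $\alpha\beta\gamma$ (the same in both terms). (ii) $\chi_\varphi^{(q-1)(q^2-1)}\otimes\chi_{\alpha,\beta,\gamma}^{(q+1)(q^2+q+1)}=\mathrm{Ind}_{T_i}^G(\alpha,\beta,\varphi\gamma)+\chi_{\alpha,\beta,\varphi\gamma}^{(q+1)(q^2+q+1)}\otimes\left(\chi_1^1-\chi_1^{q^2+q}\right)$,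 where $\varphi\gamma$ means $\varphi|_{\mathbb F_q^\times}\cdot\gamma$. 9. $\chi_\varphi^{(q-1)(q^2-1)}\otimes\chi_\psi^{(q-1)(q^2-1)}=\mathrm{Ind}_{T_a}^G(\varphi\psi)+\chi_{\varphi\psi^q}^{(q-1)(q^2-1)}+\chi_{\varphi\psi^{q^2}}^{(q-1)(q^2-1)}-\chi_{\varphi\psi}^{(q-1)(q^2-1)}\otimes\left(\chi_1^{q^2+q}+\chi_1^1\right)$. 10. $\chi_{\alpha,\beta,\gamma}^{(q+1)(q^2+q+1)}\otimes\chi_{\delta,\varepsilon,\eta}^{(q+1)(q^2+q+1)}=\mathrm{Ind}_{T_i}^G(\alpha\delta,\beta\varepsilon,\gamma\eta)+\sum_{(\delta',\varepsilon',\eta')}\chi_{\alpha\delta',\beta\varepsilon',\gamma\eta'}^{(q+1)(q^2+q+1)}+\left(\chi_{\alpha\varepsilon,\beta\eta,\gamma\delta}^{(q+1)(q^2+q+1)}+\chi_{\alpha\eta,\beta\delta,\gamma\varepsilon}^{(q+1)(q^2+q+1)}\right)\otimes\left(\chi_1^{q^2+q}-2\chi_1^1\right)$, where the sum runs over the five triples $(\delta',\varepsilon',\eta')$ obtained from $(\delta,\varepsilon,\eta)$ by the non-identity permutations in $S_3$.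
   Context: "Character" of an abelian group means a homomorphism to $\mathbb C^\times$. A representation and its character are denoted by the same symbol; $\otimes$ is the pointwise product of class functions. $1$ as a subscript denotes the trivial character of $\mathbb F_q^\times$. $\mathbf N_2:\mathbb F_{q^2}^\times\to\mathbb F_q^\times$ and $\mathbf N_3:\mathbb F_{q^3}^\times\to\mathbb F_q^\times$ are the norms. For a character $\mu$ of $\mathbb F_{q^2}^\times$ or $\mathbb F_{q^3}^\times$, $\mu^q(x)=\mu(x^q)$. Tori. Fix generators $\tau$ of $\mathbb F_{q^2}$ and $\sigma$ of $\mathbb F_{q^3}$ over $\mathbb F_q$; identify $w\in\mathbb F_{q^2}$ with the $2\times2$ matrix of multiplication by $w$ in the basis $\{1,\tau\}$, and $z\in\mathbb F_{q^3}$ with the $3\times 3$ matrix of multiplication by $z$ in the basis $\{1,\sigma,\sigma^2\}$. $T_i$ is the group of diagonal matrices in $G$; $T_m=\{\mathrm{diag}(x,a): x\in\mathbb F_{q^2}^\times, a\in\mathbb F_q^\times\}$ (block diagonal); $T_a$ is the image of $\mathbb F_{q^3}^\times$ in $G$. $\mathrm{Ind}_{T_i}^G(\alpha,\beta,\gamma)$ is induced from $\mathrm{diag}(a,b,c)\mapsto\alpha(a)\beta(b)\gamma(c)$; $\mathrm{Ind}_{T_m}^G(\lambda,\alpha)$ is induced from $\mathrm{diag}(x,a)\mapsto\lambda(x)\alpha(a)$; $\mathrm{Ind}_{T_a}^G(\varphi)$ is induced from $z\mapsto\varphi(z)$. Conjugacy classes. Representatives of the conjugacy classes of $G$ are of the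 types (with $a,b,c\in\mathbb F_q^\times$ pairwise distinct, $\varkappa\in\mathbb F_{q^2}\setminus\mathbb F_q$, $z\in\mathbb F_{q^3}\setminus\mathbb F_q$): $T^a=aI$; $T_1^a$ = the matrix with diagonal $(a,a,a)$ and one further nonzero entry, a $1$ in position $(1,2)$; $T_{11}^a$ = the single Jordan block of size 3 with eigenvalue $a$; $T^{ab}=\mathrm{diag}(a,a,b)$; $T_1^{ab}$ = $T^{ab}$ plus a $1$ in position $(1,2)$; $T^{abc}=\mathrm{diag}(a,b,c)$; $T^{\varkappa a}=\mathrm{diag}(\varkappa,a)$ (block diagonal); $T^z=z$. Class functions. For arbitrary characters $\alpha,\beta,\gamma$ of $\mathbb F_q^\times$, $\lambda$ of $\mathbb F_{q^2}^\times$, $\varphi$ of $\mathbb F_{q^3}^\times$, define class functions on $G$ by the following values on $(T^a,\;T_1^a,\;T_{11}^a,\;T^{ab},\;T_1^{ab},\;T^{abc},\;T^{\varkappa a},\;T^z)$, in this order: - $\chi_\alpha^1$: $\alpha\circ\det$. - $\chi_\alpha^{q^2+q}$: $\alpha\circ\det$ times $(q^2+q,\;q,\;0,\;q+1,\;1,\;2,\;0,\;-1)$. - $\chi_\alpha^{q^3}$: $\alpha\circ\det$ times $(q^3,\;0,\;0,\;q,\;0,\;1,\;-1,\;1)$. - $\chi_{\alpha,\beta,\gamma}^{(q+1)(q^2+q+1)}$: $(q+1)(q^2+q+1)\,\alpha\beta\gamma(a)$; $(2q+1)\,\alpha\beta\gamma(a)$; $\alpha\beta\gamma(a)$; $(q+1)[\alpha\beta(a)\gamma(b)+\alpha\gamma(a)\beta(b)+\beta\gamma(a)\alpha(b)]$;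 $\alpha\beta(a)\gamma(b)+\alpha\gamma(a)\beta(b)+\beta\gamma(a)\alpha(b)$; the sum of the six terms obtained from $\alpha(a)\beta(b)\gamma(c)$ by permuting $\alpha,\beta,\gamma$; $0$; $0$. - $\chi_{\alpha,\lambda}^{q^3-1}$: $(q^3-1)\alpha(a)\lambda(a)$; $-\alpha(a)\lambda(a)$; $-\alpha(a)\lambda(a)$; $(q-1)\alpha(b)\lambda(a)$; $-\alpha(b)\lambda(a)$; $0$; $-\alpha(a)(\lambda(\varkappa)+\lambda(\varkappa^q))$; $0$. - $\chi_\varphi^{(q-1)(q^2-1)}$: $(q-1)(q^2-1)\varphi(a)$; $-(q-1)\varphi(a)$; $\varphi(a)$; $0$; $0$; $0$; $0$; $\varphi(z)+\varphi(z^q)+\varphi(z^{q^2})$. Irreducibility conditions: $\chi_\alpha^1,\chi_\alpha^{q^2+q},\chi_\alpha^{q^3}$ are irreducible characters for every $\alpha$; $\chi_{\alpha,\beta,\gamma}^{(q+1)(q^2+q+1)}$ is irreducible when $\alpha,\beta,\gamma$ are pairwise distinct; $\chi_{\alpha,\lambda}^{q^3-1}$ when $\lambda\ne\lambda^q$; $\chi_\varphi^{(q-1)(q^2-1)}$ when $\varphi\neq\varphi^q$. For parameters violating these conditions (which may occur on right-hand sides) the symbols denote the class functions given by the same formulas. *)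

theory Defs
  imports "HOL-Analysis.Analysis" "HOL-Library.Function_Algebras"
begin

text \<open>Products, sums, powers and numeral multiples of characters and of class functions are
  pointwise (theory \<^verbatim>\<open>Function_Algebras\<close>); \<^verbatim>\<open>*\<close> is never a matrix product here, that is \<^verbatim>\<open>**\<close>.\<close>


definition field_embedding :: "('a::field \<Rightarrow> 'b::field) \<Rightarrow> bool" where
  "field_embedding e \<longleftrightarrow> e 1 = 1 \<and> (\<forall>x y. e (x + y) = e x + e y) \<and> (\<forall>x y. e (x * y) = e x * e y)"

definition generates_over :: "('a::field \<Rightarrow> 'b::field) \<Rightarrow> 'b \<Rightarrow> bool" where
  "generates_over e t \<longleftrightarrow>
     (\<forall>S. range e \<subseteq> S \<and> t \<in> S \<and> (\<forall>x\<in>S. \<forall>y\<in>S. x - y \<in> S \<and> x * y \<in> S) \<and> (\<forall>x\<in>S. inverse x \<in> S)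
        \<longrightarrow> S = UNIV)"

text \<open>The types \<open>'k\<close>, \<open>'l\<close>, \<open>'m\<close> are the fields of orders \<open>q\<close>, \<open>q\<^sup>2\<close>, \<open>q\<^sup>3\<close>, where \<open>q = CARD('k)\<close>;
  \<open>emb2\<close> and \<open>emb3\<close> are the inclusions of the small field, \<open>gen2\<close> and \<open>gen3\<close> the chosen
  generators \<open>\<tau>\<close> and \<open>\<sigma>\<close>.\<close>

record ('k, 'l, 'm) tower =
  emb2 :: "'k \<Rightarrow> 'l"
  emb3 :: "'k \<Rightarrow> 'm"
  gen2 :: 'l
  gen3 :: 'm

definition is_tower :: "('k::{field,finite}, 'l::{field,finite}, 'm::{field,finite}) tower \<Rightarrow> bool" where
  "is_tower F \<longleftrightarrow>
     CARD('l) = CARD('k) ^ 2 \<and> CARD('m) = CARD('k) ^ 3 \<and>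
     field_embedding (emb2 F) \<and> field_embedding (emb3 F) \<and>
     generates_over (emb2 F) (gen2 F) \<and> generates_over (emb3 F) (gen3 F)"

definition norm2 :: "('k::{field,finite}, 'l::field, 'm) tower \<Rightarrow> 'l \<Rightarrow> 'k" where
  "norm2 F x = inv (emb2 F) (x * x ^ CARD('k))"

definition norm3 :: "('k::{field,finite}, 'l, 'm::field) tower \<Rightarrow> 'm \<Rightarrow> 'k" where
  "norm3 F x = inv (emb3 F) (x * x ^ CARD('k) * x ^ (CARD('k) ^ 2))"


text \<open>A character of the multiplicative group is represented by its extension by \<open>0\<close> to the
  whole field, so that equality of functions is equality of characters.\<close>

definition mult_char :: "('a::field \<Rightarrow> complex) \<Rightarrow> bool" where
  "mult_char \<mu> \<longleftrightarrow> \<mu> 0 = 0 \<and> (\<forall>x. x \<noteq> 0 \<longrightarrow> \<mu> x \<noteq> 0) \<and>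
     (\<forall>x y. x \<noteq> 0 \<longrightarrow> y \<noteq> 0 \<longrightarrow> \<mu> (x * y) = \<mu> x * \<mu> y)"

definition triv :: "'a::field \<Rightarrow> complex" where
  "triv x = (if x = 0 then 0 else 1)"

definition twist :: "nat \<Rightarrow> ('a::field \<Rightarrow> complex) \<Rightarrow> 'a \<Rightarrow> complex" where
  "twist n \<mu> = (\<lambda>x. \<mu> (x ^ n))"

definition is_extension ::
  "('k::field \<Rightarrow> 'l::field) \<Rightarrow> ('k \<Rightarrow> complex) \<Rightarrow> ('l \<Rightarrow> complex) \<Rightarrow> bool" where
  "is_extension e \<alpha> \<omega> \<longleftrightarrow> mult_char \<omega> \<and> \<omega> \<circ> e = \<alpha>"


definition GL3 :: "('k::field ^ 3 ^ 3) set" where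
  "GL3 = {A. invertible A}"

definition GL3_conj :: "'k::field ^ 3 ^ 3 \<Rightarrow> 'k ^ 3 ^ 3 \<Rightarrow> bool" where
  "GL3_conj A B \<longleftrightarrow> (\<exists>P\<in>GL3. A = P ** B ** matrix_inv P)"

text \<open>Matrix of multiplication by \<open>w\<close> in the basis \<open>b\<close>: column \<open>j\<close> holds the coordinates
  of \<open>w b\<^sub>j\<close>.\<close>

definition mult_matrix :: "('k::field \<Rightarrow> 'l::field) \<Rightarrow> 'l ^ 'n \<Rightarrow> 'l \<Rightarrow> 'k ^ 'n ^ 'n" where
  "mult_matrix e b w = (THE M. \<forall>j. w * b $ j = (\<Sum>i\<in>UNIV. e (M $ i $ j) * b $ i))"

definition mat2 :: "('k::field, 'l::field, 'm) tower \<Rightarrow> 'l \<Rightarrow> 'k ^ 2 ^ 2" where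
  "mat2 F w = mult_matrix (emb2 F) (vector [1, gen2 F]) w"

definition mat3 :: "('k::field, 'l, 'm::field) tower \<Rightarrow> 'm \<Rightarrow> 'k ^ 3 ^ 3" where
  "mat3 F z = mult_matrix (emb3 F) (vector [1, gen3 F, gen3 F ^ 2]) z"

definition block_diag :: "'k::zero ^ 2 ^ 2 \<Rightarrow> 'k \<Rightarrow> 'k ^ 3 ^ 3" where
  "block_diag M a = vector [vector [M $ 1 $ 1, M $ 1 $ 2, 0], vector [M $ 2 $ 1, M $ 2 $ 2, 0], vector [0, 0, a]]"

definition torus_i :: "('k::field ^ 3 ^ 3) set" where
  "torus_i = {A \<in> GL3. \<forall>i j. i \<noteq> j \<longrightarrow> A $ i $ j = 0}"

definition torus_m :: "('k::field, 'l::field, 'm) tower \<Rightarrow> ('k ^ 3 ^ 3) set" where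
  "torus_m F = {block_diag (mat2 F x) a | x a. x \<noteq> 0 \<and> a \<noteq> 0}"

definition torus_a :: "('k::field, 'l, 'm::field) tower \<Rightarrow> ('k ^ 3 ^ 3) set" where
  "torus_a F = {mat3 F z | z. z \<noteq> 0}"

text \<open>Labels of conjugacy classes, in the order
  \<open>T\<^sup>a\<close>, \<open>T\<^sub>1\<^sup>a\<close>, \<open>T\<^sub>1\<^sub>1\<^sup>a\<close>, \<open>T\<^sup>a\<^sup>b\<close>, \<open>T\<^sub>1\<^sup>a\<^sup>b\<close>, \<open>T\<^sup>a\<^sup>b\<^sup>c\<close>, \<open>T\<^sup>\<kappa>\<^sup>a\<close>, \<open>T\<^sup>z\<close>.\<close>

datatype ('k, 'l, 'm) cls =
  Ca 'k | Ca1 'k | Ca11 'k | Cab 'k 'k | Cab1 'k 'k | Cabc 'k 'k 'k | Cka 'l 'k | Cz 'm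

fun is_cls :: "('k::field, 'l::field, 'm::field) tower \<Rightarrow> ('k, 'l, 'm) cls \<Rightarrow> bool" where
  "is_cls F (Ca a) \<longleftrightarrow> a \<noteq> 0"
| "is_cls F (Ca1 a) \<longleftrightarrow> a \<noteq> 0"
| "is_cls F (Ca11 a) \<longleftrightarrow> a \<noteq> 0"
| "is_cls F (Cab a b) \<longleftrightarrow> a \<noteq> 0 \<and> b \<noteq> 0 \<and> a \<noteq> b"
| "is_cls F (Cab1 a b) \<longleftrightarrow> a \<noteq> 0 \<and> b \<noteq> 0 \<and> a \<noteq> b"
| "is_cls F (Cabc a b c) \<longleftrightarrow> a \<noteq> 0 \<and> b \<noteq> 0 \<and> c \<noteq> 0 \<and> distinct [a, b, c]"
| "is_cls F (Cka \<kappa> a) \<longleftrightarrow> \<kappa> \<notin> range (emb2 F) \<and> a \<noteq> 0"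
| "is_cls F (Cz z) \<longleftrightarrow> z \<notin> range (emb3 F)"

fun cls_rep :: "('k::field, 'l::field, 'm::field) tower \<Rightarrow> ('k, 'l, 'm) cls \<Rightarrow> 'k ^ 3 ^ 3" where
  "cls_rep F (Ca a) = vector [vector [a, 0, 0], vector [0, a, 0], vector [0, 0, a]]"
| "cls_rep F (Ca1 a) = vector [vector [a, 1, 0], vector [0, a, 0], vector [0, 0, a]]"
| "cls_rep F (Ca11 a) = vector [vector [a, 1, 0], vector [0, a, 1], vector [0, 0, a]]"
| "cls_rep F (Cab a b) = vector [vector [a, 0, 0], vector [0, a, 0], vector [0, 0, b]]"
| "cls_rep F (Cab1 a b) = vector [vector [a, 1, 0], vector [0, a, 0], vector [0, 0, b]]"
| "cls_rep F (Cabc a b c) = vector [vector [a, 0, 0], vector [0, b, 0], vector [0, 0, c]]"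
| "cls_rep F (Cka \<kappa> a) = block_diag (mat2 F \<kappa>) a"
| "cls_rep F (Cz z) = mat3 F z"


text \<open>The class function on \<open>GL(3, q)\<close> with value \<open>v c\<close> on the class of \<open>cls_rep F c\<close>, extended by
  \<open>0\<close> to singular matrices. The label \<open>c\<close> of a class is unique up to permuting \<open>a, b, c\<close> in
  \<open>T\<^sup>a\<^sup>b\<^sup>c\<close> and replacing \<open>\<kappa>\<close> or \<open>z\<close> by a Galois conjugate, and all value functions \<open>v\<close> used
  below are invariant under these changes.\<close>

definition class_fun :: "('k::field, 'l::field, 'm::field) tower \<Rightarrow> (('k, 'l, 'm) cls \<Rightarrow> complex)
    \<Rightarrow> 'k ^ 3 ^ 3 \<Rightarrow> complex" where
  "class_fun F v g = (if g \<in> GL3 then v (SOME c. is_cls F c \<and> GL3_conj g (cls_rep F c)) else 0)"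

text \<open>The six families \<open>chi_one\<close>, \<open>chi_q2q\<close>, \<open>chi_q3\<close>, \<open>chi_split\<close>, \<open>chi_quad\<close>, \<open>chi_cubic\<close> have degrees
  \<open>1\<close>, \<open>q\<^sup>2 + q\<close>, \<open>q\<^sup>3\<close>, \<open>(q + 1)(q\<^sup>2 + q + 1)\<close>, \<open>q\<^sup>3 - 1\<close>, \<open>(q - 1)(q\<^sup>2 - 1)\<close>. The last three are
  irreducible characters under \<open>irr_split\<close>, \<open>irr_quad\<close>, \<open>irr_cubic\<close>.\<close>

definition chi_one :: "('k::field \<Rightarrow> complex) \<Rightarrow> 'k ^ 3 ^ 3 \<Rightarrow> complex" where
  "chi_one \<alpha> = \<alpha> \<circ> det"

definition chi_q2q :: "('k::{field,finite}, 'l::field, 'm::field) tower \<Rightarrow> ('k \<Rightarrow> complex)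
    \<Rightarrow> 'k ^ 3 ^ 3 \<Rightarrow> complex" where
  "chi_q2q F \<alpha> = (let q = of_nat CARD('k) in
     (\<alpha> \<circ> det) * class_fun F (\<lambda>c. case c of
         Ca a \<Rightarrow> q^2 + q
       | Ca1 a \<Rightarrow> q
       | Ca11 a \<Rightarrow> 0
       | Cab a b \<Rightarrow> q + 1
       | Cab1 a b \<Rightarrow> 1
       | Cabc a b c \<Rightarrow> 2
       | Cka \<kappa> a \<Rightarrow> 0
       | Cz z \<Rightarrow> - 1))"

definition chi_q3 :: "('k::{field,finite}, 'l::field, 'm::field) tower \<Rightarrow> ('k \<Rightarrow> complex)
    \<Rightarrow> 'k ^ 3 ^ 3 \<Rightarrow> complex" where
  "chi_q3 F \<alpha> = (let q = of_nat CARD('k) in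
     (\<alpha> \<circ> det) * class_fun F (\<lambda>c. case c of
         Ca a \<Rightarrow> q^3
       | Ca1 a \<Rightarrow> 0
       | Ca11 a \<Rightarrow> 0
       | Cab a b \<Rightarrow> q
       | Cab1 a b \<Rightarrow> 0
       | Cabc a b c \<Rightarrow> 1
       | Cka \<kappa> a \<Rightarrow> - 1
       | Cz z \<Rightarrow> 1))"

definition chi_split :: "('k::{field,finite}, 'l::field, 'm::field) tower
    \<Rightarrow> ('k \<Rightarrow> complex) \<Rightarrow> ('k \<Rightarrow> complex) \<Rightarrow> ('k \<Rightarrow> complex) \<Rightarrow> 'k ^ 3 ^ 3 \<Rightarrow> complex" where
  "chi_split F \<alpha> \<beta> \<gamma> = (let q = of_nat CARD('k) in
     class_fun F (\<lambda>c. case c of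
         Ca a \<Rightarrow> (q + 1) * (q^2 + q + 1) * (\<alpha> a * \<beta> a * \<gamma> a)
       | Ca1 a \<Rightarrow> (2 * q + 1) * (\<alpha> a * \<beta> a * \<gamma> a)
       | Ca11 a \<Rightarrow> \<alpha> a * \<beta> a * \<gamma> a
       | Cab a b \<Rightarrow> (q + 1) * (\<alpha> a * \<beta> a * \<gamma> b + \<alpha> a * \<gamma> a * \<beta> b + \<beta> a * \<gamma> a * \<alpha> b)
       | Cab1 a b \<Rightarrow> \<alpha> a * \<beta> a * \<gamma> b + \<alpha> a * \<gamma> a * \<beta> b + \<beta> a * \<gamma> a * \<alpha> b
       | Cabc a b c \<Rightarrow> \<alpha> a * \<beta> b * \<gamma> c + \<alpha> a * \<gamma> b * \<beta> c + \<beta> a * \<alpha> b * \<gamma> c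
                    + \<beta> a * \<gamma> b * \<alpha> c + \<gamma> a * \<alpha> b * \<beta> c + \<gamma> a * \<beta> b * \<alpha> c
       | Cka \<kappa> a \<Rightarrow> 0
       | Cz z \<Rightarrow> 0))"

definition chi_quad :: "('k::{field,finite}, 'l::field, 'm::field) tower
    \<Rightarrow> ('k \<Rightarrow> complex) \<Rightarrow> ('l \<Rightarrow> complex) \<Rightarrow> 'k ^ 3 ^ 3 \<Rightarrow> complex" where
  "chi_quad F \<alpha> \<Lambda> = (let q = of_nat CARD('k) in
     class_fun F (\<lambda>c. case c of
         Ca a \<Rightarrow> (q^3 - 1) * (\<alpha> a * \<Lambda> (emb2 F a))
       | Ca1 a \<Rightarrow> - (\<alpha> a * \<Lambda> (emb2 F a))
       | Ca11 a \<Rightarrow> - (\<alpha> a * \<Lambda> (emb2 F a))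
       | Cab a b \<Rightarrow> (q - 1) * (\<alpha> b * \<Lambda> (emb2 F a))
       | Cab1 a b \<Rightarrow> - (\<alpha> b * \<Lambda> (emb2 F a))
       | Cabc a b c \<Rightarrow> 0
       | Cka \<kappa> a \<Rightarrow> - (\<alpha> a * (\<Lambda> \<kappa> + \<Lambda> (\<kappa> ^ CARD('k))))
       | Cz z \<Rightarrow> 0))"

definition chi_cubic :: "('k::{field,finite}, 'l::field, 'm::field) tower
    \<Rightarrow> ('m \<Rightarrow> complex) \<Rightarrow> 'k ^ 3 ^ 3 \<Rightarrow> complex" where
  "chi_cubic F \<phi> = (let q = of_nat CARD('k) in
     class_fun F (\<lambda>c. case c of
         Ca a \<Rightarrow> (q - 1) * (q^2 - 1) * \<phi> (emb3 F a)
       | Ca1 a \<Rightarrow> - ((q - 1) * \<phi> (emb3 F a))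
       | Ca11 a \<Rightarrow> \<phi> (emb3 F a)
       | Cab a b \<Rightarrow> 0
       | Cab1 a b \<Rightarrow> 0
       | Cabc a b c \<Rightarrow> 0
       | Cka \<kappa> a \<Rightarrow> 0
       | Cz z \<Rightarrow> \<phi> z + \<phi> (z ^ CARD('k)) + \<phi> (z ^ (CARD('k) ^ 2))))"


definition irr_split :: "('k \<Rightarrow> complex) \<Rightarrow> ('k \<Rightarrow> complex) \<Rightarrow> ('k \<Rightarrow> complex) \<Rightarrow> bool" where
  "irr_split \<alpha> \<beta> \<gamma> \<longleftrightarrow> \<alpha> \<noteq> \<beta> \<and> \<alpha> \<noteq> \<gamma> \<and> \<beta> \<noteq> \<gamma>"

definition irr_quad :: "('k::{field,finite}, 'l::field, 'm) tower \<Rightarrow> ('l \<Rightarrow> complex) \<Rightarrow> bool" where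
  "irr_quad F \<Lambda> \<longleftrightarrow> \<Lambda> \<noteq> twist CARD('k) \<Lambda>"

definition irr_cubic :: "('k::{field,finite}, 'l, 'm::field) tower \<Rightarrow> ('m \<Rightarrow> complex) \<Rightarrow> bool" where
  "irr_cubic F \<phi> \<longleftrightarrow> \<phi> \<noteq> twist CARD('k) \<phi>"


text \<open>The character of \<open>GL(3, q)\<close> induced from the character \<open>\<theta>\<close> of the subgroup \<open>H\<close>; it vanishes on
  singular matrices.\<close>

definition induced :: "('k::{field,finite} ^ 3 ^ 3) set \<Rightarrow> ('k ^ 3 ^ 3 \<Rightarrow> complex)
    \<Rightarrow> 'k ^ 3 ^ 3 \<Rightarrow> complex" where
  "induced H \<theta> g =
     (\<Sum>x \<in> {x \<in> GL3. matrix_inv x ** g ** x \<in> H}. \<theta> (matrix_inv x ** g ** x)) / of_nat (card H)"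

definition Ind_i :: "('k::{field,finite} \<Rightarrow> complex) \<Rightarrow> ('k \<Rightarrow> complex) \<Rightarrow> ('k \<Rightarrow> complex)
    \<Rightarrow> 'k ^ 3 ^ 3 \<Rightarrow> complex" where
  "Ind_i \<alpha> \<beta> \<gamma> = induced torus_i (\<lambda>A. \<alpha> (A $ 1 $ 1) * \<beta> (A $ 2 $ 2) * \<gamma> (A $ 3 $ 3))"

definition Ind_m :: "('k::{field,finite}, 'l::field, 'm) tower \<Rightarrow> ('l \<Rightarrow> complex) \<Rightarrow> ('k \<Rightarrow> complex)
    \<Rightarrow> 'k ^ 3 ^ 3 \<Rightarrow> complex" where
  "Ind_m F \<Lambda> \<alpha> = induced (torus_m F)
     (\<lambda>A. case inv (\<lambda>(x, a). block_diag (mat2 F x) a) A of (x, a) \<Rightarrow> \<Lambda> x * \<alpha> a)"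

definition Ind_a :: "('k::{field,finite}, 'l, 'm::field) tower \<Rightarrow> ('m \<Rightarrow> complex)
    \<Rightarrow> 'k ^ 3 ^ 3 \<Rightarrow> complex" where
  "Ind_a F \<phi> = induced (torus_a F) (\<lambda>A. \<phi> (inv (mat3 F) A))"

end

theory Submission
  imports Defs "HOL-Computational_Algebra.Polynomial_Factorial"
begin

text \<open>All functions involved are class functions, so an identity only has to be compared on the
  representatives of the classes. That every invertible matrix is conjugate to a representative is
  clear when the characteristic polynomial splits. Otherwise an irreducible factor \<open>p\<close> of degree
  \<open>d\<close> has a root in the field of order \<open>q\<^sup>d\<close>, since it divides \<open>X\<^bsup>q^d\<^esup> - X\<close>, and a
  left eigenvector with coordinates in that field identifies the action of the matrix with
  multiplication by the root. The character induced from \<open>\<theta>\<close> on a torus \<open>T\<close> takes at \<open>g\<close> the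
  value \<open>|C(g)| / |T|\<close> times the sum of \<open>\<theta>\<close> over the elements of \<open>T\<close> conjugate to \<open>g\<close>; the
  elements of \<open>T\<close> conjugate to a representative are found by comparing polynomial equations and
  eigenvalues, and the orders of the centralisers are counted directly. What remains are polynomial
  identities in \<open>q\<close> and in values of characters.\<close>

section \<open>Extensions of finite fields\<close>

text \<open>A class function is tabulated by labels, and the label of a matrix is picked by a choice
  operator. Both sides of an identity are read off at the same chosen label, so what the comparison
  rests on is that every invertible matrix has some label. The three fields are separate types.
  Eigenvalues in an extension are therefore reached through \<open>ev\<close> and
  \<open>map_matrix\<close>, and conjugating maps arise as functionals \<open>comb u\<close> with
  values in the extension, rewritten in coordinates. Conjugacy inside the tori is decided by a few
  invariants: vanishing products of factors \<open>A - mat a\<close>, the determinant, and the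
  characteristic polynomial at a point of the small field or of an extension. The coefficients of
  the correction terms have a common origin: on the classes \<open>Cabc\<close>, \<open>Cka\<close>,
  \<open>Cz\<close> the functions \<open>chi_one triv\<close>, \<open>chi_q2q F triv\<close>,
  \<open>chi_q3 F triv\<close> take the values of the trivial, the two-dimensional and the sign
  character of the symmetric group on three letters at the identity, a transposition and a
  3-cycle.\<close>

lemma finite_field_power_card:
  fixes x :: "'a::{field,finite}"
  shows "x ^ CARD('a) = x"
proof (cases "x = 0")
  case False
  let ?U = "UNIV - {0::'a}"
  have "bij_betw ((*) x) ?U ?U"
    by (rule bij_betw_byWitness[where f' = "\<lambda>y. y / x"]) (use False in auto)
  then have "(\<Prod>y\<in>?U. y) = (\<Prod>y\<in>?U. x * y)"
    by (rule prod.reindex_bij_betw[symmetric])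
  also have "\<dots> = x ^ (CARD('a) - 1) * (\<Prod>y\<in>?U. y)"
    by (simp add: prod.distrib)
  finally have "x ^ (CARD('a) - 1) = 1" by simp
  then show ?thesis
    using power_minus_mult[of "CARD('a)" x] by simp
qed (simp add: zero_power)

lemma CARD_gt_1: "CARD('a::{field,finite}) > 1"
proof -
  have "card {0, 1 :: 'a} \<le> CARD('a)" by (rule card_mono) auto
  then show ?thesis by simp
qed

text \<open>The degree of the extension stays open, so that the results serve the quadratic and the
  cubic extension and also the identity map, which makes the small field an extension of itself.
  Statements about one degree assume \<open>CARD('l)\<close> separately.\<close>

locale field_ext =
  fixes e :: "'k::{field,finite} \<Rightarrow> 'l::{field,finite}"
    and q :: nat
  assumes embedding: "field_embedding e"
    and q_def: "q = CARD('k)"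
begin

lemma q_gt_1: "q > 1"
  unfolding q_def by (rule CARD_gt_1)

lemma e_1 [simp]: "e 1 = 1" and e_add [simp]: "e (x + y) = e x + e y"
  and e_mult [simp]: "e (x * y) = e x * e y"
  using embedding by (auto simp: field_embedding_def)

lemma e_0 [simp]: "e 0 = 0"
  using e_add[of 0 0] by (metis add_cancel_right_right)

lemma e_minus [simp]: "e (- x) = - e x"
  using e_add[of x "- x"] by (simp del: e_add add: eq_neg_iff_add_eq_0 add.commute)

lemma e_diff [simp]: "e (x - y) = e x - e y"
  using e_add[of x "- y"] by (simp del: e_add)

lemma e_eq_0 [simp]: "e x = 0 \<longleftrightarrow> x = 0"
proof
  assume "e x = 0"
  then have "e (x * inverse x) = 0" by simp
  then show "x = 0" by (metis e_1 right_inverse zero_neq_one)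
qed simp

lemma inj_e: "inj e"
  by (rule injI) (metis e_diff e_eq_0 right_minus_eq)

lemma e_eq [simp]: "e x = e y \<longleftrightarrow> x = y"
  using inj_e by (auto dest: injD)

lemma e_power [simp]: "e (x ^ n) = e x ^ n"
  by (induction n) auto

lemma e_sum: "e (\<Sum>i\<in>A. f i) = (\<Sum>i\<in>A. e (f i))"
  by (induction A rule: infinite_finite_induct) auto

lemma e_inverse [simp]: "e (inverse x) = inverse (e x)"
proof (cases "x = 0")
  case False
  then have "e x * e (inverse x) = 1" by (simp flip: e_mult)
  then show ?thesis by (metis inverse_unique)
qed simp

lemma e_divide [simp]: "e (x / y) = e x / e y"
  by (simp add: divide_inverse)

definition ev :: "'k poly \<Rightarrow> 'l \<Rightarrow> 'l" where "ev p z = poly (map_poly e p) z"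

lemma ev_pCons [simp]: "ev (pCons a p) z = e a + z * ev p z"
  by (simp add: ev_def map_poly_pCons)

lemma ev_0 [simp]: "ev 0 z = 0"
  by (simp add: ev_def)

lemma ev_add [simp]: "ev (p + r) z = ev p z + ev r z"
  by (induction p r rule: poly_induct2) (auto simp: algebra_simps)

lemma ev_smult [simp]: "ev (smult a p) z = e a * ev p z"
  by (induction p) (auto simp: algebra_simps)

lemma ev_mult [simp]: "ev (p * r) z = ev p z * ev r z"
  by (induction p) (auto simp: algebra_simps)

lemma ev_minus [simp]: "ev (- p) z = - ev p z"
  using ev_add[of p "- p" z] by (simp del: ev_add add: eq_neg_iff_add_eq_0 add.commute)

lemma ev_diff [simp]: "ev (p - r) z = ev p z - ev r z"
  using ev_add[of p "- r" z] by (simp del: ev_add)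

lemma ev_1 [simp]: "ev 1 z = 1"
  using ev_pCons[of 1 0 z] by (simp del: ev_pCons add: one_pCons)

lemma ev_power [simp]: "ev (p ^ n) z = ev p z ^ n"
  by (induction n) auto

lemma degree_map_poly_e [simp]: "degree (map_poly e p) = degree p"
  by (rule degree_map_poly) simp

lemma map_poly_e_eq_0 [simp]: "map_poly e p = 0 \<longleftrightarrow> p = 0"
  by (simp add: poly_eq_iff coeff_map_poly)

lemma card_ev_roots:
  assumes "p \<noteq> 0"
  shows "card {z. ev p z = 0} \<le> degree p"
  using card_poly_roots_bound[of "map_poly e p"] assms by (simp add: ev_def)

text \<open>The polynomial \<open>(X + 1)\<^sup>q - X\<^sup>q - 1\<close> over the small field has degree below \<open>q\<close> and vanishes on
  all its \<open>q\<close> elements, so it is zero.\<close>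

lemma power_q_add_1: "(z + 1) ^ q = z ^ q + (1 :: 'l)"
proof -
  let ?P = "[:1, 1:] ^ q - (monom 1 q + 1) :: 'k poly"
  have mon: "monom 1 q = [:0, 1:] ^ q"
    by (simp add: monom_altdef)
  have roots: "poly ?P x = 0" for x
    using finite_field_power_card[of x] finite_field_power_card[of "1 + x"] q_gt_1
    by (simp add: poly_monom add.commute q_def)
  have "?P = 0"
  proof (rule ccontr)
    assume "?P \<noteq> 0"
    have deg: "degree ([:1, 1:] ^ q :: 'k poly) = q"
      by (simp add: degree_power_eq)
    have lead: "coeff ([:1, 1:] ^ q :: 'k poly) q = 1"
      using lead_coeff_power[of "[:1, 1:] :: 'k poly" q] by (simp add: deg)
    have deg1: "degree (monom 1 q + 1 :: 'k poly) = q"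
      using q_gt_1 by (subst degree_add_eq_left) (auto simp: degree_monom_eq)
    have "coeff ?P q = 0"
      using lead q_gt_1 by simp
    moreover have "degree ?P \<le> q"
      by (rule degree_diff_le) (use deg deg1 in auto)
    ultimately have "degree ?P < q"
      using q_gt_1 \<open>?P \<noteq> 0\<close> by (metis le_neq_implies_less leading_coeff_0_iff)
    moreover have "q \<le> degree ?P"
      using card_poly_roots_bound[OF \<open>?P \<noteq> 0\<close>] unfolding roots by (simp add: q_def)
    ultimately show False by simp
  qed
  \<comment> \<open>Being zero as a polynomial, \<open>?P\<close> also vanishes at the points of the
    extension, where the identity is wanted.\<close>
  then have "ev ?P z = 0" by simp
  then show ?thesis by (simp add: mon add.commute)
qed

lemma power_q_add: "(x + y) ^ q = x ^ q + (y ^ q :: 'l)"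
proof (cases "y = 0")
  case False
  have "(x + y) ^ q = (x / y + 1) ^ q * y ^ q"
    using False by (simp add: distrib_right flip: power_mult_distrib)
  also have "\<dots> = x ^ q + y ^ q"
    using False by (simp add: power_q_add_1 power_divide distrib_right)
  finally show ?thesis .
qed (use q_gt_1 in simp)

lemma power_q_e [simp]: "e c ^ q = e c"
  by (metis e_power finite_field_power_card q_def)

text \<open>\<open>X ^ q - X\<close> has at most \<open>q\<close> roots, and the small field already
  supplies \<open>q\<close> of them.\<close>

lemma power_q_eq_iff: "(z :: 'l) ^ q = z \<longleftrightarrow> z \<in> range e"
proof -
  let ?p = "[:0, 1:] ^ q - [:0, 1:] :: 'k poly"
  have ev: "ev ?p z = z ^ q - z" for z :: 'l by simp
  have c: "coeff ?p q = 1"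
    using q_gt_1 monom_altdef[of "1 :: 'k" q] by (simp add: coeff_pCons flip: monom_altdef split: nat.split)
  then have nz: "?p \<noteq> 0" by auto
  have deg: "degree ?p \<le> q"
    using q_gt_1 by (intro degree_diff_le) (auto simp: degree_power_eq)
  have "card {z. ev ?p z = 0} \<le> q"
    using card_ev_roots[OF nz] deg by (rule order_trans)
  then have le: "card {z :: 'l. z ^ q = z} \<le> q"
    by (simp only: ev right_minus_eq)
  have sub: "range e \<subseteq> {z :: 'l. z ^ q = z}" by auto
  have "card (range e) = q" by (simp add: card_image inj_e q_def)
  then have "range e = {z :: 'l. z ^ q = z}"
    using le sub by (intro card_seteq) auto
  then show ?thesis by auto
qed

lemma power_q_power_q: "(z ^ q) ^ q = z ^ (q ^ 2)" for z :: 'l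
  by (simp add: power2_eq_square power_mult)

lemma power_q_cube: "((z ^ q) ^ q) ^ q = z ^ (q ^ 3)" for z :: 'l
  by (simp add: power3_eq_cube power_mult)

lemma power_q_minus: "(- x) ^ q = - (x ^ q)" for x :: 'l
  using power_q_add[of x "- x"] q_gt_1 by (simp add: eq_neg_iff_add_eq_0 add.commute zero_power)

lemma power_q_diff: "(x - y) ^ q = x ^ q - y ^ q" for x y :: 'l
  using power_q_add[of x "- y"] by (simp add: power_q_minus)

lemma power_q_sum: "(\<Sum>i\<in>A. f i) ^ q = (\<Sum>i\<in>A. f i ^ q)" for f :: "'i \<Rightarrow> 'l"
  using q_gt_1 by (induction A rule: infinite_finite_induct) (auto simp: power_q_add)

lemma power_q_inj: "x ^ q = y ^ q \<longleftrightarrow> x = y" for x y :: 'l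
  by (metis power_q_diff eq_iff_diff_eq_0 power_eq_0_iff)

text \<open>Fermat's little theorem in \<open>k[X]/(p)\<close>, by multiplying together all non-zero residues.\<close>

lemma irreducible_dvd_X_power:
  fixes p :: "'k poly"
  assumes irr: "irreducible p" and d: "degree p = d" "d > 0"
  shows "p dvd [:0, 1:] ^ q ^ d - [:0, 1:]"
\<comment> \<open>The product argument needs \<open>X\<close> to be invertible modulo
  \<open>p\<close>; when \<open>p\<close> divides \<open>X\<close>, both terms are divisible by
  \<open>p\<close>.\<close>
proof (cases "p dvd [:0, 1:]")
  case True
  have "q ^ d > 0" using q_gt_1 by simp
  then have "[:0, 1:] dvd ([:0, 1:] ^ q ^ d :: 'k poly)" by (intro dvd_power) auto
  with True show ?thesis by (meson dvd_diff dvd_trans)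
next
  case False
  let ?X = "[:0, 1:] :: 'k poly"
  have prime: "prime_elem p"
    using irr by (rule field_poly_irreducible_imp_prime)
  \<comment> \<open>A system of representatives modulo \<open>p\<close>; lists of \<open>d\<close>
    coefficients show that it has \<open>q ^ d\<close> elements.\<close>
  define S where "S = {f :: 'k poly. degree f < d}"
  have S_bij: "bij_betw (\<lambda>f. map (coeff f) [0..<d]) S {xs :: 'k list. length xs = d}"
  proof (rule bij_betw_byWitness[where f' = Poly])
    show "\<forall>f\<in>S. Poly (map (coeff f) [0..<d]) = f"
    proof
      fix f assume "f \<in> S"
      then show "Poly (map (coeff f) [0..<d]) = f"
        by (auto simp: poly_eq_iff S_def nth_default_def coeff_eq_0)
    qed
    show "\<forall>xs\<in>{xs. length xs = d}. map (coeff (Poly xs)) [0..<d] = xs"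
      by (auto intro!: nth_equalityI simp: nth_default_def)
    show "Poly ` {xs. length xs = d} \<subseteq> S"
    proof
      fix f assume "f \<in> Poly ` {xs :: 'k list. length xs = d}"
      then obtain xs where "f = Poly xs" "length xs = d" by auto
      then have "degree f \<le> d - 1"
        by (intro degree_le) (auto simp: nth_default_def)
      then show "f \<in> S" using d by (auto simp: S_def)
    qed
  qed auto
  have cardS: "card S = q ^ d"
    using bij_betw_same_card[OF S_bij] card_lists_length_eq[of "UNIV :: 'k set" d]
    by (simp add: q_def)
  have finS: "finite S"
    using bij_betw_finite[OF S_bij] finite_lists_length_eq[of "UNIV :: 'k set" d] by simp
  define U where "U = S - {0}"
  have "0 \<in> S" using d by (simp add: S_def)
  have cardU: "card U = q ^ d - 1" and finU: "finite U"
    using cardS finS \<open>0 \<in> S\<close> by (auto simp: U_def)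
  have p0: "p \<noteq> 0" using irr by auto
  have notdvd: "\<not> p dvd f" if "f \<in> U" for f
    using that d dvd_imp_degree_le[of p f] by (auto simp: U_def S_def)
  \<comment> \<open>Multiplication by \<open>X\<close> on residues. It permutes the non-zero ones
    because \<open>p\<close> is prime and does not divide \<open>X\<close>.\<close>
  define g where "g = (\<lambda>f. ?X * f mod p)"
  have gU: "g f \<in> U" if "f \<in> U" for f
  proof -
    have "\<not> p dvd ?X * f"
      using False notdvd[OF that] prime_elem_dvd_multD[OF prime] by blast
    then have "g f \<noteq> 0" by (auto simp: g_def mod_eq_0_iff_dvd)
    then show ?thesis
      using degree_mod_less[OF p0, of "?X * f"] d by (auto simp: U_def S_def g_def)
  qed
  have inj: "inj_on g U"
  proof (rule inj_onI)
    fix f h assume fh: "f \<in> U" "h \<in> U" "g f = g h"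
    then have "p dvd ?X * f - ?X * h"
      by (simp add: g_def mod_eq_dvd_iff)
    then have "p dvd ?X * (f - h)" by (simp add: right_diff_distrib)
    then have dvd: "p dvd f - h"
      using False prime_elem_dvd_multD[OF prime] by blast
    have "degree (f - h) < d"
      using fh by (intro degree_diff_less) (auto simp: U_def S_def)
    then show "f = h"
      using dvd d dvd_imp_degree_le[of p "f - h"] by fastforce
  qed
  have bij: "bij_betw g U U"
    unfolding bij_betw_def using inj gU finU by (meson endo_inj_surj image_subsetI)
  have "(\<Prod>f\<in>U. f) mod p = (\<Prod>f\<in>U. g f) mod p"
    by (subst prod.reindex_bij_betw[OF bij]) simp
  also have "\<dots> = (\<Prod>f\<in>U. ?X * f) mod p"
    unfolding g_def by (rule mod_prod_eq)
  also have "\<dots> = (?X ^ (q ^ d - 1) * (\<Prod>f\<in>U. f)) mod p"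
    by (simp only: prod.distrib prod_constant cardU)
  finally have "p dvd (\<Prod>f\<in>U. f) - ?X ^ (q ^ d - 1) * (\<Prod>f\<in>U. f)"
    by (simp only: mod_eq_dvd_iff)
  then have "p dvd (1 - ?X ^ (q ^ d - 1)) * (\<Prod>f\<in>U. f)"
    by (simp only: left_diff_distrib mult_1)
  moreover have "\<not> p dvd (\<Prod>f\<in>U. f)"
    using finU notdvd
  proof (induction U rule: finite_induct)
    case empty
    then show ?case using irr by (simp add: irreducible_def)
  next
    case (insert f A)
    then show ?case using prime_elem_dvd_multD[OF prime] by auto
  qed
  ultimately have "p dvd 1 - ?X ^ (q ^ d - 1)"
    using prime_elem_dvd_multD[OF prime] by blast
  then have "p dvd (1 - ?X ^ (q ^ d - 1)) * (- ?X)" by (rule dvd_mult2)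
  also have "(1 - ?X ^ (q ^ d - 1)) * (- ?X) = ?X ^ (q ^ d) - ?X"
  proof -
    have "(1 - Y) * (- X) = Y * X - X" for X Y :: "'k poly"
      by (simp add: algebra_simps)
    moreover have "?X ^ (q ^ d - 1) * ?X = ?X ^ (q ^ d)"
      using q_gt_1 by (intro power_minus_mult) simp
    ultimately show ?thesis by metis
  qed
  finally show ?thesis .
qed

text \<open>Write \<open>X ^ (q ^ d) - X\<close> as \<open>p * h\<close>; it vanishes at all
  \<open>q ^ d\<close> points of the extension. If \<open>p\<close> had no root there, all these
  points would be roots of \<open>h\<close>, whose degree is only \<open>q ^ d - d\<close>.\<close>

lemma irreducible_has_root:
  fixes p :: "'k poly"
  assumes irr: "irreducible p" and d: "degree p = d" "d > 0" and card: "CARD('l) = q ^ d"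
  shows "\<exists>z. ev p z = 0"
proof (rule ccontr)
  assume no_root: "\<nexists>z. ev p z = 0"
  let ?P = "[:0, 1:] ^ q ^ d - [:0, 1:] :: 'k poly"
  obtain h where h: "?P = p * h"
    using irreducible_dvd_X_power[OF irr d] by (auto simp: dvd_def)
  have "q ^ d > 1" using q_gt_1 d one_less_power by blast
  then have degP: "degree ?P = q ^ d"
    by (subst diff_conv_add_uminus, subst degree_add_eq_left) (simp_all add: degree_power_eq)
  then have h0: "h \<noteq> 0" using h \<open>q ^ d > 1\<close> by (metis degree_0 mult_zero_right not_one_less_zero)
  have "ev ?P z = 0" for z
    using finite_field_power_card[of z] card by simp
  then have "ev p z * ev h z = 0" for z
    by (metis h ev_mult)
  then have "{z. ev h z = 0} = UNIV"
    using no_root by auto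
  then have "q ^ d \<le> degree h"
    using card_ev_roots[OF h0] card by simp
  moreover have "q ^ d = d + degree h"
    using degP h h0 irr d by (metis degree_mult_eq irreducible_def)
  ultimately show False using d by simp
qed

end

lemma irreducible_if_no_roots:
  fixes p :: "'k::field poly"
  assumes d: "degree p = 2 \<or> degree p = 3" and nr: "\<And>a. poly p a \<noteq> 0"
  shows "irreducible p"
proof (rule irreducibleI)
  show "p \<noteq> 0" using d by auto
  show "\<not> p dvd 1" using d by (auto simp: is_unit_iff_degree[OF \<open>p \<noteq> 0\<close>])
  fix a b assume ab: "p = a * b"
  then have nz: "a \<noteq> 0" "b \<noteq> 0" using \<open>p \<noteq> 0\<close> by auto
  have root: "\<exists>x. poly r x = 0" if "degree r = 1" for r :: "'k poly"
  proof -
    obtain u v where "r = [:u, v:]" "v \<noteq> 0" using degree1_coeffs[OF \<open>degree r = 1\<close>] by metis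
    then have "poly r (- u / v) = 0" by simp
    then show ?thesis ..
  qed
  have "degree a \<noteq> 1" "degree b \<noteq> 1" using root nr ab by auto
  moreover have "degree a + degree b = degree p" using ab nz by (simp add: degree_mult_eq)
  ultimately have "degree a = 0 \<or> degree b = 0" using d by linarith
  then show "a dvd 1 \<or> b dvd 1" using nz by (auto simp: is_unit_iff_degree)
qed

section \<open>Conjugacy and matrices of multiplication\<close>

lemma matrix_inv_works:
  assumes "invertible A"
  shows "A ** matrix_inv A = mat 1" "matrix_inv A ** A = mat 1"
proof -
  have "\<exists>A'. A ** A' = mat 1 \<and> A' ** A = mat 1"
    using assms by (simp add: invertible_def)
  then have "A ** matrix_inv A = mat 1 \<and> matrix_inv A ** A = mat 1"
    unfolding matrix_inv_def by (rule someI_ex)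
  then show "A ** matrix_inv A = mat 1" "matrix_inv A ** A = mat 1" by auto
qed

lemma det_0_kernel:
  fixes A :: "'a::field^'n^'n"
  assumes "det A = 0"
  shows "\<exists>v. v \<noteq> 0 \<and> A *v v = 0"
  using assms invertible_det_nz[of A] invertible_left_inverse[of A] matrix_left_invertible_ker[of A] by auto

lemma matrix_diff_ldistrib: "A ** (B - C) = A ** B - A ** (C :: 'a::ring_1^'n^'m)"
  by (simp add: matrix_matrix_mult_def vec_eq_iff sum_subtractf right_diff_distrib)

lemma matrix_diff_rdistrib: "(A - B) ** C = A ** C - B ** (C :: 'a::ring_1^'n^'m)"
  by (simp add: matrix_matrix_mult_def vec_eq_iff sum_subtractf left_diff_distrib)

lemma mat_mult_entry: "(mat c ** A) $ i $ j = c * A $ i $ j"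
  by (simp add: matrix_matrix_mult_def mat_def if_distrib[where f = "\<lambda>x. x * _"] cong: if_cong)

lemma mult_mat_entry: "(A ** mat c) $ i $ j = A $ i $ j * c"
  by (simp add: matrix_matrix_mult_def mat_def if_distrib[where f = "\<lambda>x. _ * x"] cong: if_cong)

lemma mat_commute: "mat c ** A = A ** mat (c :: 'a::comm_semiring_1)"
  by (simp add: vec_eq_iff mat_mult_entry mult_mat_entry mult.commute)

lemma mat_vector: "mat c *v v = c *s v"
  by (simp add: matrix_vector_mult_def mat_def vec_eq_iff if_distrib[where f = "\<lambda>x. x * _"] cong: if_cong)

lemma det_GL3: "A \<in> GL3 \<longleftrightarrow> det A \<noteq> 0"
  by (simp add: GL3_def invertible_det_nz)

lemma GL3_mult: "A \<in> GL3 \<Longrightarrow> B \<in> GL3 \<Longrightarrow> A ** B \<in> GL3"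
  by (simp add: det_GL3 det_mul)

lemma GL3_inv:
  assumes "P \<in> GL3"
  shows "P ** matrix_inv P = mat 1" "matrix_inv P ** P = mat 1" "matrix_inv P \<in> GL3"
proof -
  show 1: "P ** matrix_inv P = mat 1" "matrix_inv P ** P = mat 1"
    using assms matrix_inv_works by (auto simp: GL3_def)
  then show "matrix_inv P \<in> GL3"
    by (auto simp: GL3_def invertible_def)
qed

lemma GL3_cancel:
  assumes "P \<in> GL3"
  shows "A ** P = B ** P \<longleftrightarrow> A = B" "P ** A = P ** B \<longleftrightarrow> A = B"
proof -
  note inv = GL3_inv[OF assms]
  show "A ** P = B ** P \<longleftrightarrow> A = B"
  proof
    assume "A ** P = B ** P"
    then have "(A ** P) ** matrix_inv P = (B ** P) ** matrix_inv P" by simp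
    then show "A = B" by (simp add: inv flip: matrix_mul_assoc)
  qed simp
  show "P ** A = P ** B \<longleftrightarrow> A = B"
  proof
    assume "P ** A = P ** B"
    then have "matrix_inv P ** (P ** A) = matrix_inv P ** (P ** B)" by simp
    then show "A = B" by (simp add: inv matrix_mul_assoc)
  qed simp
qed

text \<open>The inverse-free form: a conjugator can be verified by its determinant and one matrix
  identity, and conjugators compose by multiplication.\<close>

lemma GL3_conj_iff: "GL3_conj A B \<longleftrightarrow> (\<exists>P\<in>GL3. A ** P = P ** B)"
proof
  assume "GL3_conj A B"
  then obtain P where P: "P \<in> GL3" "A = P ** B ** matrix_inv P" by (auto simp: GL3_conj_def)
  then have "A ** P = P ** B" using GL3_inv[OF P(1)] by (simp flip: matrix_mul_assoc)
  with P show "\<exists>P\<in>GL3. A ** P = P ** B" by auto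
next
  assume "\<exists>P\<in>GL3. A ** P = P ** B"
  then obtain P where P: "P \<in> GL3" "A ** P = P ** B" by auto
  then have "A = P ** B ** matrix_inv P"
    using GL3_inv[OF P(1)] by (metis matrix_mul_assoc matrix_mul_rid)
  with P show "GL3_conj A B" by (auto simp: GL3_conj_def)
qed

lemma GL3_conj_left: "P \<in> GL3 \<Longrightarrow> P ** A = B ** P \<Longrightarrow> GL3_conj A B"
  unfolding GL3_conj_iff
  by (rule bexI[of _ "matrix_inv P"])
    (metis GL3_inv(1,2) matrix_mul_assoc matrix_mul_lid matrix_mul_rid, simp add: GL3_inv)

lemma GL3_conj_refl: "GL3_conj A A"
  unfolding GL3_conj_iff by (rule bexI[of _ "mat 1"]) (auto simp: det_GL3)

lemma GL3_conj_sym: "GL3_conj A B \<Longrightarrow> GL3_conj B A"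
  by (metis GL3_conj_iff GL3_conj_left)

lemma GL3_conj_trans: "GL3_conj A B \<Longrightarrow> GL3_conj B C \<Longrightarrow> GL3_conj A C"
  unfolding GL3_conj_iff by (metis GL3_mult matrix_mul_assoc)

lemma GL3_conj_det: "GL3_conj A B \<Longrightarrow> det A = det B"
  unfolding GL3_conj_iff by (auto simp: det_GL3) (metis det_mul mult.commute mult_left_cancel)

lemma GL3_conj_GL3: "GL3_conj A B \<Longrightarrow> A \<in> GL3 \<longleftrightarrow> B \<in> GL3"
  by (simp add: det_GL3 GL3_conj_det)

lemma GL3_conj_mat_iff: "GL3_conj A (mat c) \<longleftrightarrow> A = mat c"
proof
  assume "GL3_conj A (mat c)"
  then obtain P where "P \<in> GL3" "A ** P = mat c ** P"
    by (auto simp: GL3_conj_iff mat_commute)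
  then show "A = mat c"
    by (simp add: GL3_cancel)
qed (simp add: GL3_conj_refl)

lemma GL3_conj_shift: "GL3_conj A B \<Longrightarrow> GL3_conj (A - mat c) (B - mat c)"
  unfolding GL3_conj_iff by (auto simp: matrix_diff_ldistrib matrix_diff_rdistrib mat_commute)

lemma GL3_conj_mult_eq_0:
  assumes "P \<in> GL3" "A ** P = P ** B" "A' ** P = P ** B'"
  shows "(A ** A') ** P = P ** (B ** B')" "A = 0 \<longleftrightarrow> B = 0"
proof -
  show "(A ** A') ** P = P ** (B ** B')"
    using assms by (metis matrix_mul_assoc)
  have "A = 0 \<longleftrightarrow> A ** P = 0 ** P"
    using GL3_cancel(1)[OF assms(1)] by blast
  also have "\<dots> \<longleftrightarrow> P ** B = P ** 0"
    by (simp add: assms(2))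
  also have "\<dots> \<longleftrightarrow> B = 0"
    using GL3_cancel(2)[OF assms(1)] by blast
  finally show "A = 0 \<longleftrightarrow> B = 0" .
qed

text \<open>Conjugate matrices satisfy the same polynomial equations. Products of two or three
  linear factors are one of the invariants by which the classes are told apart.\<close>

lemma GL3_conj_product:
  assumes "GL3_conj A B"
  shows "(A - mat a) ** (A - mat b) = 0 \<longleftrightarrow> (B - mat a) ** (B - mat b) = 0"
    and "(A - mat a) ** (A - mat b) ** (A - mat c) = 0
      \<longleftrightarrow> (B - mat a) ** (B - mat b) ** (B - mat c) = 0"
proof -
  obtain P where P: "P \<in> GL3" "A ** P = P ** B" using assms by (auto simp: GL3_conj_iff)
  have s: "(A - mat x) ** P = P ** (B - mat x)" for x
    using P by (simp add: matrix_diff_ldistrib matrix_diff_rdistrib mat_commute)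
  note t = GL3_conj_mult_eq_0[OF P(1)]
  show "(A - mat a) ** (A - mat b) = 0 \<longleftrightarrow> (B - mat a) ** (B - mat b) = 0"
    using t(2)[OF t(1)[OF s s] P(2)] .
  show "(A - mat a) ** (A - mat b) ** (A - mat c) = 0
      \<longleftrightarrow> (B - mat a) ** (B - mat b) ** (B - mat c) = 0"
    using t(2)[OF t(1)[OF t(1)[OF s s] s] P(2)] .
qed

lemma matrix_3_eq_iff:
  "A = (B :: 'a^3^3) \<longleftrightarrow> A$1$1 = B$1$1 \<and> A$1$2 = B$1$2 \<and> A$1$3 = B$1$3 \<and>
     A$2$1 = B$2$1 \<and> A$2$2 = B$2$2 \<and> A$2$3 = B$2$3 \<and>
     A$3$1 = B$3$1 \<and> A$3$2 = B$3$2 \<and> A$3$3 = B$3$3"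
  by (auto simp: vec_eq_iff forall_3)

lemma matrix_2_eq_iff:
  "A = (B :: 'a^2^2) \<longleftrightarrow> A$1$1 = B$1$1 \<and> A$1$2 = B$1$2 \<and> A$2$1 = B$2$1 \<and> A$2$2 = B$2$2"
  by (auto simp: vec_eq_iff forall_2)

lemma mult_3_entry: "((A :: 'a::semiring_1^3^3) ** B)$i$j = A$i$1 * B$1$j + A$i$2 * B$2$j + A$i$3 * B$3$j"
  by (simp add: matrix_matrix_mult_def sum_3)

lemma mult_2_entry: "((A :: 'a::semiring_1^2^2) ** B)$i$j = A$i$1 * B$1$j + A$i$2 * B$2$j"
  by (simp add: matrix_matrix_mult_def sum_2)

lemma matvec_3_entry: "((A :: 'a::semiring_1^3^3) *v v)$i = A$i$1 * v$1 + A$i$2 * v$2 + A$i$3 * v$3"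
  by (simp add: matrix_vector_mult_def sum_3)

lemma matvec_2_entry: "((A :: 'a::semiring_1^2^2) *v v)$i = A$i$1 * v$1 + A$i$2 * v$2"
  by (simp add: matrix_vector_mult_def sum_2)

lemma mat_entries: "(mat c)$i$j = (if i = j then c else 0)"
  by (simp add: mat_def)

lemma block_diag_entries [simp]:
  "(block_diag M a)$1$1 = M$1$1" "(block_diag M a)$1$2 = M$1$2" "(block_diag M a)$1$3 = 0"
  "(block_diag M a)$2$1 = M$2$1" "(block_diag M a)$2$2 = M$2$2" "(block_diag M a)$2$3 = 0"
  "(block_diag M a)$3$1 = 0" "(block_diag M a)$3$2 = 0" "(block_diag M a)$3$3 = a"
  by (simp_all add: block_diag_def)

lemma block_diag_eq_iff: "block_diag M a = block_diag N b \<longleftrightarrow> M = N \<and> a = b"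
  by (auto simp: matrix_3_eq_iff matrix_2_eq_iff)

lemma block_diag_mult: "block_diag M a ** block_diag N b = block_diag (M ** N) (a * b)"
  for M :: "'a::semiring_1^2^2"
  by (simp add: matrix_3_eq_iff mult_3_entry mult_2_entry)

lemma block_diag_mat: "block_diag (mat c) c = mat c"
  by (simp add: matrix_3_eq_iff mat_entries)

lemma block_diag_diff: "block_diag M a - block_diag N b = block_diag (M - N) (a - b)"
  for M :: "'a::ring_1^2^2"
  by (simp add: matrix_3_eq_iff)

lemma det_block_diag: "det (block_diag M a) = det M * (a :: 'a::comm_ring_1)"
  by (simp add: det_2 det_3 algebra_simps)

lemma block_diag_0: "block_diag M a = 0 \<longleftrightarrow> M = 0 \<and> a = (0 :: 'a::zero)"
  by (auto simp: matrix_3_eq_iff matrix_2_eq_iff)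

section \<open>Coordinates over the small field, matrices of multiplication, and Frobenius\<close>

context field_ext
begin

lemma map_mult: "map_matrix e (A ** B) = map_matrix e A ** map_matrix e B"
  by (simp add: vec_eq_iff matrix_matrix_mult_def e_sum)

lemma map_mat [simp]: "map_matrix e (mat c) = mat (e c)"
  by (simp add: vec_eq_iff mat_def)

lemma det_map_3: "det (map_matrix e A) = e (det (A :: 'k^3^3))"
  by (simp add: det_3)

text \<open>Compares characteristic polynomials at a point of the extension, where the eigenvalues
  of non-split matrices lie.\<close>

lemma GL3_conj_map_det:
  assumes "GL3_conj A B"
  shows "det (mat z - map_matrix e A) = det (mat z - map_matrix e B)"
proof -
  obtain P where P: "P \<in> GL3" "A ** P = P ** B" using assms by (auto simp: GL3_conj_iff)
  let ?P = "map_matrix e P"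
  have "(mat z - map_matrix e A) ** ?P = ?P ** (mat z - map_matrix e B)"
    using P(2) by (simp add: matrix_diff_ldistrib matrix_diff_rdistrib mat_commute flip: map_mult)
  moreover have "det ?P \<noteq> 0" using P(1) by (simp add: det_GL3 det_map_3)
  ultimately show ?thesis
    by (metis det_mul mult.commute mult_left_cancel)
qed

text \<open>Serves two purposes. If \<open>b\<close> is a basis, it turns coordinates into elements
  of the extension; for an arbitrary \<open>b\<close> it is the general functional on
  \<open>'k^'n\<close>, linear over the small field, with values in the extension.\<close>

definition comb :: "'l^'n \<Rightarrow> 'k^'n \<Rightarrow> 'l" where
  "comb b v = (\<Sum>i\<in>UNIV. e (v $ i) * b $ i)"

lemma comb_add: "comb b (v + w) = comb b v + comb b w"
  by (simp add: comb_def sum.distrib distrib_right)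

lemma comb_diff: "comb b (v - w) = comb b v - comb b w"
  by (simp add: comb_def sum_subtractf left_diff_distrib)

lemma comb_scale: "comb b (c *s v) = e c * comb b v"
  by (simp add: comb_def sum_distrib_left mult.assoc)

lemma comb_axis: "comb b (axis j 1) = b $ j"
  by (simp add: comb_def axis_def if_distrib[where f = "\<lambda>x. e x"] if_distrib[where f = "\<lambda>x. x * _"] cong: if_cong)

lemma bij_combI:
  fixes b :: "'l^'n"
  assumes card: "CARD('l) = q ^ CARD('n)" and ker: "\<And>v. comb b v = 0 \<Longrightarrow> v = 0"
  shows "bij (comb b)"
proof -
  have inj: "inj (comb b)"
    by (rule injI) (metis comb_diff ker right_minus_eq)
  have "CARD('k^'n) = CARD('l)"
    using card by (simp add: q_def)
  then have "range (comb b) = UNIV"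
    using inj by (intro card_subset_eq) (auto simp: card_image)
  with inj show ?thesis by (simp add: bij_def)
qed

lemma comb_matvec: "comb b (M *v v) = comb (\<chi> j. comb b (column j M)) v"
proof -
  have "comb b (M *v v) = (\<Sum>i\<in>UNIV. \<Sum>j\<in>UNIV. e (M $ i $ j) * e (v $ j) * b $ i)"
    by (simp add: comb_def matrix_vector_mult_def e_sum sum_distrib_right)
  also have "\<dots> = (\<Sum>j\<in>UNIV. \<Sum>i\<in>UNIV. e (M $ i $ j) * e (v $ j) * b $ i)"
    by (rule sum.swap)
  also have "\<dots> = comb (\<chi> j. comb b (column j M)) v"
    by (simp add: comb_def column_def sum_distrib_left mult_ac)
  finally show ?thesis .
qed

lemma comb_mult_left: "w * comb b v = comb (\<chi> j. w * b $ j) v"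
  by (simp add: comb_def sum_distrib_left mult_ac)

text \<open>The assumption says that \<open>b\<close> is a basis of the extension over the small
  field.\<close>

context
  fixes b :: "'l^'n"
  assumes bij: "bij (comb b)"
begin

lemma comb_eq_iff: "comb b v = comb b w \<longleftrightarrow> v = w"
  using bij by (auto simp: bij_def dest: injD)

lemma mult_matrix_ex1: "\<exists>!M. \<forall>j. w * b $ j = (\<Sum>i\<in>UNIV. e (M $ i $ j) * b $ i)"
proof -
  have eq: "(\<Sum>i\<in>UNIV. e (M $ i $ j) * b $ i) = comb b (column j M)" for M :: "'k^'n^'n" and j
    by (simp add: comb_def column_def)
  define c where "c = (\<lambda>x. inv (comb b) x)"
  have c: "comb b (c x) = x" for x
    using bij by (simp add: c_def surj_f_inv_f bij_is_surj)
  define M :: "'k^'n^'n" where "M = (\<chi> i j. c (w * b $ j) $ i)"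
  have col: "column j M = c (w * b $ j)" for j
    by (simp add: M_def column_def vec_eq_iff)
  show ?thesis unfolding eq
  proof (rule ex1I[of _ M])
    show "\<forall>j. w * b $ j = comb b (column j M)" by (simp add: col c)
    fix N :: "'k^'n^'n" assume "\<forall>j. w * b $ j = comb b (column j N)"
    then have "column j N = column j M" for j
      using c col by (metis comb_eq_iff)
    then show "N = M" by (simp add: column_def vec_eq_iff)
  qed
qed

lemma comb_mult_matrix: "comb b (mult_matrix e b w *v v) = w * comb b v"
proof -
  have "\<forall>j. w * b $ j = (\<Sum>i\<in>UNIV. e (mult_matrix e b w $ i $ j) * b $ i)"
    unfolding mult_matrix_def by (rule theI'[OF mult_matrix_ex1])
  then have "comb b (column j (mult_matrix e b w)) = w * b $ j" for j
    by (simp add: comb_def column_def)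
  then show ?thesis
    by (simp add: comb_matvec comb_mult_left)
qed

text \<open>Replaces the definition by \<open>THE\<close>: the multiplication matrix is the one that
  \<open>comb b\<close> intertwines with multiplication. The homomorphism laws below are
  instances.\<close>

lemma mult_matrix_eqI:
  assumes "\<And>v. comb b (M *v v) = w * comb b v"
  shows "M = mult_matrix e b w"
proof -
  have "M *v v = mult_matrix e b w *v v" for v
    using assms comb_mult_matrix comb_eq_iff by metis
  then show ?thesis by (simp add: matrix_eq)
qed

lemma mult_matrix_mult: "mult_matrix e b (x * y) = mult_matrix e b x ** mult_matrix e b y"
  by (rule mult_matrix_eqI[symmetric]) (simp add: comb_mult_matrix flip: matrix_vector_mul_assoc)

lemma mult_matrix_diff: "mult_matrix e b (x - y) = mult_matrix e b x - mult_matrix e b y"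
  by (rule mult_matrix_eqI[symmetric])
    (simp add: comb_mult_matrix comb_diff matrix_vector_mult_diff_rdistrib left_diff_distrib)

lemma mult_matrix_e: "mult_matrix e b (e c) = mat c"
  by (rule mult_matrix_eqI[symmetric]) (simp add: mat_vector comb_scale)

lemma mult_matrix_eq_iff: "mult_matrix e b x = mult_matrix e b y \<longleftrightarrow> x = y"
proof
  assume "mult_matrix e b x = mult_matrix e b y"
  then have "x * comb b v = y * comb b v" for v
    by (metis comb_mult_matrix)
  moreover obtain v where "comb b v = 1"
    using bij by (metis bij_pointE)
  ultimately show "x = y" by (metis mult.right_neutral)
qed simp

lemma mult_matrix_0: "mult_matrix e b x = 0 \<longleftrightarrow> x = 0"
  using mult_matrix_eq_iff[of x 0] mult_matrix_diff[of 0 0] by simp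

lemma mult_matrix_mat_iff: "mult_matrix e b x = mat c \<longleftrightarrow> x = e c"
  by (metis mult_matrix_e mult_matrix_eq_iff)

text \<open>Frobenius is linear over the small field. \<open>P\<close> is its matrix in the basis
  \<open>b\<close>, and the intertwining relation is multiplicativity of the \<open>q\<close>-th
  power; \<open>Q\<close> exists because \<open>y ^ q = 0\<close> only for
  \<open>y = 0\<close>.\<close>

lemma mult_matrix_power_q:
  "\<exists>P Q. P ** Q = mat 1 \<and> Q ** P = mat 1 \<and> (\<forall>x. P ** mult_matrix e b x = mult_matrix e b (x ^ q) ** P)"
proof -
  define f where "f = (\<lambda>v. inv (comb b) (comb b v ^ q))"
  have cf: "comb b (f v) = comb b v ^ q" for v
    using bij by (simp add: f_def surj_f_inv_f bij_is_surj)
  define P :: "'k^'n^'n" where "P = (\<chi> i j. f (axis j 1) $ i)"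
  have col: "column j P = f (axis j 1)" for j
    by (simp add: P_def column_def vec_eq_iff)
  have P: "comb b (P *v v) = comb b v ^ q" for v
  proof -
    have "comb b (P *v v) = (\<Sum>j\<in>UNIV. e (v $ j) * (b $ j) ^ q)"
      unfolding comb_matvec by (simp add: col cf comb_axis) (simp add: comb_def)
    also have "\<dots> = comb b v ^ q"
      by (simp add: comb_def power_q_sum power_mult_distrib)
    finally show ?thesis .
  qed
  have "P *v x = 0 \<Longrightarrow> x = 0" for x
  proof -
    assume "P *v x = 0"
    then have "comb b x ^ q = 0" using P[of x] by (simp add: comb_def)
    then have "comb b x = comb b 0" by (simp add: comb_def)
    then show "x = 0" by (simp only: comb_eq_iff)
  qed
  then obtain Q where "Q ** P = mat 1"
    using matrix_left_invertible_ker[of P] by auto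
  then have Q: "P ** Q = mat 1" "Q ** P = mat 1"
    using matrix_left_right_inverse by auto
  have "P ** mult_matrix e b x = mult_matrix e b (x ^ q) ** P" for x
  proof -
    have "comb b (P ** mult_matrix e b x *v v) = comb b (mult_matrix e b (x ^ q) ** P *v v)" for v
      by (simp add: P comb_mult_matrix power_mult_distrib flip: matrix_vector_mul_assoc)
    then show ?thesis by (simp add: comb_eq_iff matrix_eq)
  qed
  with Q show ?thesis by blast
qed

text \<open>For \<open>n = 0\<close> this is the relation that defines the matrix. Each application
  of Frobenius raises the basis and \<open>w\<close> to the \<open>q\<close>-th power and fixes the
  entries, which come from the small field.\<close>

lemma mult_matrix_conjugate_row:
  "(\<Sum>i\<in>UNIV. (b $ i) ^ (q ^ n) * e (mult_matrix e b w $ i $ j)) = w ^ (q ^ n) * (b $ j) ^ (q ^ n)"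
proof (induction n)
  case 0
  have "comb b (mult_matrix e b w *v axis j 1) = w * b $ j"
    by (simp add: comb_mult_matrix comb_axis)
  then show ?case
    by (simp add: comb_def matrix_vector_mult_def axis_def if_distrib[where f = "\<lambda>x. _ * x"]
        cong: if_cong) (simp add: mult.commute)
next
  case (Suc n)
  have pq: "x ^ (q ^ Suc n) = (x ^ (q ^ n)) ^ q" for x :: 'l
    by (simp add: mult.commute flip: power_mult)
  have "(\<Sum>i\<in>UNIV. (b $ i) ^ (q ^ Suc n) * e (mult_matrix e b w $ i $ j))
      = (\<Sum>i\<in>UNIV. (b $ i) ^ (q ^ n) * e (mult_matrix e b w $ i $ j)) ^ q"
    unfolding pq power_q_sum by (simp add: power_mult_distrib)
  also have "\<dots> = w ^ (q ^ Suc n) * (b $ j) ^ (q ^ Suc n)"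
    by (simp only: Suc.IH pq power_mult_distrib)
  finally show ?case .
qed

end

lemma independent_2:
  assumes "t \<notin> range e" "e a + e c * t = 0"
  shows "a = 0 \<and> c = 0"
proof (cases "c = 0")
  case False
  then have "t = e (- a / c)" using assms(2) by (simp add: field_simps eq_neg_iff_add_eq_0)
  then show ?thesis using assms(1) by blast
qed (use assms in auto)

text \<open>Three applications of Frobenius give the identity here, so an element fixed by two
  applications is fixed by one, that is, lies in the small field.\<close>

lemma conjugates_3_distinct:
  assumes "CARD('l) = q ^ 3" "t \<notin> range e"
  shows "t ^ q \<noteq> t" "(t ^ q) ^ q \<noteq> t" "(t ^ q) ^ q \<noteq> t ^ q"
proof -
  show 1: "t ^ q \<noteq> t" using assms(2) by (simp add: power_q_eq_iff)
  show "(t ^ q) ^ q \<noteq> t ^ q" using 1 by (simp add: power_q_inj)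
  have "((t ^ q) ^ q) ^ q = t"
    using finite_field_power_card[of t] by (simp add: assms(1) power_q_cube)
  then show "(t ^ q) ^ q \<noteq> t" using 1 by auto
qed

text \<open>A root of a quadratic polynomial over the small field has at most two conjugates, but an
  element of the cubic extension outside the small field has three.\<close>

lemma independent_3:
  assumes card: "CARD('l) = q ^ 3" and t: "t \<notin> range e" and z: "e a + e c * t + e d * t ^ 2 = 0"
  shows "a = 0 \<and> c = 0 \<and> d = 0"
proof (cases "d = 0")
  case True
  then show ?thesis using independent_2[OF t, of a c] z by simp
next
  case False
  let ?f = "\<lambda>x. e a + e c * x + e d * x ^ 2"
  have step: "?f (x ^ q) = 0" if "?f x = 0" for x
  proof -
    have "?f (x ^ q) = (?f x) ^ q"
      by (simp add: power_q_add power_mult_distrib flip: power_mult) (simp add: mult.commute power_mult)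
    then show ?thesis using that q_gt_1 by simp
  qed
  have f: "?f t = 0" "?f (t ^ q) = 0" "?f ((t ^ q) ^ q) = 0"
    using z step by blast+
  \<comment> \<open>The difference quotient of the quadratic. Taken at \<open>t\<close> and each of
    the two other conjugates, it forces these two to coincide.\<close>
  have sub: "(x - y) * (e c + e d * (x + y)) = 0" if "?f x = 0" "?f y = 0" for x y
  proof -
    have "(x - y) * (e c + e d * (x + y)) = ?f x - ?f y" by algebra
    then show ?thesis using that by simp
  qed
  note ne = conjugates_3_distinct[OF card t]
  have "e c + e d * (t + t ^ q) = 0" "e c + e d * (t + (t ^ q) ^ q) = 0"
    using sub[OF f(1) f(2)] sub[OF f(1) f(3)] ne by auto
  moreover have "e d * x = e d * y" if "e c + e d * (t + x) = 0" "e c + e d * (t + y) = 0" for x y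
    using that by algebra
  ultimately have "e d * (t ^ q) = e d * ((t ^ q) ^ q)"
    by blast
  then show ?thesis using False ne by simp
qed

lemma bij_comb_2:
  assumes "CARD('l) = q ^ 2" "t \<notin> range e"
  shows "bij (comb (vector [1, t] :: 'l^2))"
  using assms independent_2[OF assms(2)]
  by (intro bij_combI) (simp_all add: comb_def sum_2 vec_eq_iff forall_2)

lemma bij_comb_3:
  assumes "CARD('l) = q ^ 3" "t \<notin> range e"
  shows "bij (comb (vector [1, t, t ^ 2] :: 'l^3))"
  using assms independent_3[OF assms]
  by (intro bij_combI) (simp_all add: comb_def sum_3 vec_eq_iff forall_3)

text \<open>The small field is itself closed under the field operations, so if it contained
  \<open>t\<close> it would be the whole extension, against \<open>n > 1\<close>. From here on a
  generator enters only as an element outside the small field.\<close>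

lemma not_in_range_if_generates:
  assumes "generates_over e t" "CARD('l) = q ^ n" "n > 1"
  shows "t \<notin> range e"
proof
  assume "t \<in> range e"
  have "range e = UNIV"
  proof (rule assms(1)[unfolded generates_over_def, rule_format], intro conjI ballI)
    fix x y assume "x \<in> range e" "y \<in> range e"
    then obtain a c where "x = e a" "y = e c" by blast
    then have "x - y = e (a - c)" "x * y = e (a * c)" by simp_all
    then show "x - y \<in> range e" "x * y \<in> range e" by blast+
  next
    fix x assume "x \<in> range e"
    then obtain a where "x = e a" by blast
    then have "inverse x = e (inverse a)" by simp
    then show "inverse x \<in> range e" by blast
  qed (use \<open>t \<in> range e\<close> in auto)
  then have "q = CARD('l)"
    using card_image[OF inj_e] by (simp add: q_def)
  then have "q ^ 1 = q ^ n" using assms(2) by simp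
  then have "n = 1" using power_inject_exp[OF q_gt_1, of 1 n] by simp
  then show False using assms(3) by simp
qed

text \<open>The rows of conjugates of the basis are left eigenvectors of the matrix of multiplication, so
  over the extension they diagonalise it.\<close>

lemma det_mult_matrix_2:
  fixes w :: 'l
  assumes card: "CARD('l) = q ^ 2" and t: "t \<notin> range e"
  defines "M \<equiv> mult_matrix e (vector [1, t] :: 'l^2) w"
  shows "det (mat z - map_matrix e M) = (z - w) * (z - w ^ q)"
proof -
  let ?B = "vector [vector [1, t], vector [1, t ^ q]] :: 'l^2^2"
  let ?D = "vector [vector [w, 0], vector [0, w ^ q]] :: 'l^2^2"
  note row = mult_matrix_conjugate_row[OF bij_comb_2[OF card t], of _ w, folded M_def, unfolded sum_2]
  have "?B ** map_matrix e M = ?D ** ?B"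
    using row[of 0 1] row[of 0 2] row[of 1 1] row[of 1 2]
    by (simp add: matrix_2_eq_iff mult_2_entry)
  then have eq: "?B ** (mat z - map_matrix e M) = (mat z - ?D) ** ?B"
    by (simp add: matrix_diff_ldistrib matrix_diff_rdistrib mat_commute)
  have "det ?B * det (mat z - map_matrix e M) = det (mat z - ?D) * det ?B"
    using arg_cong[OF eq, of det] by (simp only: det_mul)
  moreover have "det ?B \<noteq> 0"
    using t by (simp add: det_2 power_q_eq_iff)
  moreover have "det (mat z - ?D) = (z - w) * (z - w ^ q)"
    by (simp add: det_2 mat_entries)
  ultimately show ?thesis
    by (metis mult.commute mult_left_cancel)
qed

lemma det_mult_matrix_3:
  fixes w :: 'l
  assumes card: "CARD('l) = q ^ 3" and t: "t \<notin> range e"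
  defines "M \<equiv> mult_matrix e (vector [1, t, t ^ 2] :: 'l^3) w"
  shows "det (mat z - map_matrix e M) = (z - w) * (z - w ^ q) * (z - w ^ (q ^ 2))"
proof -
  let ?s = "t ^ q" let ?r = "t ^ (q ^ 2)"
  let ?B = "vector [vector [1, t, t ^ 2], vector [1, ?s, ?s ^ 2], vector [1, ?r, ?r ^ 2]] :: 'l^3^3"
  let ?D = "vector [vector [w, 0, 0], vector [0, w ^ q, 0], vector [0, 0, w ^ (q ^ 2)]] :: 'l^3^3"
  have sq: "(t ^ 2) ^ n = (t ^ n) ^ 2" for n :: nat
    by (simp add: mult.commute flip: power_mult)
  note row = mult_matrix_conjugate_row[OF bij_comb_3[OF card t], of _ w, folded M_def, unfolded sum_3]
  have "?B ** map_matrix e M = ?D ** ?B"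
    using row[of 0 1] row[of 0 2] row[of 0 3] row[of 1 1] row[of 1 2] row[of 1 3]
      row[of 2 1] row[of 2 2] row[of 2 3]
    by (simp add: matrix_3_eq_iff mult_3_entry sq)
  then have eq: "?B ** (mat z - map_matrix e M) = (mat z - ?D) ** ?B"
    by (simp add: matrix_diff_ldistrib matrix_diff_rdistrib mat_commute)
  have "det ?B * det (mat z - map_matrix e M) = det (mat z - ?D) * det ?B"
    using arg_cong[OF eq, of det] by (simp only: det_mul)
  moreover have "det (mat z - ?D) = (z - w) * (z - w ^ q) * (z - w ^ (q ^ 2))"
    by (simp add: det_3 mat_entries)
  \<comment> \<open>\<open>?B\<close> is the Vandermonde matrix of the three distinct conjugates of
    \<open>t\<close>.\<close>
  moreover have "det ?B \<noteq> 0"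
  proof -
    have "det (vector [vector [1, x, x ^ 2], vector [1, y, y ^ 2], vector [1, u, u ^ 2]] :: 'l^3^3)
        = (y - x) * (u - x) * (u - y)" for x y u
      unfolding det_3 vector_3 by algebra
    moreover have "?r = (t ^ q) ^ q" by (simp only: power_q_power_q)
    ultimately have "det ?B = (?s - t) * ((t ^ q) ^ q - t) * ((t ^ q) ^ q - ?s)"
      by (simp only:)
    then show ?thesis
      using conjugates_3_distinct[OF card t] by (simp only: mult_eq_0_iff right_minus_eq simp_thms)
  qed
  ultimately show ?thesis
    by (metis mult.commute mult_left_cancel)
qed

end

section \<open>Representatives of the conjugacy classes\<close>

text \<open>The linear coefficient is the sum of the principal minors of order two. The coefficients
  are recorded explicitly because over the field with two elements the values
  \<open>det (mat z - A)\<close> do not determine a monic cubic.\<close>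

definition charpoly3 :: "'a::comm_ring_1^3^3 \<Rightarrow> 'a poly" where
  "charpoly3 A = [: - det A,
     A$1$1 * A$2$2 - A$1$2 * A$2$1 + (A$1$1 * A$3$3 - A$1$3 * A$3$1) + (A$2$2 * A$3$3 - A$2$3 * A$3$2),
     - (A$1$1 + A$2$2 + A$3$3), 1 :]"

lemma poly_charpoly3: "poly (charpoly3 A) z = det (mat z - A)"
  by (simp add: charpoly3_def det_3 mat_entries algebra_simps)

lemma charpoly3_mult_linear:
  "charpoly3 A = [:- a, 1:] * [:- b, 1:] * [:- c, 1:] \<longleftrightarrow>
     A$1$1 + A$2$2 + A$3$3 = a + b + c \<and>
     A$1$1 * A$2$2 - A$1$2 * A$2$1 + (A$1$1 * A$3$3 - A$1$3 * A$3$1) + (A$2$2 * A$3$3 - A$2$3 * A$3$2)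
       = a * b + a * c + b * c \<and> det A = a * b * c"
proof -
  have "[:- a, 1:] * [:- b, 1:] * [:- c, 1:] = [:- (a * b * c), a * b + a * c + b * c, - (a + b + c), 1:]"
    by (simp add: algebra_simps)
  then show ?thesis
    unfolding charpoly3_def by (simp only: pCons_eq_iff neg_equal_iff_equal simp_thms) blast
qed

text \<open>Determinant and trace are invariant, and \<open>det (A - mat 1)\<close> then yields the
  remaining coefficient.\<close>

lemma GL3_conj_charpoly3:
  assumes "GL3_conj A B"
  shows "charpoly3 A = charpoly3 B"
proof -
  have d: "det A = det B" by (rule GL3_conj_det[OF assms])
  obtain P where P: "P \<in> GL3" "A = P ** B ** matrix_inv P"
    using assms by (auto simp: GL3_conj_def)
  have "trace A = trace (matrix_inv P ** (P ** B))"
    unfolding P(2) by (rule trace_mul_sym)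
  also have "\<dots> = trace B"
    using GL3_inv[OF P(1)] by (simp add: matrix_mul_assoc)
  finally have t: "A$1$1 + A$2$2 + A$3$3 = B$1$1 + B$2$2 + B$3$3"
    by (simp add: trace_def sum_3)
  have "det (M - mat 1) = det M - coeff (charpoly3 M) 1 + (M$1$1 + M$2$2 + M$3$3) - 1" for M :: "'a^3^3"
    by (simp add: charpoly3_def det_3 mat_entries algebra_simps)
  then have "coeff (charpoly3 A) 1 = coeff (charpoly3 B) 1"
    using GL3_conj_det[OF GL3_conj_shift[OF assms, of 1]] d t by simp
  then show ?thesis
    using d t by (simp add: charpoly3_def)
qed

context field_ext
begin

lemma ev_charpoly3: "ev (charpoly3 A) z = det (mat z - map_matrix e A)"
  by (simp add: charpoly3_def det_3 mat_entries algebra_simps)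

text \<open>Left eigenvectors are the right kind because \<open>u\<close> is to be read as the
  functional \<open>comb u\<close>: being an eigenvector then means that this functional turns
  \<open>A\<close> into multiplication by \<open>z\<close>.\<close>

lemma left_eigenvector:
  fixes A :: "'k^'n^'n"
  assumes "det (mat z - map_matrix e A) = 0"
  shows "\<exists>u. u \<noteq> 0 \<and> (\<forall>v. comb u (A *v v) = z * comb u v)"
proof -
  have "det (transpose (mat z - map_matrix e A)) = 0"
    using assms by (simp add: det_transpose)
  then obtain u where u: "u \<noteq> 0" "transpose (mat z - map_matrix e A) *v u = 0"
    using det_0_kernel by blast
  have "comb u (column j A) = z * u $ j" for j
  proof -
    have "0 = (transpose (mat z - map_matrix e A) *v u) $ j" using u by simp
    also have "\<dots> = (\<Sum>i\<in>UNIV. ((if i = j then z else 0) - e (A $ i $ j)) * u $ i)"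
      by (simp add: matrix_vector_mult_def transpose_def mat_def del: transpose_matrix_vector)
    also have "\<dots> = z * u $ j - comb u (column j A)"
      by (simp add: left_diff_distrib sum_subtractf comb_def column_def
          if_distrib[where f = "\<lambda>x. x * _"] cong: if_cong)
    finally show ?thesis by simp
  qed
  then have "comb u (A *v v) = z * comb u v" for v
    by (simp add: comb_matvec comb_mult_left)
  with u(1) show ?thesis by blast
qed

lemma comb_nonzero: "u \<noteq> 0 \<Longrightarrow> \<exists>v. comb u v \<noteq> 0"
  by (metis comb_axis vec_eq_iff zero_index)

text \<open>A left eigenvector \<open>u\<close> over the cubic extension gives a linear isomorphism onto that extension
  which turns \<open>A\<close> into multiplication by the eigenvalue.\<close>

lemma GL3_conj_mult_matrix_3:
  fixes A :: "'k^3^3"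
  assumes card: "CARD('l) = q ^ 3" and t: "t \<notin> range e" and z: "z \<notin> range e"
    and root: "det (mat z - map_matrix e A) = 0"
  shows "GL3_conj A (mult_matrix e (vector [1, t, t ^ 2] :: 'l^3) z)"
proof -
  let ?b = "vector [1, t, t ^ 2] :: 'l^3"
  note bij = bij_comb_3[OF card t]
  obtain u where u: "u \<noteq> 0" "\<And>v. comb u (A *v v) = z * comb u v"
    using left_eigenvector[OF root] by blast
  obtain v where v: "comb u v \<noteq> 0" using comb_nonzero[OF u(1)] by blast
  \<comment> \<open>The image of \<open>comb u\<close> is a subspace stable under multiplication by
    \<open>z\<close> and contains \<open>comb u v \<noteq> 0\<close>; since
    \<open>1, z, z ^ 2\<close> is a basis, it is everything.\<close>
  have surj: "\<exists>w. comb u w = y" for y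
  proof -
    obtain c where "comb (vector [1, z, z ^ 2] :: 'l^3) c = y / comb u v"
      using bij_comb_3[OF card z] by (metis bij_pointE)
    then have "y = (e (c$1) + e (c$2) * z + e (c$3) * z ^ 2) * comb u v"
      using v by (simp add: comb_def sum_3)
    also have "\<dots> = comb u (c$1 *s v + c$2 *s (A *v v) + c$3 *s (A *v (A *v v)))"
      by (simp add: comb_add comb_scale u(2) algebra_simps power2_eq_square)
    finally show ?thesis by metis
  qed
  \<comment> \<open>The functional \<open>comb u\<close> written in the coordinates of
    \<open>?b\<close>.\<close>
  define P :: "'k^3^3" where "P = (\<chi> i j. inv (comb ?b) (u $ j) $ i)"
  have "column j P = inv (comb ?b) (u $ j)" for j
    by (simp add: P_def column_def vec_eq_iff)
  then have P: "comb ?b (P *v w) = comb u w" for w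
    using bij by (simp add: comb_matvec surj_f_inv_f bij_is_surj)
  have "surj ((*v) P)"
  proof (rule surjI)
    fix w
    have "comb u (SOME x. comb u x = comb ?b w) = comb ?b w"
      using surj by (rule someI_ex)
    then show "P *v (SOME x. comb u x = comb ?b w) = w"
      using P comb_eq_iff[OF bij] by metis
  qed
  then have "P \<in> GL3"
    using matrix_right_invertible_surjective[of P] invertible_right_inverse[of P] by (simp add: GL3_def)
  moreover have "comb ?b (P ** A *v w) = comb ?b (mult_matrix e ?b z ** P *v w)" for w
    by (simp add: P u(2) comb_mult_matrix[OF bij] flip: matrix_vector_mul_assoc)
  then have "P ** A = mult_matrix e ?b z ** P"
    by (simp add: comb_eq_iff[OF bij] matrix_eq)
  ultimately show ?thesis by (rule GL3_conj_left)
qed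

end

section \<open>Triangular and Jordan forms of split matrices\<close>

lemma conj_column:
  fixes A :: "'a::field^3^3"
  assumes "P \<in> GL3" "A *v (P *v u) = P *v w"
  shows "(matrix_inv P ** A ** P) *v u = w"
  using assms GL3_inv[OF assms(1)]
  by (simp flip: matrix_vector_mul_assoc) (simp add: matrix_vector_mul_assoc)

lemma GL3_conj_inv: "P \<in> GL3 \<Longrightarrow> GL3_conj A (matrix_inv P ** A ** P)"
  unfolding GL3_conj_iff by (rule bexI[of _ P]) (simp_all add: GL3_inv matrix_mul_assoc)

definition upper3 :: "'a::zero \<Rightarrow> 'a \<Rightarrow> 'a \<Rightarrow> 'a \<Rightarrow> 'a \<Rightarrow> 'a \<Rightarrow> 'a^3^3" where
  "upper3 a b c x y z = vector [vector [a, x, y], vector [0, b, z], vector [0, 0, c]]"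

text \<open>The eigenvalues appear on the diagonal in the prescribed order: an eigenvector for
  \<open>a\<close> becomes the first basis vector, and an eigenvector for \<open>b\<close> of the
  lower right block, whose trace is \<open>b + c\<close> and determinant \<open>b * c\<close>,
  becomes the second.\<close>

lemma triangularise:
  fixes A :: "'a::field^3^3"
  assumes cp: "charpoly3 A = [:- a, 1:] * [:- b, 1:] * [:- c, 1:]"
  shows "\<exists>x y z. GL3_conj A (upper3 a b c x y z)"
proof -
  have "det (mat a - A) = 0"
    unfolding poly_charpoly3[symmetric] cp poly_mult by simp
  then obtain v where v: "v \<noteq> 0" "(mat a - A) *v v = 0" using det_0_kernel by blast
  then have Av: "A *v v = a *s v"
    by (simp add: matrix_vector_mult_diff_rdistrib mat_vector)
  obtain P where P: "P \<in> GL3" "P *v vector [1, 0, 0] = v"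
  proof -
    have "v$1 \<noteq> 0 \<or> v$2 \<noteq> 0 \<or> v$3 \<noteq> 0"
      using v(1) by (auto simp: vec_eq_iff forall_3)
    then consider "v$1 \<noteq> 0" | "v$2 \<noteq> 0" | "v$3 \<noteq> 0" by blast
    then show ?thesis
    proof cases
      case 1
      then show ?thesis
        by (intro that[of "vector [vector [v$1, 0, 0], vector [v$2, 1, 0], vector [v$3, 0, 1]]"])
          (simp_all add: det_GL3 det_3 vec_eq_iff forall_3 matvec_3_entry)
    next
      case 2
      then show ?thesis
        by (intro that[of "vector [vector [v$1, 1, 0], vector [v$2, 0, 0], vector [v$3, 0, 1]]"])
          (simp_all add: det_GL3 det_3 vec_eq_iff forall_3 matvec_3_entry)
    next
      case 3
      then show ?thesis
        by (intro that[of "vector [vector [v$1, 1, 0], vector [v$2, 0, 1], vector [v$3, 0, 0]]"])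
          (simp_all add: det_GL3 det_3 vec_eq_iff forall_3 matvec_3_entry)
    qed
  qed
  define B where "B = matrix_inv P ** A ** P"
  have AB: "GL3_conj A B" unfolding B_def by (rule GL3_conj_inv[OF P(1)])
  have "B *v vector [1, 0, 0] = vector [a, 0, 0]"
    unfolding B_def
  proof (rule conj_column[OF P(1)])
    have "vector [a, 0, 0] = a *s (vector [1, 0, 0] :: 'a^3)"
      by (simp add: vec_eq_iff forall_3)
    then show "A *v (P *v vector [1, 0, 0]) = P *v vector [a, 0, 0]"
      by (simp add: P(2) Av vec.scale)
  qed
  then have B1: "B$1$1 = a" "B$2$1 = 0" "B$3$1 = 0"
    by (simp_all add: vec_eq_iff forall_3 matvec_3_entry)
  have cpB: "charpoly3 B = [:- a, 1:] * [:- b, 1:] * [:- c, 1:]"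
    using GL3_conj_charpoly3[OF AB, symmetric] cp by (rule trans)
  have tr: "B$2$2 + B$3$3 = b + c"
    using cpB unfolding charpoly3_mult_linear by (simp add: B1 add.assoc)
  have "a * B$2$2 + (a * B$3$3 + (B$2$2 * B$3$3 - B$2$3 * B$3$2)) = a * b + (a * c + b * c)"
    using cpB unfolding charpoly3_mult_linear by (simp add: B1 add.assoc)
  then have "a * (B$2$2 + B$3$3) + (B$2$2 * B$3$3 - B$2$3 * B$3$2) = a * (b + c) + b * c"
    by (simp only: distrib_left add.assoc)
  then have s: "B$2$2 * B$3$3 - B$2$3 * B$3$2 = b * c"
    by (simp only: tr add_left_cancel)
  \<comment> \<open>The block minus \<open>b\<close> is singular, so a vector killed by a non-zero
    row of it is killed by both rows; this gives \<open>(B$2$3, b - B$2$2)\<close>. If the first row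
    is zero, the second row gives \<open>(b - c, B$3$2)\<close>, or \<open>(0, 1)\<close> when
    \<open>b = c\<close>.\<close>
  obtain g1 g2 where g: "g1 \<noteq> 0 \<or> g2 \<noteq> 0" "B$2$2 * g1 + B$2$3 * g2 = b * g1"
    "B$3$2 * g1 + B$3$3 * g2 = b * g2"
  proof (cases "B$2$3 = 0 \<and> B$2$2 = b")
    case True
    then have "B$3$3 = c" using tr by simp
    show ?thesis
    proof (cases "b = c")
      case True
      then show ?thesis using that[of 0 1] \<open>B$3$3 = c\<close> \<open>B$2$3 = 0 \<and> B$2$2 = b\<close> by simp
    next
      case False
      then show ?thesis
        using that[of "b - c" "B$3$2"] \<open>B$3$3 = c\<close> True by (simp add: algebra_simps)
    qed
  next
    case False
    have "B$3$2 * B$2$3 + B$3$3 * (b - B$2$2) = b * (b - B$2$2)"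
      using tr s by algebra
    then show ?thesis
      using that[of "B$2$3" "b - B$2$2"] False by (auto simp: algebra_simps)
  qed
  obtain Q where Q: "Q \<in> GL3" "Q *v vector [1, 0, 0] = vector [1, 0, 0]" "Q *v vector [0, 1, 0] = vector [0, g1, g2]"
  proof (cases "g1 = 0")
    case True
    then show ?thesis using g(1)
      by (intro that[of "vector [vector [1, 0, 0], vector [0, g1, 1], vector [0, g2, 0]]"])
        (simp_all add: det_GL3 det_3 vec_eq_iff forall_3 matvec_3_entry)
  next
    case False
    then show ?thesis
      by (intro that[of "vector [vector [1, 0, 0], vector [0, g1, 0], vector [0, g2, 1]]"])
        (simp_all add: det_GL3 det_3 vec_eq_iff forall_3 matvec_3_entry)
  qed
  define C where "C = matrix_inv Q ** B ** Q"
  have BC: "GL3_conj B C" unfolding C_def by (rule GL3_conj_inv[OF Q(1)])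
  have "C *v vector [1, 0, 0] = vector [a, 0, 0]"
    unfolding C_def
  proof (rule conj_column[OF Q(1)])
    have "vector [a, 0, 0] = a *s (vector [1, 0, 0] :: 'a^3)"
      by (simp add: vec_eq_iff forall_3)
    then show "B *v (Q *v vector [1, 0, 0]) = Q *v vector [a, 0, 0]"
      by (simp only: vec.scale Q(2)) (simp add: vec_eq_iff forall_3 matvec_3_entry B1)
  qed
  then have C1: "C$1$1 = a" "C$2$1 = 0" "C$3$1 = 0"
    by (simp_all add: vec_eq_iff forall_3 matvec_3_entry)
  let ?x = "B$1$2 * g1 + B$1$3 * g2"
  have "C *v vector [0, 1, 0] = vector [?x, b, 0]"
    unfolding C_def
  proof (rule conj_column[OF Q(1)])
    have "vector [?x, b, 0] = ?x *s (vector [1, 0, 0] :: 'a^3) + b *s vector [0, 1, 0]"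
      by (simp add: vec_eq_iff forall_3)
    then show "B *v (Q *v vector [0, 1, 0]) = Q *v vector [?x, b, 0]"
      by (simp only: vec.scale vec.add Q(2,3)) (simp add: vec_eq_iff forall_3 matvec_3_entry g)
  qed
  then have C2: "C$2$2 = b" "C$3$2 = 0"
    by (simp_all add: vec_eq_iff forall_3 matvec_3_entry)
  have "charpoly3 C = [:- a, 1:] * [:- b, 1:] * [:- c, 1:]"
    using GL3_conj_charpoly3[OF BC, symmetric] cpB by (rule trans)
  then have "C$3$3 = c"
    unfolding charpoly3_mult_linear by (simp add: C1 C2)
  then have "C = upper3 a b c (C$1$2) (C$1$3) (C$2$3)"
    by (simp add: matrix_3_eq_iff upper3_def C1 C2)
  then show ?thesis
    using GL3_conj_trans[OF AB BC] by metis
qed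

lemma GL3_conj_leftI:
  fixes A :: "'a::field^3^3"
  assumes "det P \<noteq> 0" "P ** A = B ** P"
  shows "GL3_conj A B"
  using assms by (intro GL3_conj_left) (simp_all add: det_GL3)

lemma linear_solution: "a \<noteq> b \<Longrightarrow> \<exists>p. x + p * b = a * (p :: 'a::field)"
  by (rule exI[of _ "x / (a - b)"]) (simp add: field_simps)

text \<open>A unitriangular conjugator: each of its entries solves a linear equation whose leading
  coefficient is a difference of two eigenvalues. The corner \<open>r\<close> depends on
  \<open>p\<close>.\<close>

lemma upper3_distinct:
  fixes a b c :: "'a::field"
  assumes "a \<noteq> b" "a \<noteq> c" "b \<noteq> c"
  shows "GL3_conj (upper3 a b c x y z) (upper3 a b c 0 0 0)"
proof -
  obtain p where p: "x + p * b = a * p" using linear_solution[OF assms(1)] by blast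
  obtain r where r: "y + p * z + r * c = a * r" using linear_solution[OF assms(2), of "y + p * z"] by blast
  obtain s where s: "z + s * c = b * s" using linear_solution[OF assms(3)] by blast
  let ?P = "vector [vector [1, p, r], vector [0, 1, s], vector [0, 0, 1]] :: 'a^3^3"
  have "det ?P \<noteq> 0" by (simp add: det_3)
  moreover have "?P ** upper3 a b c x y z = upper3 a b c 0 0 0 ** ?P"
    using p r s by (simp add: upper3_def matrix_3_eq_iff mult_3_entry mult.commute)
  ultimately show ?thesis by (rule GL3_conj_leftI)
qed

text \<open>Division by \<open>a - b\<close> clears \<open>y\<close> and \<open>z\<close>. What
  remains is \<open>x\<close>, which the middle diagonal entry of the conjugator scales to 1 if it
  is non-zero.\<close>

lemma upper3_double:
  fixes a b :: "'a::field"
  assumes "a \<noteq> b"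
  shows "GL3_conj (upper3 a a b x y z) (upper3 a a b 0 0 0) \<or>
    GL3_conj (upper3 a a b x y z) (upper3 a a b 1 0 0)"
proof (cases "x = 0")
  case True
  let ?r = "y / (a - b)" let ?s = "z / (a - b)"
  let ?P = "vector [vector [1, 0, ?r], vector [0, 1, ?s], vector [0, 0, 1]] :: 'a^3^3"
  have "GL3_conj (upper3 a a b x y z) (upper3 a a b 0 0 0)"
  proof (rule GL3_conj_leftI)
    show "det ?P \<noteq> 0" by (simp add: det_3)
    have "y + ?r * b = a * ?r" "z + ?s * b = a * ?s"
      using assms by (simp_all add: field_simps)
    then show "?P ** upper3 a a b x y z = upper3 a a b 0 0 0 ** ?P"
      by (simp add: upper3_def matrix_3_eq_iff mult_3_entry mult.commute True)
  qed
  then show ?thesis ..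
next
  case False
  let ?s = "x * z / (a - b)" let ?r = "(y - ?s) / (a - b)"
  let ?P = "vector [vector [1, 0, ?r], vector [0, x, ?s], vector [0, 0, 1]] :: 'a^3^3"
  have "GL3_conj (upper3 a a b x y z) (upper3 a a b 1 0 0)"
  proof (rule GL3_conj_leftI)
    show "det ?P \<noteq> 0" using False by (simp add: det_3)
    have "y + ?r * b = a * ?r + ?s" "x * z + ?s * b = a * ?s"
      using assms by (simp_all add: divide_simps) (simp_all add: algebra_simps)
    then show "?P ** upper3 a a b x y z = upper3 a a b 1 0 0 ** ?P"
      by (simp add: upper3_def matrix_3_eq_iff mult_3_entry mult.commute)
  qed
  then show ?thesis ..
qed

text \<open>The square of the nilpotent part has the single entry \<open>x * z\<close>. If this is
  non-zero there is one Jordan block; otherwise the nilpotent part has rank at most one.\<close>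

lemma upper3_triple:
  fixes a :: "'a::field"
  shows "GL3_conj (upper3 a a a x y z) (upper3 a a a 0 0 0) \<or>
    GL3_conj (upper3 a a a x y z) (upper3 a a a 1 0 0) \<or>
    GL3_conj (upper3 a a a x y z) (upper3 a a a 1 0 1)"
proof -
  consider "x = 0" "y = 0" "z = 0" | "x \<noteq> 0" "z \<noteq> 0" | "x \<noteq> 0" "z = 0"
    | "x = 0" "z \<noteq> 0" | "x = 0" "z = 0" "y \<noteq> 0" by blast
  then show ?thesis
  proof cases
    case 1
    then show ?thesis by (simp add: GL3_conj_refl)
  next
    case 2
    have "GL3_conj (upper3 a a a x y z) (upper3 a a a 1 0 1)"
    proof (rule GL3_conj_leftI)
      let ?P = "vector [vector [1, 0, 0], vector [0, x, y], vector [0, 0, x * z]] :: 'a^3^3"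
      show "det ?P \<noteq> 0" using 2 by (simp add: det_3)
      show "?P ** upper3 a a a x y z = upper3 a a a 1 0 1 ** ?P"
        by (simp add: upper3_def matrix_3_eq_iff mult_3_entry algebra_simps)
    qed
    then show ?thesis by simp
  next
    case 3
    have "GL3_conj (upper3 a a a x y z) (upper3 a a a 1 0 0)"
    proof (rule GL3_conj_leftI)
      let ?P = "vector [vector [1, 0, 0], vector [0, x, y], vector [0, 0, 1]] :: 'a^3^3"
      show "det ?P \<noteq> 0" using 3 by (simp add: det_3)
      show "?P ** upper3 a a a x y z = upper3 a a a 1 0 0 ** ?P"
        using 3 by (simp add: upper3_def matrix_3_eq_iff mult_3_entry algebra_simps)
    qed
    then show ?thesis by simp
  next
    case 4
    have "GL3_conj (upper3 a a a x y z) (upper3 a a a 1 0 0)"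
    proof (rule GL3_conj_leftI)
      \<comment> \<open>The rows form a Jordan basis for the action from the right: the nilpotent
        part sends the first row to the second and kills the other two, whence
        \<open>- y / z\<close>.\<close>
      let ?P = "vector [vector [0, 1, 0], vector [0, 0, z], vector [1, - y / z, 0]] :: 'a^3^3"
      show "det ?P \<noteq> 0" using 4 by (simp add: det_3)
      show "?P ** upper3 a a a x y z = upper3 a a a 1 0 0 ** ?P"
        using 4 by (simp add: upper3_def matrix_3_eq_iff mult_3_entry algebra_simps)
    qed
    then show ?thesis by simp
  next
    case 5
    have "GL3_conj (upper3 a a a x y z) (upper3 a a a 1 0 0)"
    proof (rule GL3_conj_leftI)
      let ?P = "vector [vector [1, 0, 0], vector [0, 0, y], vector [0, 1, 0]] :: 'a^3^3"
      show "det ?P \<noteq> 0" using 5 by (simp add: det_3)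
      show "?P ** upper3 a a a x y z = upper3 a a a 1 0 0 ** ?P"
        using 5 by (simp add: upper3_def matrix_3_eq_iff mult_3_entry algebra_simps)
    qed
    then show ?thesis by simp
  qed
qed

section \<open>The tower of fields, norms, and labels for all invertible matrices\<close>

locale tower_setup =
  fixes F :: "('k::{field,finite}, 'l::{field,finite}, 'm::{field,finite}) tower" and q :: nat
  assumes tower: "is_tower F" and q_eq: "q = CARD('k)"
begin

sublocale E2: field_ext "emb2 F" q
  by unfold_locales (use tower q_eq in \<open>auto simp: is_tower_def\<close>)

sublocale E3: field_ext "emb3 F" q
  by unfold_locales (use tower q_eq in \<open>auto simp: is_tower_def\<close>)

lemma card_l: "CARD('l) = q ^ 2" and card_m: "CARD('m) = q ^ 3"
  using tower by (auto simp: is_tower_def q_eq)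

lemma gen2: "gen2 F \<notin> range (emb2 F)"
  using tower card_l by (intro E2.not_in_range_if_generates[of _ 2]) (auto simp: is_tower_def)

lemma gen3: "gen3 F \<notin> range (emb3 F)"
  using tower card_m by (intro E3.not_in_range_if_generates[of _ 3]) (auto simp: is_tower_def)

abbreviation b2 :: "'l^2" where "b2 \<equiv> vector [1, gen2 F]"
abbreviation b3 :: "'m^3" where "b3 \<equiv> vector [1, gen3 F, gen3 F ^ 2]"

lemma bij2: "bij (E2.comb b2)"
  by (rule E2.bij_comb_2[OF card_l gen2])

lemma bij3: "bij (E3.comb b3)"
  by (rule E3.bij_comb_3[OF card_m gen3])

lemma mat2_fold: "mult_matrix (emb2 F) b2 = mat2 F"
  by (simp add: mat2_def fun_eq_iff)

lemma mat3_fold: "mult_matrix (emb3 F) b3 = mat3 F"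
  by (simp add: mat3_def fun_eq_iff)

lemmas mat2_simps = E2.mult_matrix_mult[OF bij2, unfolded mat2_fold]
  E2.mult_matrix_diff[OF bij2, unfolded mat2_fold]
lemmas mat2_e = E2.mult_matrix_e[OF bij2, unfolded mat2_fold]
lemmas mat2_eq_iff = E2.mult_matrix_eq_iff[OF bij2, unfolded mat2_fold]
lemmas mat2_0 = E2.mult_matrix_0[OF bij2, unfolded mat2_fold]
lemmas comb_mat2 = E2.comb_mult_matrix[OF bij2, unfolded mat2_fold]

lemmas mat3_simps = E3.mult_matrix_mult[OF bij3, unfolded mat3_fold]
  E3.mult_matrix_diff[OF bij3, unfolded mat3_fold]
lemmas mat3_e = E3.mult_matrix_e[OF bij3, unfolded mat3_fold]
lemmas mat3_eq_iff = E3.mult_matrix_eq_iff[OF bij3, unfolded mat3_fold]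
lemmas mat3_0 = E3.mult_matrix_0[OF bij3, unfolded mat3_fold]
lemmas mat3_mat_iff = E3.mult_matrix_mat_iff[OF bij3, unfolded mat3_fold]
lemmas comb_mat3 = E3.comb_mult_matrix[OF bij3, unfolded mat3_fold]

lemma det_mat_minus_mat2: "det (mat z - map_matrix (emb2 F) (mat2 F w)) = (z - w) * (z - w ^ q)"
  using E2.det_mult_matrix_2[OF card_l gen2] by (simp only: mat2_fold)

lemma det_mat_minus_mat3:
  "det (mat z - map_matrix (emb3 F) (mat3 F w)) = (z - w) * (z - w ^ q) * (z - w ^ (q ^ 2))"
  using E3.det_mult_matrix_3[OF card_m gen3] by (simp only: mat3_fold)

lemma emb2_det_mat2: "emb2 F (det (mat2 F w)) = w * w ^ q"
  using det_mat_minus_mat2[of 0 w] by (simp add: det_2 mat_entries)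

lemma emb3_det_mat3: "emb3 F (det (mat3 F w)) = w * w ^ q * w ^ (q ^ 2)"
proof -
  have "det (mat 0 - map_matrix (emb3 F) (mat3 F w)) = - emb3 F (det (mat3 F w))"
    by (simp add: det_3 mat_entries algebra_simps)
  then show ?thesis using det_mat_minus_mat3[of 0 w] by simp
qed

lemma det_mat2: "det (mat2 F w) = norm2 F w"
  unfolding norm2_def q_eq[symmetric] emb2_det_mat2[symmetric] by (simp add: inv_f_f E2.inj_e)

lemma det_mat3: "det (mat3 F w) = norm3 F w"
  unfolding norm3_def q_eq[symmetric] emb3_det_mat3[symmetric] by (simp add: inv_f_f E3.inj_e)

lemma norm2_0: "norm2 F w = 0 \<longleftrightarrow> w = 0"
  using emb2_det_mat2[of w] E2.e_eq_0[of "det (mat2 F w)"] E2.q_gt_1 by (auto simp: det_mat2)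

lemma norm3_0: "norm3 F w = 0 \<longleftrightarrow> w = 0"
  using emb3_det_mat3[of w] E3.e_eq_0[of "det (mat3 F w)"] E3.q_gt_1 by (auto simp: det_mat3)

lemma pow_q_q_2: "((w :: 'l) ^ q) ^ q = w"
  using finite_field_power_card[of w] by (simp add: card_l E2.power_q_power_q)

lemma pow_q_q_q_3: "(((w :: 'm) ^ q) ^ q) ^ q = w"
  using finite_field_power_card[of w] by (simp add: card_m E3.power_q_cube)

lemma norm2_e: "norm2 F (emb2 F a) = a ^ 2"
proof -
  have "emb2 F (norm2 F (emb2 F a)) = emb2 F (a ^ 2)"
    by (simp add: emb2_det_mat2 power2_eq_square flip: det_mat2)
  then show ?thesis by (simp only: E2.e_eq)
qed

lemma norm3_e: "norm3 F (emb3 F a) = a ^ 3"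
proof -
  have "emb3 F (norm3 F (emb3 F a)) = emb3 F (a ^ 3)"
    by (simp add: emb3_det_mat3 power3_eq_cube flip: det_mat3 E3.power_q_power_q)
  then show ?thesis by (simp only: E3.e_eq)
qed

text \<open>A left eigenvector over the quadratic extension together with one over the small field gives a
  linear isomorphism onto the product of the two fields.\<close>

lemma GL3_conj_block_diag:
  fixes A :: "'k^3^3"
  assumes z: "z \<notin> range (emb2 F)" and cp: "charpoly3 A = [:- a, 1:] * [:d, c, 1:]"
    and root: "E2.ev [:d, c, 1:] z = 0" and a: "poly [:d, c, 1:] a \<noteq> 0"
  shows "GL3_conj A (block_diag (mat2 F z) a)"
proof -
  \<comment> \<open>The small field as an extension of itself, so that the eigenvalue
    \<open>a\<close> yields a functional by the same lemma as \<open>z\<close>.\<close>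
  have K: "field_ext (\<lambda>x :: 'k. x) q"
    by unfold_locales (auto simp: field_embedding_def q_eq)
  let ?f = "\<lambda>v. A *v (A *v v) + c *s (A *v v) + d *s v"
  have "E2.ev (charpoly3 A) z = 0"
    unfolding cp E2.ev_mult root by simp
  then have "det (mat z - map_matrix (emb2 F) A) = 0"
    by (simp add: E2.ev_charpoly3)
  then obtain u where u: "u \<noteq> 0" "\<And>v. E2.comb u (A *v v) = z * E2.comb u v"
    using E2.left_eigenvector by blast
  have "poly (charpoly3 A) a = 0"
    unfolding cp poly_mult by simp
  then have "det (mat a - map_matrix (\<lambda>x. x) A) = 0"
    by (simp add: poly_charpoly3 map_matrix_def)
  then obtain r where r: "r \<noteq> 0" "\<And>v. field_ext.comb (\<lambda>x. x) r (A *v v) = a * field_ext.comb (\<lambda>x. x) r v"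
    using field_ext.left_eigenvector[OF K] by blast
  define T where "T = E2.comb u"
  define S where "S = field_ext.comb (\<lambda>x :: 'k. x) r"
  note T = u(2)[folded T_def] E2.comb_add[of u, folded T_def] E2.comb_diff[of u, folded T_def]
    E2.comb_scale[of u, folded T_def]
  note S = r(2)[folded S_def] field_ext.comb_add[OF K, of r, folded S_def] field_ext.comb_diff[OF K, of r, folded S_def]
    field_ext.comb_scale[OF K, of r, folded S_def]
  obtain v where v: "T v \<noteq> 0" using E2.comb_nonzero[OF u(1)] by (auto simp: T_def)
  obtain w where w: "S w \<noteq> 0" using field_ext.comb_nonzero[OF K, OF r(1)] by (auto simp: S_def)
  \<comment> \<open>\<open>?f\<close> is the quadratic factor evaluated at \<open>A\<close>. Under
    \<open>T\<close> it becomes multiplication by its value at \<open>z\<close>, which is 0, and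
    under \<open>S\<close> by its value at \<open>a\<close>, which is not. So \<open>w'\<close> is
    seen by \<open>S\<close> alone; the vector \<open>v'\<close> below, obtained from the linear
    factor, is seen by \<open>T\<close> alone.\<close>
  define w' where "w' = ?f w"
  have "T w' = E2.ev [:d, c, 1:] z * T w"
    by (simp add: w'_def T algebra_simps)
  then have Tw': "T w' = 0" by (simp only: root mult_zero_left)
  have "S w' = poly [:d, c, 1:] a * S w"
    by (simp add: w'_def S algebra_simps)
  then have Sw': "S w' \<noteq> 0" using w a by (metis mult_eq_0_iff)
  define v' where "v' = A *v v - a *s v"
  have "T v' = (z - emb2 F a) * T v" and Sv': "S v' = 0"
    by (simp_all add: v'_def T S algebra_simps)
  then have Tv': "T v' \<noteq> 0" using v z by auto
  have surj: "\<exists>x. T x = y \<and> S x = s" for y s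
  proof -
    obtain g where "E2.comb (vector [1, z] :: 'l^2) g = y / T v'"
      using E2.bij_comb_2[OF card_l z] by (metis bij_pointE)
    then have y: "y = (emb2 F (g$1) + emb2 F (g$2) * z) * T v'"
      using Tv' by (simp add: E2.comb_def sum_2)
    let ?x = "g$1 *s v' + g$2 *s (A *v v') + (s / S w') *s w'"
    have "T ?x = y" "S ?x = s"
      using Sw' by (simp_all add: T S Tw' Sv' y algebra_simps)
    then show ?thesis by blast
  qed
  \<comment> \<open>Two rows for the coordinates of \<open>T\<close> in the basis \<open>b2\<close>,
    one row for \<open>S\<close>.\<close>
  define P :: "'k^3^3" where "P = vector
    [\<chi> j. inv (E2.comb b2) (u $ j) $ 1, \<chi> j. inv (E2.comb b2) (u $ j) $ 2, r]"
  have ib: "E2.comb b2 (inv (E2.comb b2) y) = y" for y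
    using bij2 by (simp add: surj_f_inv_f bij_is_surj)
  have PT: "E2.comb b2 (vector [(P *v x)$1, (P *v x)$2]) = T x" for x
  proof -
    have "E2.comb b2 (vector [(P *v x)$1, (P *v x)$2])
      = emb2 F (x$1) * E2.comb b2 (inv (E2.comb b2) (u $ 1))
      + emb2 F (x$2) * E2.comb b2 (inv (E2.comb b2) (u $ 2))
      + emb2 F (x$3) * E2.comb b2 (inv (E2.comb b2) (u $ 3))"
      by (simp add: E2.comb_def sum_2 matvec_3_entry P_def algebra_simps)
    also have "\<dots> = T x"
      unfolding ib by (simp add: T_def E2.comb_def sum_3)
    finally show ?thesis .
  qed
  have PS: "(P *v x)$3 = S x" for x
    by (simp add: S_def field_ext.comb_def[OF K] sum_3 matvec_3_entry P_def mult.commute)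
  have eqI: "x = y" if "E2.comb b2 (vector [x$1, x$2]) = E2.comb b2 (vector [y$1, y$2])" "x$3 = y$3"
    for x y :: "'k^3"
    using that unfolding E2.comb_eq_iff[OF bij2] by (simp add: vec_eq_iff forall_2 forall_3)
  have "\<exists>x. P *v x = y" for y
    using surj[of "E2.comb b2 (vector [y$1, y$2])" "y$3"] PT PS eqI by metis
  then have "surj ((*v) P)" by (metis surjI surj_def)
  then have "P \<in> GL3"
    using matrix_right_invertible_surjective[of P] invertible_right_inverse[of P] by (simp add: GL3_def)
  moreover have "P *v (A *v x) = block_diag (mat2 F z) a *v (P *v x)" for x
  proof (rule eqI)
    have "vector [(block_diag (mat2 F z) a *v (P *v x)) $ 1, (block_diag (mat2 F z) a *v (P *v x)) $ 2]
      = mat2 F z *v vector [(P *v x)$1, (P *v x)$2]"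
      by (simp add: vec_eq_iff forall_2 matvec_3_entry[of "block_diag _ _"] matvec_2_entry)
    then show "E2.comb b2 (vector [(P *v (A *v x)) $ 1, (P *v (A *v x)) $ 2]) =
      E2.comb b2 (vector [(block_diag (mat2 F z) a *v (P *v x)) $ 1, (block_diag (mat2 F z) a *v (P *v x)) $ 2])"
      by (simp only: PT comb_mat2 T)
    show "(P *v (A *v x)) $ 3 = (block_diag (mat2 F z) a *v (P *v x)) $ 3"
      by (simp add: PS S matvec_3_entry[of "block_diag _ _"])
  qed
  then have "P ** A = block_diag (mat2 F z) a ** P"
    by (simp add: matrix_eq matrix_vector_mul_assoc)
  ultimately show ?thesis by (rule GL3_conj_left)
qed

lemma cls_rep_upper3:
  "cls_rep F (Ca a) = upper3 a a a 0 0 0" "cls_rep F (Ca1 a) = upper3 a a a 1 0 0"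
  "cls_rep F (Ca11 a) = upper3 a a a 1 0 1" "cls_rep F (Cab a b) = upper3 a a b 0 0 0"
  "cls_rep F (Cab1 a b) = upper3 a a b 1 0 0" "cls_rep F (Cabc a b c) = upper3 a b c 0 0 0"
  by (simp_all add: upper3_def)

text \<open>The characteristic polynomial is symmetric in its roots, so a repeated root can be moved
  to the first two places, where \<open>Cab\<close> and \<open>Cab1\<close> have it, before
  triangularising.\<close>

lemma split_has_label:
  assumes A: "(A :: 'k^3^3) \<in> GL3" and cp: "charpoly3 A = [:- a, 1:] * [:- b, 1:] * [:- c, 1:]"
  shows "\<exists>c. is_cls F c \<and> GL3_conj A (cls_rep F c)"
proof -
  have nz: "a \<noteq> 0" "b \<noteq> 0" "c \<noteq> 0"
    using A cp unfolding charpoly3_mult_linear by (auto simp: det_GL3)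
  have double: "\<exists>c. is_cls F c \<and> GL3_conj A (cls_rep F c)"
    if "charpoly3 A = [:- x, 1:] * [:- x, 1:] * [:- y, 1:]" "x \<noteq> y" "x \<noteq> 0" "y \<noteq> 0" for x y
  proof -
    have "\<exists>c\<in>{Cab x y, Cab1 x y}. GL3_conj A (cls_rep F c)"
      using triangularise[OF that(1)] upper3_double[OF that(2)] GL3_conj_trans
      unfolding bex_simps cls_rep_upper3 by blast
    moreover have "\<forall>c\<in>{Cab x y, Cab1 x y}. is_cls F c" using that by simp
    ultimately show ?thesis by blast
  qed
  consider "a = b" "b = c" | "a = b" "b \<noteq> c" | "a = c" "b \<noteq> c" | "b = c" "a \<noteq> c"
    | "a \<noteq> b" "a \<noteq> c" "b \<noteq> c" by blast
  then show ?thesis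
  proof cases
    case 1
    have "\<exists>c\<in>{Ca a, Ca1 a, Ca11 a}. GL3_conj A (cls_rep F c)"
      using triangularise[OF cp[folded 1]] upper3_triple[of a] GL3_conj_trans 1
      unfolding bex_simps cls_rep_upper3 by blast
    moreover have "\<forall>c\<in>{Ca a, Ca1 a, Ca11 a}. is_cls F c" using nz by simp
    ultimately show ?thesis by blast
  next
    case 2
    then show ?thesis using double[of a c] cp nz by simp
  next
    case 3
    have "charpoly3 A = [:- a, 1:] * [:- a, 1:] * [:- b, 1:]"
      using cp unfolding charpoly3_mult_linear by (simp add: 3 algebra_simps)
    then show ?thesis using double[of a b] 3 nz by simp
  next
    case 4
    have "charpoly3 A = [:- b, 1:] * [:- b, 1:] * [:- a, 1:]"
      using cp unfolding charpoly3_mult_linear by (simp add: 4 algebra_simps)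
    then show ?thesis using double[of b a] 4 nz by simp
  next
    case 5
    have "GL3_conj A (cls_rep F (Cabc a b c))"
      using triangularise[OF cp] upper3_distinct[OF 5] GL3_conj_trans unfolding cls_rep_upper3 by blast
    then show ?thesis using nz 5 by (intro exI[of _ "Cabc a b c"]) auto
  qed
qed

theorem has_label:
  assumes A: "A \<in> GL3"
  shows "\<exists>c. is_cls F c \<and> GL3_conj A (cls_rep F c)"
proof (cases "\<exists>a. poly (charpoly3 A) a = 0")
  case False
  have deg: "degree (charpoly3 A) = 3" by (simp add: charpoly3_def)
  have "irreducible (charpoly3 A)"
    using False deg by (intro irreducible_if_no_roots) auto
  then obtain z where z: "E3.ev (charpoly3 A) z = 0"
    using E3.irreducible_has_root[OF _ deg] card_m by auto
  have "z \<notin> range (emb3 F)"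
  proof
    assume "z \<in> range (emb3 F)"
    then obtain x where x: "z = emb3 F x" by blast
    have "E3.ev p (emb3 F x) = emb3 F (poly p x)" for p
      by (induction p) auto
    then show False using z False x by simp
  qed
  moreover have "GL3_conj A (mat3 F z)"
    using E3.GL3_conj_mult_matrix_3[OF card_m gen3 calculation] z
    by (simp add: E3.ev_charpoly3 mat3_fold)
  ultimately show ?thesis by (intro exI[of _ "Cz z"]) simp
next
  case True
  then obtain a where a: "poly (charpoly3 A) a = 0" by blast
  then have "[:- a, 1:] dvd charpoly3 A" by (simp add: poly_eq_0_iff_dvd)
  then obtain f where f: "charpoly3 A = [:- a, 1:] * f" by (auto simp: dvd_def)
  have monic: "f = [:coeff f 0, coeff f 1, 1:]"
  proof -
    have "f \<noteq> 0" using f by (auto simp: charpoly3_def)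
    then have "degree (charpoly3 A) = 1 + degree f"
      unfolding f by (subst degree_mult_eq) auto
    then have deg: "degree f = 2" by (simp add: charpoly3_def)
    have "lead_coeff (charpoly3 A) = lead_coeff f"
      unfolding f lead_coeff_mult by simp
    then have "coeff f 2 = 1" unfolding deg by (simp add: charpoly3_def)
    then show ?thesis
      using deg by (auto simp: poly_eq_iff coeff_pCons numeral_2_eq_2 coeff_eq_0 split: nat.splits)
  qed
  show ?thesis
  proof (cases "\<exists>b. poly f b = 0")
    case False
    have deg: "degree f = 2" by (subst monic) simp
    have "irreducible f"
      using False deg by (intro irreducible_if_no_roots) auto
    then obtain z where z: "E2.ev f z = 0"
      using E2.irreducible_has_root[OF _ deg] card_l by auto
    have z': "z \<notin> range (emb2 F)"
    proof
      assume "z \<in> range (emb2 F)"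
      then obtain x where x: "z = emb2 F x" by blast
      have "E2.ev p (emb2 F x) = emb2 F (poly p x)" for p
        by (induction p) auto
      then show False using z False x by simp
    qed
    have "GL3_conj A (block_diag (mat2 F z) a)"
      using GL3_conj_block_diag[OF z', of A a "coeff f 0" "coeff f 1"] f z False monic by metis
    moreover have "a \<noteq> 0"
      using calculation A by (auto simp: det_GL3 GL3_conj_det det_block_diag)
    ultimately show ?thesis using z' by (intro exI[of _ "Cka z a"]) simp
  next
    case True
    then obtain b where b: "poly f b = 0" by blast
    \<comment> \<open>The second root, since the roots of the monic \<open>f\<close> add up to
      \<open>- coeff f 1\<close>.\<close>
    define c where "c = - coeff f 1 - b"
    have "coeff f 0 + b * (coeff f 1 + b) = 0"
      using b by (subst (asm) monic) simp
    then have "coeff f 0 = b * c" "coeff f 1 = - b - c"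
      by (simp_all add: c_def algebra_simps eq_neg_iff_add_eq_0)
    then have "f = [:- b, 1:] * [:- c, 1:]"
      by (subst monic) simp
    then have "charpoly3 A = [:- a, 1:] * [:- b, 1:] * [:- c, 1:]"
      using f by (simp only: mult.assoc)
    then show ?thesis by (rule split_has_label[OF A])
  qed
qed

end

section \<open>Induced characters and centralisers\<close>

definition centraliser :: "'a::field^3^3 \<Rightarrow> ('a^3^3) set" where
  "centraliser g = {x \<in> GL3. g ** x = x ** g}"

lemma conj_by_eq_iff: "x \<in> GL3 \<Longrightarrow> matrix_inv x ** g ** x = t \<longleftrightarrow> g ** x = x ** t"
  using GL3_cancel(2)[of x "matrix_inv x ** g ** x" t] GL3_inv(1)[of x]
  by (simp add: matrix_mul_assoc)

text \<open>All conjugators form the coset of the centraliser through any one of them.\<close>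

lemma card_conjugators:
  fixes g :: "'a::{field,finite}^3^3"
  assumes "GL3_conj g t"
  shows "card {x \<in> GL3. g ** x = x ** t} = card (centraliser g)"
proof -
  obtain P where P: "P \<in> GL3" "g ** P = P ** t" using assms by (auto simp: GL3_conj_iff)
  have inj: "inj_on (\<lambda>y. y ** P) (centraliser g)"
    by (auto intro: inj_onI simp: GL3_cancel[OF P(1)])
  have "(\<lambda>y. y ** P) ` centraliser g = {x \<in> GL3. g ** x = x ** t}"
  proof (intro subset_antisym subsetI)
    fix x assume "x \<in> (\<lambda>y. y ** P) ` centraliser g"
    then obtain y where y: "y \<in> GL3" "g ** y = y ** g" "x = y ** P" by (auto simp: centraliser_def)
    have "g ** x = y ** (g ** P)" by (simp add: y(2,3) matrix_mul_assoc)
    then show "x \<in> {x \<in> GL3. g ** x = x ** t}"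
      using y P GL3_mult by (simp add: matrix_mul_assoc)
  next
    fix x assume "x \<in> {x \<in> GL3. g ** x = x ** t}"
    then have x: "x \<in> GL3" "g ** x = x ** t" by auto
    define y where "y = x ** matrix_inv P"
    have yP: "y ** P = x" unfolding y_def using GL3_inv[OF P(1)] by (simp flip: matrix_mul_assoc)
    have "(g ** y) ** P = g ** x"
      using yP by (simp flip: matrix_mul_assoc)
    moreover have "(y ** g) ** P = x ** t"
      unfolding matrix_mul_assoc[symmetric] P(2) unfolding matrix_mul_assoc yP ..
    ultimately have "(g ** y) ** P = (y ** g) ** P"
      using x(2) by simp
    then have "g ** y = y ** g" by (simp add: GL3_cancel[OF P(1)])
    then have "y \<in> centraliser g"
      using x GL3_inv[OF P(1)] GL3_mult by (auto simp: centraliser_def y_def)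
    with yP show "x \<in> (\<lambda>y. y ** P) ` centraliser g" by force
  qed
  then show ?thesis using card_image[OF inj] by simp
qed

text \<open>Sort the sum over \<open>x\<close> by the conjugate reached: every \<open>t\<close> is
  reached by as many \<open>x\<close> as the centraliser has elements.\<close>

lemma induced_eq:
  fixes g :: "'a::{field,finite}^3^3"
  shows "induced H \<theta> g =
    of_nat (card (centraliser g)) / of_nat (card H) * (\<Sum>t | t \<in> H \<and> GL3_conj g t. \<theta> t)"
proof -
  let ?X = "{x \<in> GL3. matrix_inv x ** g ** x \<in> H}"
  let ?T = "{t \<in> H. GL3_conj g t}"
  let ?f = "\<lambda>x. matrix_inv x ** g ** x"
  have "(\<Sum>x\<in>?X. \<theta> (?f x)) = (\<Sum>t\<in>?T. \<Sum>x | x \<in> ?X \<and> ?f x = t. \<theta> (?f x))"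
    by (rule sum.group[symmetric]) (auto intro: GL3_conj_inv)
  also have "\<dots> = (\<Sum>t\<in>?T. of_nat (card (centraliser g)) * \<theta> t)"
  proof (rule sum.cong[OF refl])
    fix t assume t: "t \<in> ?T"
    have "{x. x \<in> ?X \<and> ?f x = t} = {x \<in> GL3. ?f x = t}"
      using t by auto
    also have "\<dots> = {x \<in> GL3. g ** x = x ** t}"
      using conj_by_eq_iff by blast
    finally have "{x. x \<in> ?X \<and> ?f x = t} = {x \<in> GL3. g ** x = x ** t}" .
    then have "card {x. x \<in> ?X \<and> ?f x = t} = card (centraliser g)"
      using card_conjugators t by auto
    then show "(\<Sum>x | x \<in> ?X \<and> ?f x = t. \<theta> (?f x)) = of_nat (card (centraliser g)) * \<theta> t"
      by simp
  qed
  finally show ?thesis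
    by (simp add: induced_def flip: sum_distrib_left)
qed

text \<open>The conjugators from \<open>g\<close> to \<open>h\<close> form a coset of either
  centraliser, on opposite sides.\<close>

lemma GL3_conj_card_centraliser:
  fixes g h :: "'a::{field,finite}^3^3"
  assumes "GL3_conj g h"
  shows "card (centraliser g) = card (centraliser h)"
proof -
  obtain P where P: "P \<in> GL3" "g ** P = P ** h" using assms by (auto simp: GL3_conj_iff)
  have inj: "inj_on (\<lambda>y. P ** y) (centraliser h)"
    by (auto intro: inj_onI simp: GL3_cancel[OF P(1)])
  have "(\<lambda>y. P ** y) ` centraliser h = {x \<in> GL3. g ** x = x ** h}"
  proof (intro subset_antisym subsetI)
    fix x assume "x \<in> (\<lambda>y. P ** y) ` centraliser h"
    then obtain y where y: "y \<in> GL3" "h ** y = y ** h" "x = P ** y" by (auto simp: centraliser_def)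
    have "g ** x = P ** (h ** y)" by (simp add: y(3) matrix_mul_assoc P)
    then show "x \<in> {x \<in> GL3. g ** x = x ** h}"
      using y P GL3_mult by (simp add: matrix_mul_assoc)
  next
    fix x assume "x \<in> {x \<in> GL3. g ** x = x ** h}"
    then have x: "x \<in> GL3" "g ** x = x ** h" by auto
    define y where "y = matrix_inv P ** x"
    have yP: "P ** y = x" unfolding y_def using GL3_inv[OF P(1)] by (simp add: matrix_mul_assoc)
    have "P ** (h ** y) = g ** x"
      unfolding matrix_mul_assoc P(2)[symmetric] unfolding matrix_mul_assoc[symmetric] yP ..
    moreover have "P ** (y ** h) = x ** h"
      unfolding matrix_mul_assoc yP ..
    ultimately have "P ** (h ** y) = P ** (y ** h)"
      using x(2) by simp
    then have "h ** y = y ** h" by (simp add: GL3_cancel[OF P(1)])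
    then have "y \<in> centraliser h"
      using x GL3_inv[OF P(1)] GL3_mult by (auto simp: centraliser_def y_def)
    with yP show "x \<in> (\<lambda>y. P ** y) ` centraliser h" by force
  qed
  then show ?thesis using card_image[OF inj] card_conjugators[OF assms] by simp
qed

lemma induced_conj:
  fixes g h :: "'a::{field,finite}^3^3"
  assumes "GL3_conj g h"
  shows "induced H \<theta> g = induced H \<theta> h"
proof -
  have "GL3_conj g t \<longleftrightarrow> GL3_conj h t" for t
    using assms GL3_conj_sym GL3_conj_trans by blast
  then show ?thesis by (simp add: induced_eq GL3_conj_card_centraliser[OF assms])
qed

lemma induced_singular:
  assumes "H \<subseteq> GL3" "g \<notin> GL3"
  shows "induced H \<theta> g = 0"
proof -
  have "{t. t \<in> H \<and> GL3_conj g t} = {}"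
    using assms GL3_conj_GL3 by blast
  then show ?thesis unfolding induced_eq by (simp only: sum.empty mult_zero_right)
qed

section \<open>Counting invertible matrices row by row\<close>

lemma card_kernel:
  fixes f :: "'a::{finite,ab_group_add} \<Rightarrow> 'b::{finite,ab_group_add}"
  assumes add: "\<And>x y. f (x + y) = f x + f y" and surj: "surj f"
  shows "card {x. f x = 0} * CARD('b) = CARD('a)"
proof -
  have fib: "card {x. f x = y} = card {x. f x = 0}" for y
  proof -
    obtain x0 where x0: "f x0 = y" using surj by (metis surjD)
    have d: "f (x - x0) = f x - f x0" for x
      using add[of "x - x0" x0] by simp
    have "bij_betw (\<lambda>x. x0 + x) {x. f x = 0} {x. f x = y}"
      by (rule bij_betw_byWitness[where f' = "\<lambda>x. x - x0"]) (auto simp: add d x0)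
    then show ?thesis by (rule bij_betw_same_card[symmetric])
  qed
  have "CARD('a) = (\<Sum>y\<in>UNIV. \<Sum>x | x \<in> UNIV \<and> f x = y. 1)"
    by (subst sum.group) auto
  also have "\<dots> = (\<Sum>y\<in>(UNIV :: 'b set). card {x. f x = y})" by simp
  also have "\<dots> = (\<Sum>y\<in>(UNIV :: 'b set). card {x. f x = 0})"
    by (rule sum.cong[OF refl]) (rule fib)
  finally show ?thesis by simp
qed

lemma card_linear_kernel_3:
  fixes c :: "'a::{field,finite}^3"
  assumes "c \<noteq> 0"
  shows "card {x :: 'a^3. c$1 * x$1 + c$2 * x$2 + c$3 * x$3 = 0} = CARD('a) ^ 2"
proof -
  let ?f = "\<lambda>x :: 'a^3. c$1 * x$1 + c$2 * x$2 + c$3 * x$3"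
  have "surj ?f"
  proof -
    consider "c$1 \<noteq> 0" | "c$2 \<noteq> 0" | "c$3 \<noteq> 0"
      using assms by (auto simp: vec_eq_iff forall_3)
    then have "\<exists>x. ?f x = y" for y
    proof cases
      case 1
      then show ?thesis by (intro exI[of _ "vector [y / c$1, 0, 0]"]) simp
    next
      case 2
      then show ?thesis by (intro exI[of _ "vector [0, y / c$2, 0]"]) simp
    next
      case 3
      then show ?thesis by (intro exI[of _ "vector [0, 0, y / c$3]"]) simp
    qed
    then show ?thesis unfolding surj_def by metis
  qed
  then have "card {x. ?f x = 0} * CARD('a) = CARD('a^3)"
    by (intro card_kernel) (auto simp: algebra_simps)
  then show ?thesis by (simp add: power2_eq_square power3_eq_cube)
qed

text \<open>The form is the determinant with rows \<open>c\<close> and \<open>x\<close>, so this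
  counts the second rows that a non-zero first row excludes.\<close>

lemma card_linear_kernel_2:
  fixes c :: "'a::{field,finite}^2"
  assumes "c \<noteq> 0"
  shows "card {x :: 'a^2. c$1 * x$2 - c$2 * x$1 = 0} = CARD('a)"
proof -
  let ?f = "\<lambda>x :: 'a^2. c$1 * x$2 - c$2 * x$1"
  have "surj ?f"
  proof -
    consider "c$1 \<noteq> 0" | "c$2 \<noteq> 0"
      using assms by (auto simp: vec_eq_iff forall_2)
    then have "\<exists>x. ?f x = y" for y
    proof cases
      case 1
      then show ?thesis by (intro exI[of _ "vector [0, y / c$1]"]) simp
    next
      case 2
      then show ?thesis by (intro exI[of _ "vector [- y / c$2, 0]"]) simp
    qed
    then show ?thesis unfolding surj_def by metis
  qed
  then have "card {x. ?f x = 0} * CARD('a) = CARD('a^2)"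
    by (intro card_kernel) (auto simp: algebra_simps)
  then show ?thesis by (simp add: power2_eq_square)
qed

lemma card_compl: "card {x :: 'a::finite. \<not> P x} = CARD('a) - card {x. P x}"
proof -
  have "{x. \<not> P x} = UNIV - {x. P x}" by auto
  then show ?thesis by (simp add: card_Diff_subset)
qed

lemma card_nonzero: "card {x :: 'a::{finite,zero}. x \<noteq> 0} = CARD('a) - 1"
  by (simp add: card_compl)

lemma card_GL2: "card {M :: 'a::{field,finite}^2^2. det M \<noteq> 0} = (CARD('a) ^ 2 - 1) * (CARD('a) ^ 2 - CARD('a))"
proof -
  let ?S = "SIGMA r : {r :: 'a^2. r \<noteq> 0}. {s :: 'a^2. r$1 * s$2 - r$2 * s$1 \<noteq> 0}"
  have "bij_betw (\<lambda>M. (M$1, M$2)) {M :: 'a^2^2. det M \<noteq> 0} ?S"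
    by (rule bij_betw_byWitness[where f' = "\<lambda>(r, s). vector [r, s]"])
      (auto simp: det_2 vec_eq_iff forall_2)
  then have "card {M :: 'a^2^2. det M \<noteq> 0} = card ?S"
    by (rule bij_betw_same_card)
  also have "\<dots> = (\<Sum>r | (r :: 'a^2) \<noteq> 0. card {s :: 'a^2. r$1 * s$2 - r$2 * s$1 \<noteq> 0})"
    by (rule card_SigmaI) auto
  also have "\<dots> = (\<Sum>r | (r :: 'a^2) \<noteq> 0. CARD('a) ^ 2 - CARD('a))"
  proof (rule sum.cong[OF refl])
    fix r :: "'a^2" assume "r \<in> {r. r \<noteq> 0}"
    then show "card {s :: 'a^2. r$1 * s$2 - r$2 * s$1 \<noteq> 0} = CARD('a) ^ 2 - CARD('a)"
      using card_compl[of "\<lambda>s :: 'a^2. r$1 * s$2 - r$2 * s$1 = 0"] card_linear_kernel_2[of r] by simp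
  qed
  finally show ?thesis by (simp add: card_nonzero)
qed

lemma card_GL3:
  "card (GL3 :: ('a::{field,finite}^3^3) set)
    = (CARD('a) ^ 3 - 1) * (CARD('a) ^ 3 - CARD('a)) * (CARD('a) ^ 3 - CARD('a) ^ 2)"
proof -
  \<comment> \<open>The cross product; \<open>D\<close> is the triple product, hence the
    determinant. A first row excludes the \<open>q\<close> second rows on its line, where
    \<open>cr\<close> vanishes, and two independent rows exclude the \<open>q ^ 2\<close> third rows
    orthogonal to their cross product.\<close>
  define cr :: "'a^3 \<Rightarrow> 'a^3 \<Rightarrow> 'a^3" where
    "cr r s = vector [r$2 * s$3 - r$3 * s$2, r$3 * s$1 - r$1 * s$3, r$1 * s$2 - r$2 * s$1]" for r s
  define D :: "'a^3 \<Rightarrow> 'a^3 \<Rightarrow> 'a^3 \<Rightarrow> 'a" where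
    "D r s t = cr r s $ 1 * t$1 + cr r s $ 2 * t$2 + cr r s $ 3 * t$3" for r s t
  let ?T = "\<lambda>r. SIGMA s : {s. cr r s \<noteq> 0}. {t. D r s t \<noteq> 0}"
  let ?S = "SIGMA r : {r :: 'a^3. r \<noteq> 0}. ?T r"
  have det: "det M = D (M$1) (M$2) (M$3)" for M :: "'a^3^3"
    by (simp add: D_def cr_def det_3 algebra_simps)
  have nz: "r \<noteq> 0 \<and> cr r s \<noteq> 0" if "D r s t \<noteq> 0" for r s t
    using that by (auto simp: D_def cr_def vec_eq_iff forall_3)
  have rows: "vector [M$1, M$2, M$3] = M" for M :: "'a^3^3"
    by (simp add: vec_eq_iff forall_3)
  have "bij_betw (\<lambda>M. (M$1, M$2, M$3)) (GL3 :: ('a^3^3) set) ?S"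
  proof (rule bij_betw_byWitness[where f' = "\<lambda>(r, s, t). vector [r, s, t]"])
    show "(\<lambda>M. (M$1, M$2, M$3)) ` (GL3 :: ('a^3^3) set) \<subseteq> ?S"
    proof (rule image_subsetI)
      fix M :: "'a^3^3" assume "M \<in> GL3"
      then have "D (M$1) (M$2) (M$3) \<noteq> 0" by (simp add: det_GL3 det)
      then show "(M$1, M$2, M$3) \<in> ?S" using nz by blast
    qed
  qed (auto simp: det_GL3 det rows)
  then have "card (GL3 :: ('a^3^3) set) = card ?S"
    by (rule bij_betw_same_card)
  also have "\<dots> = (\<Sum>r | (r :: 'a^3) \<noteq> 0. card (?T r))"
    by (rule card_SigmaI) auto
  also have "\<dots> = (\<Sum>r | (r :: 'a^3) \<noteq> 0. (CARD('a) ^ 3 - CARD('a)) * (CARD('a) ^ 3 - CARD('a) ^ 2))"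
  proof (rule sum.cong[OF refl])
    fix r :: "'a^3" assume "r \<in> {r. r \<noteq> 0}"
    then have r: "r \<noteq> 0" by simp
    have "card (?T r) = (\<Sum>s | cr r s \<noteq> 0. card {t. D r s t \<noteq> 0})"
      by (rule card_SigmaI) auto
    also have "\<dots> = (\<Sum>s | cr r s \<noteq> 0. CARD('a) ^ 3 - CARD('a) ^ 2)"
    proof (rule sum.cong[OF refl])
      fix s assume "s \<in> {s. cr r s \<noteq> 0}"
      then show "card {t. D r s t \<noteq> 0} = CARD('a) ^ 3 - CARD('a) ^ 2"
        using card_compl[of "\<lambda>t. D r s t = 0"] card_linear_kernel_3[of "cr r s"] by (simp add: D_def)
    qed
    finally have card_T: "card (?T r) = (\<Sum>s | cr r s \<noteq> 0. CARD('a) ^ 3 - CARD('a) ^ 2)" .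
    have "{s. cr r s = 0} = range (\<lambda>x. x *s r)"
    proof (intro subset_antisym subsetI)
      fix s assume "s \<in> {s. cr r s = 0}"
      then have s: "r$2 * s$3 = r$3 * s$2" "r$3 * s$1 = r$1 * s$3" "r$1 * s$2 = r$2 * s$1"
        by (simp_all add: cr_def vec_eq_iff forall_3)
      consider "r$1 \<noteq> 0" | "r$2 \<noteq> 0" | "r$3 \<noteq> 0"
        using r by (auto simp: vec_eq_iff forall_3)
      then have "\<exists>x. s = x *s r"
      proof cases
        case 1
        then show ?thesis using s
          by (intro exI[of _ "s$1 / r$1"]) (simp add: vec_eq_iff forall_3 field_simps)
      next
        case 2
        then show ?thesis using s
          by (intro exI[of _ "s$2 / r$2"]) (simp add: vec_eq_iff forall_3 field_simps)
      next
        case 3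
        then show ?thesis using s
          by (intro exI[of _ "s$3 / r$3"]) (simp add: vec_eq_iff forall_3 field_simps)
      qed
      then show "s \<in> range (\<lambda>x. x *s r)" by blast
    qed (auto simp: cr_def vec_eq_iff forall_3 algebra_simps)
    then have "card {s. cr r s = 0} = CARD('a)"
      using r by (simp add: card_image inj_on_def)
    then have "card {s. cr r s \<noteq> 0} = CARD('a) ^ 3 - CARD('a)"
      using card_compl[of "\<lambda>s. cr r s = 0"] by simp
    then show "card (?T r) = (CARD('a) ^ 3 - CARD('a)) * (CARD('a) ^ 3 - CARD('a) ^ 2)"
      by (simp add: card_T)
  qed
  finally show ?thesis by (simp add: card_nonzero mult.assoc)
qed

section \<open>Elements of the tori conjugate to a representative\<close>

abbreviation diag3 :: "'a::zero \<Rightarrow> 'a \<Rightarrow> 'a \<Rightarrow> 'a^3^3" where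
  "diag3 a b c \<equiv> upper3 a b c 0 0 0"

lemma upper3_entries [simp]:
  "upper3 a b c x y z $1$1 = a" "upper3 a b c x y z $1$2 = x" "upper3 a b c x y z $1$3 = y"
  "upper3 a b c x y z $2$1 = 0" "upper3 a b c x y z $2$2 = b" "upper3 a b c x y z $2$3 = z"
  "upper3 a b c x y z $3$1 = 0" "upper3 a b c x y z $3$2 = 0" "upper3 a b c x y z $3$3 = c"
  by (simp_all add: upper3_def)

lemma diag3_offdiag: "i \<noteq> j \<Longrightarrow> diag3 a b c $ i $ j = 0"
  using exhaust_3[of i] exhaust_3[of j] by auto

lemma mat_diag3: "mat a = diag3 a a a"
  by (simp add: matrix_3_eq_iff mat_entries)

lemma det_upper3: "det (upper3 a b c x y z) = a * b * (c :: 'a::comm_ring_1)"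
  by (simp add: det_3)

lemma diag3_eq_iff: "diag3 a b c = diag3 a' b' c' \<longleftrightarrow> a = a' \<and> b = b' \<and> c = c'"
  by (auto simp: matrix_3_eq_iff)

lemma diag3_eq_mat: "diag3 a b c = mat u \<longleftrightarrow> a = u \<and> b = u \<and> c = u"
  by (simp add: mat_diag3 diag3_eq_iff)

lemma diag3_diff: "diag3 a b c - mat u = diag3 (a - u) (b - u) (c - (u :: 'a::ring_1))"
  by (simp add: matrix_3_eq_iff mat_entries)

lemma diag3_mult: "diag3 a b c ** diag3 a' b' c' = diag3 (a * a') (b * b') (c * (c' :: 'a::semiring_1))"
  by (simp add: matrix_3_eq_iff mult_3_entry)

lemma diag3_0: "diag3 a b c = 0 \<longleftrightarrow> a = 0 \<and> b = 0 \<and> c = 0"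
  by (auto simp: matrix_3_eq_iff)

lemma GL3_conj_mat_iff': "GL3_conj (mat c) A \<longleftrightarrow> A = mat c"
  using GL3_conj_mat_iff GL3_conj_sym by blast

text \<open>Only the two consequences of semisimplicity that keep the elements of the tori apart from the
  classes of \<open>T\<^sub>1\<^sup>a\<close>, \<open>T\<^sub>1\<^sub>1\<^sup>a\<close> and \<open>T\<^sub>1\<^sup>a\<^sup>b\<close>.\<close>

definition semisimple3 :: "'a::field^3^3 \<Rightarrow> bool" where
  "semisimple3 t \<longleftrightarrow>
     (\<forall>a b. (t - mat a) ** (t - mat a) ** (t - mat b) = 0 \<longrightarrow> (t - mat a) ** (t - mat b) = 0) \<and>
     (\<forall>a. (t - mat a) ** (t - mat a) = 0 \<longrightarrow> t = mat a)"

text \<open>Each Jordan matrix satisfies an equation with a repeated factor. Semisimplicity of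
  \<open>t\<close> lowers the exponent, and transporting the shorter equation back contradicts the
  entry 1. The parameter \<open>z\<close> covers \<open>Ca1\<close> and \<open>Ca11\<close>
  together.\<close>

lemma not_conj_semisimple3:
  assumes t: "semisimple3 (t :: 'a::field^3^3)"
  shows "\<not> GL3_conj (upper3 a a a 1 0 z) t"
    and "a \<noteq> b \<Longrightarrow> \<not> GL3_conj (upper3 a a b 1 0 0) t"
proof -
  show "\<not> GL3_conj (upper3 a a a 1 0 z) t"
  proof
    assume c: "GL3_conj (upper3 a a a 1 0 z) t"
    have "(upper3 a a a 1 0 z - mat a) ** (upper3 a a a 1 0 z - mat a) ** (upper3 a a a 1 0 z - mat a) = 0"
      by (simp add: matrix_3_eq_iff mult_3_entry mat_entries)
    then have "t = mat a"
      using t unfolding GL3_conj_product(2)[OF c] semisimple3_def by blast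
    then have "upper3 a a a 1 0 z = mat a" using c by (simp add: GL3_conj_mat_iff)
    then show False by (simp add: matrix_3_eq_iff mat_entries)
  qed
  show "\<not> GL3_conj (upper3 a a b 1 0 0) t" if "a \<noteq> b"
  proof
    assume c: "GL3_conj (upper3 a a b 1 0 0) t"
    have "(upper3 a a b 1 0 0 - mat a) ** (upper3 a a b 1 0 0 - mat a) ** (upper3 a a b 1 0 0 - mat b) = 0"
      by (simp add: matrix_3_eq_iff mult_3_entry mat_entries)
    then have "(t - mat a) ** (t - mat b) = 0"
      using t unfolding GL3_conj_product(2)[OF c] semisimple3_def by blast
    then have "(upper3 a a b 1 0 0 - mat a) ** (upper3 a a b 1 0 0 - mat b) = 0"
      unfolding GL3_conj_product(1)[OF c] .
    then show False using that by (simp add: matrix_3_eq_iff mult_3_entry mat_entries)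
  qed
qed

lemma semisimple3_diag3: "semisimple3 (diag3 a b (c :: 'a::field))"
  by (auto simp: semisimple3_def diag3_diff diag3_mult diag3_0 diag3_eq_mat)

lemma diag3_perm:
  fixes a b c :: "'a::field"
  shows "GL3_conj (diag3 a b c) (diag3 b a c)" "GL3_conj (diag3 a b c) (diag3 a c b)"
proof -
  let ?P = "vector [vector [0, 1, 0], vector [1, 0, 0], vector [0, 0, 1]] :: 'a^3^3"
  have "det ?P \<noteq> 0" "?P ** diag3 a b c = diag3 b a c ** ?P"
    by (simp_all add: det_3 matrix_3_eq_iff mult_3_entry)
  then show "GL3_conj (diag3 a b c) (diag3 b a c)" by (rule GL3_conj_leftI)
  let ?P = "vector [vector [1, 0, 0], vector [0, 0, 1], vector [0, 1, 0]] :: 'a^3^3"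
  have "det ?P \<noteq> 0" "?P ** diag3 a b c = diag3 a c b ** ?P"
    by (simp_all add: det_3 matrix_3_eq_iff mult_3_entry)
  then show "GL3_conj (diag3 a b c) (diag3 a c b)" by (rule GL3_conj_leftI)
qed

lemma diag3_perm_all:
  fixes a b c :: "'a::field"
  shows "GL3_conj (diag3 a b c) (diag3 a b c)" "GL3_conj (diag3 a b c) (diag3 a c b)"
    "GL3_conj (diag3 a b c) (diag3 b a c)" "GL3_conj (diag3 a b c) (diag3 b c a)"
    "GL3_conj (diag3 a b c) (diag3 c a b)" "GL3_conj (diag3 a b c) (diag3 c b a)"
proof -
  note p = diag3_perm and t = GL3_conj_trans
  show "GL3_conj (diag3 a b c) (diag3 a b c)" by (rule GL3_conj_refl)
  show 1: "GL3_conj (diag3 a b c) (diag3 a c b)" "GL3_conj (diag3 a b c) (diag3 b a c)" by (rule p)+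
  show "GL3_conj (diag3 a b c) (diag3 b c a)" by (rule t[OF 1(2) p(2)])
  show 2: "GL3_conj (diag3 a b c) (diag3 c a b)" by (rule t[OF 1(1) p(1)])
  show "GL3_conj (diag3 a b c) (diag3 c b a)" by (rule t[OF 2 p(2)])
qed

lemma diag3_annihilator:
  fixes t :: "'a::field^3^3"
  assumes "GL3_conj t (diag3 u v w)"
  shows "(t - mat u) ** (t - mat v) ** (t - mat w) = 0"
  unfolding GL3_conj_product(2)[OF assms] diag3_diff diag3_mult diag3_0 by simp

text \<open>The quadratic equation puts \<open>u\<close>, \<open>v\<close>, \<open>w\<close> into
  \<open>{a, b}\<close>, and the determinant fixes the multiplicities up to one exception: for
  \<open>b = - a\<close> it also allows \<open>u = v = w = b\<close>, which is ruled out because a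
  scalar matrix is conjugate only to itself.\<close>

lemma conj_diag3_Cab:
  fixes a b :: "'a::field"
  assumes "a \<noteq> b" "a \<noteq> 0" "b \<noteq> 0"
  shows "GL3_conj (diag3 a a b) (diag3 u v w) \<longleftrightarrow> (u, v, w) \<in> {(a, a, b), (a, b, a), (b, a, a)}"
proof
  assume c: "GL3_conj (diag3 a a b) (diag3 u v w)"
  have "(diag3 a a b - mat a) ** (diag3 a a b - mat b) = 0"
    by (simp add: diag3_diff diag3_mult diag3_0)
  then have "u \<in> {a, b}" "v \<in> {a, b}" "w \<in> {a, b}"
    unfolding GL3_conj_product(1)[OF c] by (auto simp: diag3_diff diag3_mult diag3_0)
  moreover have "a * a * b = u * v * w"
    using GL3_conj_det[OF c] by (simp add: det_upper3)
  moreover have "\<not> (u = b \<and> v = b \<and> w = b)"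
  proof
    assume "u = b \<and> v = b \<and> w = b"
    then have "diag3 a a b = mat b" using c by (simp only: GL3_conj_mat_iff flip: mat_diag3)
    then show False using assms by (simp add: diag3_eq_mat)
  qed
  ultimately show "(u, v, w) \<in> {(a, a, b), (a, b, a), (b, a, a)}"
    using assms by auto
next
  assume "(u, v, w) \<in> {(a, a, b), (a, b, a), (b, a, a)}"
  then show "GL3_conj (diag3 a a b) (diag3 u v w)"
    using diag3_perm_all[of a a b] by auto
qed

text \<open>The product of the factors for \<open>u\<close>, \<open>v\<close>, \<open>w\<close>
  annihilates \<open>diag3 a b c\<close>, so each of the three distinct eigenvalues occurs among
  them.\<close>

lemma conj_diag3_Cabc:
  fixes a b c :: "'a::field"
  assumes "a \<noteq> b" "a \<noteq> c" "b \<noteq> c"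
  shows "GL3_conj (diag3 a b c) (diag3 u v w) \<longleftrightarrow>
    (u, v, w) \<in> {(a, b, c), (a, c, b), (b, a, c), (b, c, a), (c, a, b), (c, b, a)}"
proof
  assume "GL3_conj (diag3 a b c) (diag3 u v w)"
  then have "(diag3 a b c - mat u) ** (diag3 a b c - mat v) ** (diag3 a b c - mat w) = 0"
    by (rule diag3_annihilator)
  then show "(u, v, w) \<in> {(a, b, c), (a, c, b), (b, a, c), (b, c, a), (c, a, b), (c, b, a)}"
    using assms by (auto simp: diag3_diff diag3_mult diag3_0)
next
  assume "(u, v, w) \<in> {(a, b, c), (a, c, b), (b, a, c), (b, c, a), (c, a, b), (c, b, a)}"
  then show "GL3_conj (diag3 a b c) (diag3 u v w)"
    using diag3_perm_all[of a b c] by auto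
qed

section \<open>Conjugacy within and between the three tori\<close>

context tower_setup
begin

text \<open>Scalars are block matrices too, so equations in factors \<open>A - mat a\<close> can be
  computed in the product of the quadratic and the small field, which has no nilpotent
  elements.\<close>

lemma mat_block: "mat a = block_diag (mat2 F (emb2 F a)) a"
  by (simp add: mat2_e block_diag_mat)

lemma block_minus_mat:
  "block_diag (mat2 F x) s - mat a = block_diag (mat2 F (x - emb2 F a)) (s - a)"
  unfolding mat_block by (simp add: block_diag_diff mat2_simps)

lemma block_mult:
  "block_diag (mat2 F x) s ** block_diag (mat2 F y) t = block_diag (mat2 F (x * y)) (s * t)"
  by (simp add: block_diag_mult mat2_simps)

lemma block_eq_0: "block_diag (mat2 F x) s = 0 \<longleftrightarrow> x = 0 \<and> s = 0"
  by (simp add: block_diag_0 mat2_0)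

lemma block_eq_mat: "block_diag (mat2 F x) s = mat a \<longleftrightarrow> x = emb2 F a \<and> s = a"
  unfolding mat_block by (simp add: block_diag_eq_iff mat2_eq_iff)

lemma det_block: "det (block_diag (mat2 F x) s) = norm2 F x * s"
  by (simp add: det_block_diag det_mat2)

lemma semisimple3_block: "semisimple3 (block_diag (mat2 F x) s)"
  by (auto simp: semisimple3_def block_minus_mat block_mult block_eq_0 block_eq_mat)

lemma mat3_minus_mat: "mat3 F z - mat a = mat3 F (z - emb3 F a)"
  by (simp add: mat3_simps mat3_e)

lemma mat3_mult: "mat3 F y ** mat3 F z = mat3 F (y * z)"
  by (simp add: mat3_simps)

lemma semisimple3_mat3: "semisimple3 (mat3 F z)"
  by (auto simp: semisimple3_def mat3_minus_mat mat3_mult mat3_0 mat3_mat_iff)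

lemma block_in_GL3: "block_diag (mat2 F x) s \<in> GL3 \<longleftrightarrow> x \<noteq> 0 \<and> s \<noteq> 0"
  by (simp add: det_GL3 det_block norm2_0)

lemma mat3_in_GL3: "mat3 F z \<in> GL3 \<longleftrightarrow> z \<noteq> 0"
  by (simp add: det_GL3 det_mat3 norm3_0)

lemma cls_rep_simps:
  "cls_rep F (Ca a) = mat a" "cls_rep F (Ca1 a) = upper3 a a a 1 0 0"
  "cls_rep F (Ca11 a) = upper3 a a a 1 0 1" "cls_rep F (Cab a b) = diag3 a a b"
  "cls_rep F (Cab1 a b) = upper3 a a b 1 0 0" "cls_rep F (Cabc a b c) = diag3 a b c"
  "cls_rep F (Cka \<kappa> a) = block_diag (mat2 F \<kappa>) a" "cls_rep F (Cz z) = mat3 F z"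
  unfolding cls_rep_upper3 by (simp_all add: mat_diag3)

declare cls_rep.simps [simp del]

text \<open>An annihilating product of linear factors over the small field would make
  \<open>z\<close> an element of that field.\<close>

lemma conj_block_diag3: "z \<notin> range (emb2 F) \<Longrightarrow> \<not> GL3_conj (block_diag (mat2 F z) a) (diag3 u v w)"
  by (auto dest!: diag3_annihilator simp: block_minus_mat block_mult block_eq_0)

lemma conj_mat3_diag3: "z \<notin> range (emb3 F) \<Longrightarrow> \<not> GL3_conj (mat3 F z) (diag3 u v w)"
  by (auto dest!: diag3_annihilator simp: mat3_minus_mat mat3_mult mat3_0)

lemma conj_diag3_block_Cab:
  assumes "a \<noteq> b" "a \<noteq> 0" "b \<noteq> 0"
  shows "GL3_conj (diag3 a a b) (block_diag (mat2 F x) s) \<longleftrightarrow> x = emb2 F a \<and> s = b"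
proof
  assume c: "GL3_conj (diag3 a a b) (block_diag (mat2 F x) s)"
  have "(diag3 a a b - mat a) ** (diag3 a a b - mat b) = 0"
    by (simp add: diag3_diff diag3_mult diag3_0)
  then have "x \<in> {emb2 F a, emb2 F b}" "s \<in> {a, b}"
    unfolding GL3_conj_product(1)[OF c] by (auto simp: block_minus_mat block_mult block_eq_0)
  moreover have "a * a * b = norm2 F x * s"
    using GL3_conj_det[OF c] by (simp add: det_upper3 det_block)
  moreover have "\<not> (x = emb2 F b \<and> s = b)"
  proof
    assume "x = emb2 F b \<and> s = b"
    then have "diag3 a a b = mat b" using c by (simp only: GL3_conj_mat_iff flip: mat_block)
    then show False using assms by (simp add: diag3_eq_mat)
  qed
  ultimately show "x = emb2 F a \<and> s = b"
    using assms by (auto simp: norm2_e power2_eq_square)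
next
  assume "x = emb2 F a \<and> s = b"
  then have "block_diag (mat2 F x) s = diag3 a a b"
    by (simp add: mat2_e matrix_3_eq_iff mat_entries)
  then show "GL3_conj (diag3 a a b) (block_diag (mat2 F x) s)"
    by (simp add: GL3_conj_refl)
qed

text \<open>The cubic equation forces \<open>x\<close> into the small field. The block matrix is
  then annihilated by two linear factors, too few for three distinct eigenvalues.\<close>

lemma conj_diag3_block_Cabc:
  assumes "a \<noteq> b" "a \<noteq> c" "b \<noteq> c"
  shows "\<not> GL3_conj (diag3 a b c) (block_diag (mat2 F x) s)"
proof
  assume conj: "GL3_conj (diag3 a b c) (block_diag (mat2 F x) s)"
  have "(diag3 a b c - mat a) ** (diag3 a b c - mat b) ** (diag3 a b c - mat c) = 0"
    by (simp add: diag3_diff diag3_mult diag3_0)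
  then have "x = emb2 F a \<or> x = emb2 F b \<or> x = emb2 F c"
    unfolding GL3_conj_product(2)[OF conj] by (auto simp: block_minus_mat block_mult block_eq_0)
  then obtain u where "x = emb2 F u" by blast
  then have "(block_diag (mat2 F x) s - mat u) ** (block_diag (mat2 F x) s - mat s) = 0"
    by (simp add: block_minus_mat block_mult block_eq_0)
  then have "(diag3 a b c - mat u) ** (diag3 a b c - mat s) = 0"
    unfolding GL3_conj_product(1)[OF conj] .
  then show False using assms by (auto simp: diag3_diff diag3_mult diag3_0)
qed

text \<open>The conjugator is the matrix of Frobenius, bordered by 1.\<close>

lemma block_power_q: "GL3_conj (block_diag (mat2 F x) s) (block_diag (mat2 F (x ^ q)) s)"
proof -
  obtain P Q where P: "P ** Q = mat 1" "P ** mat2 F x = mat2 F (x ^ q) ** P"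
    using E2.mult_matrix_power_q[OF bij2] unfolding mat2_fold by metis
  have "det P * det Q = 1" using P(1) by (simp flip: det_mul)
  then have "det P \<noteq> 0" by auto
  then show ?thesis
    by (intro GL3_conj_leftI[of "block_diag P 1"]) (simp_all add: det_block_diag block_diag_mult P)
qed

lemma mat3_power_q: "GL3_conj (mat3 F z) (mat3 F (z ^ q))"
proof -
  obtain P Q where P: "P ** Q = mat 1" "P ** mat3 F z = mat3 F (z ^ q) ** P"
    using E3.mult_matrix_power_q[OF bij3] unfolding mat3_fold by metis
  have "det P * det Q = 1" using P(1) by (simp flip: det_mul)
  then have "det P \<noteq> 0" by auto
  then show ?thesis using P by (intro GL3_conj_leftI[of P]) simp_all
qed

lemma norm2_power_q: "norm2 F (x ^ q) = norm2 F x"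
  using GL3_conj_det[OF block_power_q[of x 1]] by (simp add: det_block)

lemma norm3_power_q: "norm3 F (x ^ q) = norm3 F x"
  using GL3_conj_det[OF mat3_power_q[of x]] by (simp add: det_mat3)

lemma det_mat_minus_block:
  "det (mat z - map_matrix (emb2 F) (block_diag (mat2 F x) s)) = (z - x) * (z - x ^ q) * (z - emb2 F s)"
proof -
  have "mat z - map_matrix (emb2 F) (block_diag (mat2 F x) s)
    = block_diag (mat z - map_matrix (emb2 F) (mat2 F x)) (z - emb2 F s)"
    by (simp add: matrix_3_eq_iff mat_entries)
  then show ?thesis by (simp add: det_block_diag det_mat_minus_mat2)
qed

text \<open>Evaluating both characteristic polynomials at \<open>\<kappa>\<close> makes
  \<open>x\<close> equal to \<open>\<kappa>\<close> or its conjugate. These have the same norm, so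
  comparing determinants gives \<open>s = a\<close>.\<close>

lemma conj_block_block:
  assumes \<kappa>: "\<kappa> \<notin> range (emb2 F)" and a: "a \<noteq> 0"
  shows "GL3_conj (block_diag (mat2 F \<kappa>) a) (block_diag (mat2 F x) s) \<longleftrightarrow>
    (x, s) \<in> {(\<kappa>, a), (\<kappa> ^ q, a)}"
proof
  assume c: "GL3_conj (block_diag (mat2 F \<kappa>) a) (block_diag (mat2 F x) s)"
  have "(\<kappa> - x) * (\<kappa> - x ^ q) * (\<kappa> - emb2 F s) = 0"
    using E2.GL3_conj_map_det[OF c, of \<kappa>] by (simp add: det_mat_minus_block)
  then have "x = \<kappa> \<or> \<kappa> = x ^ q" using \<kappa> by auto
  then have x: "x = \<kappa> \<or> x = \<kappa> ^ q" using pow_q_q_2[of x] by auto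
  have "\<kappa> \<noteq> 0" using \<kappa> E2.e_0 by (metis rangeI)
  moreover have "norm2 F \<kappa> * a = norm2 F x * s"
    using GL3_conj_det[OF c] by (simp add: det_block)
  ultimately have "s = a" using x by (auto simp: norm2_power_q norm2_0)
  with x show "(x, s) \<in> {(\<kappa>, a), (\<kappa> ^ q, a)}" by auto
next
  assume "(x, s) \<in> {(\<kappa>, a), (\<kappa> ^ q, a)}"
  then show "GL3_conj (block_diag (mat2 F \<kappa>) a) (block_diag (mat2 F x) s)"
    using block_power_q[of \<kappa> a] GL3_conj_refl by auto
qed

text \<open>Evaluation at \<open>z\<close> makes \<open>z\<close> a conjugate of \<open>y\<close>;
  the relation is symmetric because Frobenius applied three times is the identity.\<close>

lemma conj_mat3_mat3:
  assumes z: "z \<notin> range (emb3 F)"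
  shows "GL3_conj (mat3 F z) (mat3 F y) \<longleftrightarrow> y \<in> {z, z ^ q, z ^ (q ^ 2)}"
proof
  assume c: "GL3_conj (mat3 F z) (mat3 F y)"
  have "(z - y) * (z - y ^ q) * (z - y ^ (q ^ 2)) = 0"
    using E3.GL3_conj_map_det[OF c, of z] by (simp add: det_mat_minus_mat3)
  then have "z = y \<or> z = y ^ q \<or> z = (y ^ q) ^ q" by (auto simp: E3.power_q_power_q)
  then show "y \<in> {z, z ^ q, z ^ (q ^ 2)}"
    using pow_q_q_q_3[of y] by (auto simp flip: E3.power_q_power_q)
next
  assume "y \<in> {z, z ^ q, z ^ (q ^ 2)}"
  then show "GL3_conj (mat3 F z) (mat3 F y)"
    using mat3_power_q[of z] mat3_power_q[of "z ^ q"] GL3_conj_refl GL3_conj_trans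
    by (auto simp flip: E3.power_q_power_q)
qed

lemma root_mat3: "det (mat a - mat3 F z) = norm3 F (emb3 F a - z)"
  by (simp add: mat3_simps mat3_e flip: det_mat3)

lemma conj_root: "GL3_conj A B \<Longrightarrow> det (mat a - A) = det (mat a - B)"
  using GL3_conj_charpoly3[of A B] by (simp flip: poly_charpoly3)

lemma conj_mat3_block:
  assumes "z \<notin> range (emb3 F)"
  shows "\<not> GL3_conj (mat3 F z) (block_diag (mat2 F x) s)"
proof
  assume "GL3_conj (mat3 F z) (block_diag (mat2 F x) s)"
  then have "det (mat s - mat3 F z) = det (mat s - block_diag (mat2 F x) s)" by (rule conj_root)
  also have "\<dots> = 0" by (simp add: det_3 mat_entries)
  finally show False using assms by (auto simp: root_mat3 norm3_0)
qed

text \<open>Multiplication by \<open>z\<close> has an eigenvalue in the small field only if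
  \<open>z - emb3 F a\<close> has norm zero for some \<open>a\<close>, that is, only if it is
  scalar. This separates \<open>torus_a F\<close> from the block and the diagonal classes.\<close>

lemma conj_mat3_root:
  assumes "GL3_conj A (mat3 F z)" "det (mat a - A) = 0"
  shows "A = mat a"
proof -
  have "z = emb3 F a"
    using conj_root[OF assms(1), of a] assms(2) by (simp add: root_mat3 norm3_0)
  then show ?thesis using assms(1) by (simp add: mat3_e GL3_conj_mat_iff)
qed

lemma conj_block_mat3: "\<kappa> \<notin> range (emb2 F) \<Longrightarrow> \<not> GL3_conj (block_diag (mat2 F \<kappa>) a) (mat3 F z)"
  using conj_mat3_root[of "block_diag (mat2 F \<kappa>) a" z a] by (auto simp: det_3 mat_entries block_eq_mat)

lemma conj_diag3_mat3: "\<not> (a = b \<and> b = c) \<Longrightarrow> \<not> GL3_conj (diag3 a b c) (mat3 F z)"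
  using conj_mat3_root[of "diag3 a b c" z a] by (auto simp: det_3 mat_entries mat_diag3 diag3_eq_iff)

text \<open>An endomorphism commuting with multiplication by a generator is determined by its value at \<open>1\<close>.\<close>

lemma commute_mat3:
  assumes z: "z \<notin> range (emb3 F)" and c: "mat3 F z ** A = A ** mat3 F z"
  shows "\<exists>w. A = mat3 F w"
proof -
  define cm where "cm = E3.comb b3"
  have cm: "cm (mat3 F w *v v) = w * cm v" for w v by (simp add: cm_def comb_mat3)
  note lin = E3.comb_add[of b3, folded cm_def] E3.comb_scale[of b3, folded cm_def]
  obtain v0 where v0: "cm v0 = 1" using bij3 unfolding cm_def by (metis bij_pointE)
  define w where "w = cm (A *v v0)"
  have com: "A *v (mat3 F z *v v) = mat3 F z *v (A *v v)" for v
    using c by (simp add: matrix_vector_mul_assoc)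
  have "cm (A *v v) = w * cm v" for v
  proof -
    obtain g where g: "E3.comb (vector [1, z, z ^ 2] :: 'm^3) g = cm v"
      using E3.bij_comb_3[OF card_m z] by (metis bij_pointE)
    let ?v = "g$1 *s v0 + g$2 *s (mat3 F z *v v0) + g$3 *s (mat3 F z *v (mat3 F z *v v0))"
    have "cm ?v = cm v"
      by (simp add: lin cm v0 flip: g) (simp add: E3.comb_def sum_3 power2_eq_square)
    then have v: "v = ?v" using E3.comb_eq_iff[OF bij3] by (simp add: cm_def)
    have "cm (A *v ?v) = w * cm ?v"
      by (simp add: matrix_vector_right_distrib vec.scale com lin cm v0 flip: w_def) (simp add: algebra_simps)
    then show ?thesis using v by simp
  qed
  then have "A = mat3 F w"
    using E3.mult_matrix_eqI[OF bij3, of A w] by (simp add: cm_def mat3_fold)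
  then show ?thesis ..
qed

lemma commute_mat2:
  assumes z: "z \<notin> range (emb2 F)" and c: "mat2 F z ** A = A ** mat2 F z"
  shows "\<exists>w. A = mat2 F w"
proof -
  define cm where "cm = E2.comb b2"
  have cm: "cm (mat2 F w *v v) = w * cm v" for w v by (simp add: cm_def comb_mat2)
  note lin = E2.comb_add[of b2, folded cm_def] E2.comb_scale[of b2, folded cm_def]
  obtain v0 where v0: "cm v0 = 1" using bij2 unfolding cm_def by (metis bij_pointE)
  define w where "w = cm (A *v v0)"
  have com: "A *v (mat2 F z *v v) = mat2 F z *v (A *v v)" for v
    using c by (simp add: matrix_vector_mul_assoc)
  have "cm (A *v v) = w * cm v" for v
  proof -
    obtain g where g: "E2.comb (vector [1, z] :: 'l^2) g = cm v"
      using E2.bij_comb_2[OF card_l z] by (metis bij_pointE)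
    let ?v = "g$1 *s v0 + g$2 *s (mat2 F z *v v0)"
    have "cm ?v = cm v"
      by (simp add: lin cm v0 flip: g) (simp add: E2.comb_def sum_2)
    then have v: "v = ?v" using E2.comb_eq_iff[OF bij2] by (simp add: cm_def)
    have "cm (A *v ?v) = w * cm ?v"
      by (simp add: matrix_vector_right_distrib vec.scale com lin cm v0 flip: w_def) (simp add: algebra_simps)
    then show ?thesis using v by simp
  qed
  then have "A = mat2 F w"
    using E2.mult_matrix_eqI[OF bij2, of A w] by (simp add: cm_def mat2_fold)
  then show ?thesis ..
qed

section \<open>Centralisers and orders of the tori\<close>

lemma centraliser_mat3:
  assumes "z \<notin> range (emb3 F)"
  shows "centraliser (mat3 F z) = torus_a F"
proof -
  have "A \<in> torus_a F" if "A \<in> centraliser (mat3 F z)" for A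
    using that commute_mat3[OF assms, of A] by (auto simp: centraliser_def torus_a_def mat3_in_GL3)
  moreover have "A \<in> centraliser (mat3 F z)" if "A \<in> torus_a F" for A
    using that by (auto simp: centraliser_def torus_a_def mat3_in_GL3 mat3_mult mult.commute)
  ultimately show ?thesis by blast
qed

text \<open>Since \<open>\<kappa>\<close> is not \<open>emb2 F a\<close>, the matrix
  \<open>mat2 F \<kappa> - mat a\<close> is invertible, which kills the off-diagonal blocks of a
  commuting matrix. Its upper block commutes with \<open>mat2 F \<kappa>\<close>.\<close>

lemma centraliser_block:
  assumes \<kappa>: "\<kappa> \<notin> range (emb2 F)"
  shows "centraliser (block_diag (mat2 F \<kappa>) a) = torus_m F"
proof -
  have "A \<in> torus_m F" if A: "A \<in> centraliser (block_diag (mat2 F \<kappa>) a)" for A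
  proof -
    let ?K = "mat2 F \<kappa>"
    have eq: "block_diag ?K a ** A = A ** block_diag ?K a" and G: "A \<in> GL3"
      using A by (auto simp: centraliser_def)
    have "\<kappa> \<noteq> emb2 F a" using \<kappa> by blast
    then have "det (?K - mat a) \<noteq> 0"
      by (simp add: det_mat2 norm2_0 flip: mat2_e mat2_simps)
    then have d: "(?K$1$1 - a) * (?K$2$2 - a) - ?K$1$2 * ?K$2$1 \<noteq> 0"
      by (simp add: det_2 mat_entries)
    have zero: "x = 0 \<and> y = 0" if "p * x + r * y = 0" "s * x + t * y = 0" "p * t - r * s \<noteq> 0"
      for x y p r s t :: 'k
    proof -
      have "(p * t - r * s) * x = 0" "(p * t - r * s) * y = 0"
        using that(1,2) by algebra+
      then show ?thesis using that(3) by simp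
    qed
    have "A$1$3 = 0 \<and> A$2$3 = 0"
      by (rule zero[of "?K$1$1 - a" _ "?K$1$2" _ "?K$2$1" "?K$2$2 - a"])
        (use eq d in \<open>simp_all add: matrix_3_eq_iff mult_3_entry algebra_simps\<close>)
    moreover have "A$3$1 = 0 \<and> A$3$2 = 0"
      by (rule zero[of "?K$1$1 - a" _ "?K$2$1" _ "?K$1$2" "?K$2$2 - a"])
        (use eq d in \<open>simp_all add: matrix_3_eq_iff mult_3_entry algebra_simps\<close>)
    ultimately have Ab: "A = block_diag (vector [vector [A$1$1, A$1$2], vector [A$2$1, A$2$2]]) (A$3$3)"
      (is "_ = block_diag ?B _") by (simp add: matrix_3_eq_iff)
    have "?K ** ?B = ?B ** ?K"
      using eq by (subst (asm) (1 2) Ab) (simp add: block_diag_mult block_diag_eq_iff)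
    then obtain w where "?B = mat2 F w" using commute_mat2[OF \<kappa>] by blast
    then have A_eq: "A = block_diag (mat2 F w) (A$3$3)" using Ab by simp
    then have "w \<noteq> 0 \<and> A$3$3 \<noteq> 0" using G block_in_GL3[of w "A$3$3"] by simp
    with A_eq show ?thesis unfolding torus_m_def by blast
  qed
  moreover have "A \<in> centraliser (block_diag (mat2 F \<kappa>) a)" if "A \<in> torus_m F" for A
    using that by (auto simp: centraliser_def torus_m_def block_in_GL3 block_mult mult.commute)
  ultimately show ?thesis by blast
qed

lemma centraliser_mat: "centraliser (mat a) = (GL3 :: ('k^3^3) set)"
  by (auto simp: centraliser_def mat_commute)

lemma torus_i_eq: "torus_i = (\<lambda>(a, b, c). diag3 a b c) ` ({a. a \<noteq> 0} \<times> {b. b \<noteq> 0} \<times> {c :: 'k. c \<noteq> 0})"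
proof (intro subset_antisym subsetI)
  fix A :: "'k^3^3" assume A: "A \<in> torus_i"
  then have "A = diag3 (A$1$1) (A$2$2) (A$3$3)"
    by (simp add: torus_i_def matrix_3_eq_iff)
  moreover from this A have "A$1$1 \<noteq> 0 \<and> A$2$2 \<noteq> 0 \<and> A$3$3 \<noteq> 0"
    using det_upper3[of "A$1$1" "A$2$2" "A$3$3" 0 0 0] by (auto simp: torus_i_def det_GL3)
  ultimately show "A \<in> (\<lambda>(a, b, c). diag3 a b c) ` ({a. a \<noteq> 0} \<times> {b. b \<noteq> 0} \<times> {c. c \<noteq> 0})"
    by force
next
  fix A :: "'k^3^3"
  assume "A \<in> (\<lambda>(a, b, c). diag3 a b c) ` ({a. a \<noteq> 0} \<times> {b. b \<noteq> 0} \<times> {c. c \<noteq> 0})"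
  then show "A \<in> torus_i"
    by (auto simp: torus_i_def det_GL3 det_upper3 diag3_offdiag)
qed

lemma inj_diag3: "inj_on (\<lambda>(a, b, c). diag3 a b c) S"
  by (auto intro!: inj_onI simp: diag3_eq_iff)

lemma torus_m_eq: "torus_m F = (\<lambda>(x, a). block_diag (mat2 F x) a) ` ({x. x \<noteq> 0} \<times> {a. a \<noteq> 0})"
  by (auto simp: torus_m_def)

lemma inj_block: "inj_on (\<lambda>(x, a). block_diag (mat2 F x) a) S"
  by (auto intro!: inj_onI simp: block_diag_eq_iff mat2_eq_iff)

lemma torus_a_eq: "torus_a F = mat3 F ` {z. z \<noteq> 0}"
  by (auto simp: torus_a_def)

lemma inj_mat3: "inj_on (mat3 F) S"
  by (auto intro!: inj_onI simp: mat3_eq_iff)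

lemma card_torus_i: "card (torus_i :: ('k^3^3) set) = (q - 1) ^ 3"
  unfolding torus_i_eq
  by (subst card_image[OF inj_diag3]) (simp add: card_cartesian_product card_nonzero q_eq power3_eq_cube)

lemma card_torus_m: "card (torus_m F) = (q ^ 2 - 1) * (q - 1)"
  unfolding torus_m_eq
  by (subst card_image[OF inj_block]) (simp add: card_cartesian_product card_nonzero card_l flip: q_eq)

lemma card_torus_a: "card (torus_a F) = q ^ 3 - 1"
  unfolding torus_a_eq
  by (subst card_image[OF inj_mat3]) (simp add: card_nonzero card_m)

lemma centraliser_Cabc:
  assumes "a \<noteq> b" "a \<noteq> c" "b \<noteq> (c :: 'k)"
  shows "centraliser (diag3 a b c) = torus_i"
proof -
  have "A \<in> centraliser (diag3 a b c) \<longleftrightarrow> A \<in> torus_i" for A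
    using assms
    by (auto simp: centraliser_def torus_i_def matrix_3_eq_iff mult_3_entry forall_3 mult.commute)
  then show ?thesis by blast
qed

lemma card_centraliser_Cab:
  assumes "a \<noteq> (b :: 'k)"
  shows "card (centraliser (diag3 a a b)) = (q ^ 2 - 1) * (q ^ 2 - q) * (q - 1)"
proof -
  have "A \<in> centraliser (diag3 a a b) \<longleftrightarrow>
    A \<in> (\<lambda>(M, s). block_diag M s) ` ({M. det M \<noteq> 0} \<times> {s. s \<noteq> 0})" (is "_ \<longleftrightarrow> A \<in> ?S") for A
  proof
    assume A: "A \<in> centraliser (diag3 a a b)"
    then have "A$1$3 = 0" "A$2$3 = 0" "A$3$1 = 0" "A$3$2 = 0"
      using assms by (auto simp: centraliser_def matrix_3_eq_iff mult_3_entry mult.commute)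
    then have Ab: "A = block_diag (vector [vector [A$1$1, A$1$2], vector [A$2$1, A$2$2]]) (A$3$3)"
      (is "_ = block_diag ?B _") by (simp add: matrix_3_eq_iff)
    moreover have "det ?B \<noteq> 0 \<and> A$3$3 \<noteq> 0"
      using A Ab det_block_diag[of ?B "A$3$3"] by (auto simp: centraliser_def det_GL3)
    ultimately show "A \<in> ?S" by force
  next
    assume "A \<in> ?S"
    then show "A \<in> centraliser (diag3 a a b)"
      by (auto simp: centraliser_def det_GL3 det_block_diag matrix_3_eq_iff mult_3_entry)
  qed
  then have "centraliser (diag3 a a b) = ?S" for A by blast
  then show ?thesis
    by (simp add: card_image inj_on_def block_diag_eq_iff card_cartesian_product card_nonzero card_GL2 q_eq)
qed

end

section \<open>Values of the characters\<close>

lemma induced_image: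
  fixes g :: "'a::{field,finite}^3^3"
  assumes inj: "inj_on p S"
  shows "induced (p ` S) \<theta> g =
    of_nat (card (centraliser g)) / of_nat (card (p ` S)) * (\<Sum>s | s \<in> S \<and> GL3_conj g (p s). \<theta> (p s))"
proof -
  have "{t. t \<in> p ` S \<and> GL3_conj g t} = p ` {s. s \<in> S \<and> GL3_conj g (p s)}" by auto
  moreover have "inj_on p {s. s \<in> S \<and> GL3_conj g (p s)}"
    using inj by (rule inj_on_subset) auto
  ultimately show ?thesis
    unfolding induced_eq by (simp add: sum.reindex)
qed

lemma mult_char_mult: "mult_char \<mu> \<Longrightarrow> \<mu> (x * y) = \<mu> x * \<mu> y"
  by (cases "x = 0"; cases "y = 0") (auto simp: mult_char_def)

lemma mult_char_1: "mult_char \<mu> \<Longrightarrow> \<mu> 1 = 1"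
  using mult_char_mult[of \<mu> 1 1] by (auto simp: mult_char_def)

lemma mult_char_power: "mult_char \<mu> \<Longrightarrow> \<mu> (x ^ n) = \<mu> x ^ n"
  by (induction n) (auto simp: mult_char_1 mult_char_mult)

context tower_setup
begin

text \<open>The choice made inside \<open>class_fun\<close>. It does not depend on the value
  function, so sums and products of class functions can be formed label by label.\<close>

definition label :: "'k^3^3 \<Rightarrow> ('k, 'l, 'm) cls" where
  "label g = (SOME c. is_cls F c \<and> GL3_conj g (cls_rep F c))"

lemma label:
  assumes "g \<in> GL3"
  shows "is_cls F (label g)" "GL3_conj g (cls_rep F (label g))"
  using someI_ex[OF has_label[OF assms]] by (auto simp: label_def)

lemma class_fun_label: "class_fun F v g = (if g \<in> GL3 then v (label g) else 0)"
  by (simp add: class_fun_def label_def)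

lemma class_fun_cong:
  assumes "\<And>c. is_cls F c \<Longrightarrow> v c = w c"
  shows "class_fun F v = class_fun F w"
  using assms label(1) by (auto simp: class_fun_label fun_eq_iff)

lemma class_fun_mult: "class_fun F v * class_fun F w = class_fun F (\<lambda>c. v c * w c)"
  by (auto simp: class_fun_label fun_eq_iff)

lemma class_fun_add: "class_fun F v + class_fun F w = class_fun F (\<lambda>c. v c + w c)"
  by (auto simp: class_fun_label fun_eq_iff)

lemma class_fun_diff: "class_fun F v - class_fun F w = class_fun F (\<lambda>c. v c - w c)"
proof
  fix g
  show "(class_fun F v - class_fun F w) g = class_fun F (\<lambda>c. v c - w c) g"
    by (simp add: class_fun_label fun_diff_def)
qed

lemma class_fun_double: "2 * class_fun F v = class_fun F (\<lambda>c. 2 * v c)"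
  by (simp only: mult_2 class_fun_add)

lemmas class_fun_ops = class_fun_mult class_fun_add class_fun_diff class_fun_double

text \<open>Brings functions defined by other means, such as \<open>\<alpha> \<circ> det\<close> and
  the induced characters, into the same tabulated form as the \<open>chi\<close> functions.\<close>

lemma conj_invariant_class_fun:
  assumes "\<And>g h. GL3_conj g h \<Longrightarrow> f g = f h" "\<And>g. g \<notin> GL3 \<Longrightarrow> f g = 0"
  shows "f = class_fun F (\<lambda>c. f (cls_rep F c))"
proof
  fix g
  show "f g = class_fun F (\<lambda>c. f (cls_rep F c)) g"
    using assms(1)[OF label(2), of g] assms(2)[of g] by (simp add: class_fun_label)
qed

lemma comp_det_class_fun:
  assumes "\<alpha> 0 = 0"
  shows "\<alpha> \<circ> det = class_fun F (\<lambda>c. \<alpha> (det (cls_rep F c)))"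
proof -
  have "\<alpha> \<circ> det = class_fun F (\<lambda>c. (\<alpha> \<circ> det) (cls_rep F c))"
    using assms by (intro conj_invariant_class_fun) (auto simp: det_GL3 dest: GL3_conj_det)
  then show ?thesis by simp
qed

section \<open>Group orders and indices as polynomials in \<open>Q\<close>\<close>

abbreviation Q :: complex where "Q \<equiv> of_nat q"

lemma Q_nonzero: "Q \<noteq> 0" "Q - 1 \<noteq> 0" "Q ^ 2 - 1 \<noteq> 0" "Q ^ 3 - 1 \<noteq> 0"
proof -
  have q: "q > 1" by (rule E2.q_gt_1)
  then show "Q \<noteq> 0" "Q - 1 \<noteq> 0" by auto
  have "q ^ 2 > 1" "q ^ 3 > 1" using q one_less_power[of q] by auto
  then have "of_nat (q ^ 2) \<noteq> (1 :: complex)" "of_nat (q ^ 3) \<noteq> (1 :: complex)"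
    unfolding of_nat_eq_1_iff by auto
  then show "Q ^ 2 - 1 \<noteq> 0" "Q ^ 3 - 1 \<noteq> 0" by auto
qed

lemma of_nat_power_diff: "i \<le> j \<Longrightarrow> of_nat (q ^ j - q ^ i) = Q ^ j - Q ^ i"
  using E2.q_gt_1 by (subst of_nat_diff) (auto intro: power_increasing)

lemma of_nat_power_diffs:
  "of_nat (q - 1) = Q - 1" "of_nat (q ^ 2 - 1) = Q ^ 2 - 1" "of_nat (q ^ 3 - 1) = Q ^ 3 - 1"
  "of_nat (q ^ 2 - q) = Q ^ 2 - Q" "of_nat (q ^ 3 - q) = Q ^ 3 - Q"
  "of_nat (q ^ 3 - q ^ 2) = Q ^ 3 - Q ^ 2"
  using of_nat_power_diff[of 0 1] of_nat_power_diff[of 0 2] of_nat_power_diff[of 0 3]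
    of_nat_power_diff[of 1 2] of_nat_power_diff[of 1 3] of_nat_power_diff[of 2 3]
  by simp_all

lemma of_nat_card_GL3: "of_nat (card (GL3 :: ('k^3^3) set)) = (Q ^ 3 - 1) * (Q ^ 3 - Q) * (Q ^ 3 - Q ^ 2)"
  unfolding card_GL3 q_eq[symmetric] of_nat_mult of_nat_power_diffs ..

lemma of_nat_card_centraliser_Cab:
  "a \<noteq> b \<Longrightarrow> of_nat (card (centraliser (diag3 a a (b :: 'k)))) = (Q ^ 2 - 1) * (Q ^ 2 - Q) * (Q - 1)"
  unfolding card_centraliser_Cab of_nat_mult of_nat_power_diffs ..

lemma of_nat_card_tori:
  "of_nat (card (torus_i :: ('k^3^3) set)) = (Q - 1) ^ 3"
  "of_nat (card (torus_m F)) = (Q ^ 2 - 1) * (Q - 1)"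
  "of_nat (card (torus_a F)) = Q ^ 3 - 1"
  unfolding card_torus_i card_torus_m card_torus_a of_nat_mult of_nat_power of_nat_power_diffs by simp_all

lemma divide_eqI: "D \<noteq> 0 \<Longrightarrow> X = Y * D \<Longrightarrow> X / D = (Y :: complex)"
  by simp

text \<open>The indices of the three tori, hence the degrees of the induced characters.\<close>

lemma index_GL3:
  "of_nat (card (GL3 :: ('k^3^3) set)) / (Q - 1) ^ 3 = Q ^ 3 * (Q + 1) * (Q ^ 2 + Q + 1)"
  "of_nat (card (GL3 :: ('k^3^3) set)) / ((Q ^ 2 - 1) * (Q - 1)) = Q ^ 3 * (Q ^ 3 - 1)"
  "of_nat (card (GL3 :: ('k^3^3) set)) / (Q ^ 3 - 1) = Q ^ 3 * (Q - 1) * (Q ^ 2 - 1)"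
  unfolding of_nat_card_GL3
proof -
  note nz = Q_nonzero
  show "(Q ^ 3 - 1) * (Q ^ 3 - Q) * (Q ^ 3 - Q ^ 2) / (Q - 1) ^ 3 = Q ^ 3 * (Q + 1) * (Q ^ 2 + Q + 1)"
    by (rule divide_eqI) (use nz in simp, algebra)
  show "(Q ^ 3 - 1) * (Q ^ 3 - Q) * (Q ^ 3 - Q ^ 2) / ((Q ^ 2 - 1) * (Q - 1)) = Q ^ 3 * (Q ^ 3 - 1)"
    by (rule divide_eqI) (use nz in simp, algebra)
  show "(Q ^ 3 - 1) * (Q ^ 3 - Q) * (Q ^ 3 - Q ^ 2) / (Q ^ 3 - 1) = Q ^ 3 * (Q - 1) * (Q ^ 2 - 1)"
    by (rule divide_eqI) (use nz in simp, algebra)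
qed

lemma index_centraliser_Cab:
  assumes "a \<noteq> (b :: 'k)"
  shows "of_nat (card (centraliser (diag3 a a b))) / (Q - 1) ^ 3 = Q * (Q + 1)"
    "of_nat (card (centraliser (diag3 a a b))) / ((Q ^ 2 - 1) * (Q - 1)) = Q * (Q - 1)"
  unfolding of_nat_card_centraliser_Cab[OF assms]
proof -
  note nz = Q_nonzero
  show "(Q ^ 2 - 1) * (Q ^ 2 - Q) * (Q - 1) / (Q - 1) ^ 3 = Q * (Q + 1)"
    by (rule divide_eqI) (use nz in simp, algebra)
  show "(Q ^ 2 - 1) * (Q ^ 2 - Q) * (Q - 1) / ((Q ^ 2 - 1) * (Q - 1)) = Q * (Q - 1)"
    by (rule divide_eqI) (use nz in simp, algebra)
qed

text \<open>Coefficients are quotients of the order of the centraliser by that of the torus; the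
  catch-all clause covers the classes that do not meet the torus.\<close>

fun ind_i_value :: "('k \<Rightarrow> complex) \<Rightarrow> ('k \<Rightarrow> complex) \<Rightarrow> ('k \<Rightarrow> complex) \<Rightarrow> ('k, 'l, 'm) cls \<Rightarrow> complex" where
  "ind_i_value \<alpha> \<beta> \<gamma> (Ca a) = Q ^ 3 * (Q + 1) * (Q ^ 2 + Q + 1) * (\<alpha> a * \<beta> a * \<gamma> a)"
| "ind_i_value \<alpha> \<beta> \<gamma> (Cab a b) =
    Q * (Q + 1) * (\<alpha> a * \<beta> a * \<gamma> b + \<alpha> a * \<beta> b * \<gamma> a + \<alpha> b * \<beta> a * \<gamma> a)"
| "ind_i_value \<alpha> \<beta> \<gamma> (Cabc a b c) =
    \<alpha> a * \<beta> b * \<gamma> c + \<alpha> a * \<beta> c * \<gamma> b + \<alpha> b * \<beta> a * \<gamma> c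
    + \<alpha> b * \<beta> c * \<gamma> a + \<alpha> c * \<beta> a * \<gamma> b + \<alpha> c * \<beta> b * \<gamma> a"
| "ind_i_value \<alpha> \<beta> \<gamma> _ = 0"

fun ind_m_value :: "('l \<Rightarrow> complex) \<Rightarrow> ('k \<Rightarrow> complex) \<Rightarrow> ('k, 'l, 'm) cls \<Rightarrow> complex" where
  "ind_m_value \<Lambda> \<alpha> (Ca a) = Q ^ 3 * (Q ^ 3 - 1) * (\<Lambda> (emb2 F a) * \<alpha> a)"
| "ind_m_value \<Lambda> \<alpha> (Cab a b) = Q * (Q - 1) * (\<Lambda> (emb2 F a) * \<alpha> b)"
| "ind_m_value \<Lambda> \<alpha> (Cka \<kappa> a) = \<Lambda> \<kappa> * \<alpha> a + \<Lambda> (\<kappa> ^ q) * \<alpha> a"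
| "ind_m_value \<Lambda> \<alpha> _ = 0"

fun ind_a_value :: "('m \<Rightarrow> complex) \<Rightarrow> ('k, 'l, 'm) cls \<Rightarrow> complex" where
  "ind_a_value \<phi> (Ca a) = Q ^ 3 * (Q - 1) * (Q ^ 2 - 1) * \<phi> (emb3 F a)"
| "ind_a_value \<phi> (Cz z) = \<phi> z + \<phi> (z ^ q) + \<phi> ((z ^ q) ^ q)"
| "ind_a_value \<phi> _ = 0"

lemma Ind_i_sum:
  "Ind_i \<alpha> \<beta> \<gamma> (g :: 'k^3^3) = of_nat (card (centraliser g)) / (Q - 1) ^ 3 *
    (\<Sum>(a, b, c) | (a \<noteq> 0 \<and> b \<noteq> 0 \<and> c \<noteq> 0) \<and> GL3_conj g (diag3 a b c). \<alpha> a * \<beta> b * \<gamma> c)"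
proof -
  have "Ind_i \<alpha> \<beta> \<gamma> g = of_nat (card (centraliser g)) / of_nat (card (torus_i :: ('k^3^3) set)) *
    (\<Sum>s | s \<in> ({a. a \<noteq> 0} \<times> {b. b \<noteq> 0} \<times> {c. c \<noteq> 0}) \<and> GL3_conj g (case s of (a, b, c) \<Rightarrow> diag3 a b c).
      case s of (a, b, c) \<Rightarrow> \<alpha> a * \<beta> b * \<gamma> c)"
    unfolding Ind_i_def torus_i_eq induced_image[OF inj_diag3] by (simp add: case_prod_unfold)
  also have "{s. s \<in> ({a. a \<noteq> 0} \<times> {b. b \<noteq> 0} \<times> {c. c \<noteq> 0}) \<and> GL3_conj g (case s of (a, b, c) \<Rightarrow> diag3 a b c)}
    = {(a, b, c). (a \<noteq> 0 \<and> b \<noteq> 0 \<and> c \<noteq> 0) \<and> GL3_conj g (diag3 a b c)}" by auto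
  finally show ?thesis by (simp only: of_nat_card_tori)
qed

lemma Ind_m_sum:
  "Ind_m F \<Lambda> \<alpha> g = of_nat (card (centraliser g)) / ((Q ^ 2 - 1) * (Q - 1)) *
    (\<Sum>(x, a) | (x \<noteq> 0 \<and> a \<noteq> 0) \<and> GL3_conj g (block_diag (mat2 F x) a). \<Lambda> x * \<alpha> a)"
proof -
  \<comment> \<open>The \<open>inv\<close> in \<open>Ind_m\<close> ranges over all pairs; the
    parametrisation is injective even where an entry is zero.\<close>
  have inv: "inv (\<lambda>(x, a). block_diag (mat2 F x) a) (case s of (x, a) \<Rightarrow> block_diag (mat2 F x) a) = s" for s
    by (rule inv_f_f[OF inj_block])
  have "Ind_m F \<Lambda> \<alpha> g = of_nat (card (centraliser g)) / of_nat (card (torus_m F)) *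
    (\<Sum>s | s \<in> ({x. x \<noteq> 0} \<times> {a. a \<noteq> 0}) \<and> GL3_conj g (case s of (x, a) \<Rightarrow> block_diag (mat2 F x) a).
      case s of (x, a) \<Rightarrow> \<Lambda> x * \<alpha> a)"
    unfolding Ind_m_def torus_m_eq induced_image[OF inj_block] inv ..
  also have "{s. s \<in> ({x. x \<noteq> 0} \<times> {a. a \<noteq> 0}) \<and> GL3_conj g (case s of (x, a) \<Rightarrow> block_diag (mat2 F x) a)}
    = {(x, a). (x \<noteq> 0 \<and> a \<noteq> 0) \<and> GL3_conj g (block_diag (mat2 F x) a)}" by auto
  finally show ?thesis by (simp only: of_nat_card_tori)
qed

lemma Ind_a_sum:
  "Ind_a F \<phi> g = of_nat (card (centraliser g)) / (Q ^ 3 - 1) *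
    (\<Sum>z | z \<noteq> 0 \<and> GL3_conj g (mat3 F z). \<phi> z)"
proof -
  have inv: "inv (mat3 F) (mat3 F z) = z" for z
    by (rule inv_f_f[OF inj_mat3])
  show ?thesis
    unfolding Ind_a_def torus_a_eq induced_image[OF inj_mat3] inv
    unfolding torus_a_eq[symmetric] of_nat_card_tori by simp
qed

lemma Ind_i_value:
  assumes c: "is_cls F c"
  shows "Ind_i \<alpha> \<beta> \<gamma> (cls_rep F c) = ind_i_value \<alpha> \<beta> \<gamma> c"
proof -
  let ?S = "{(u, v, w). (u \<noteq> 0 \<and> v \<noteq> 0 \<and> w \<noteq> 0) \<and> GL3_conj (cls_rep F c) (diag3 u v w)}"
  have zero: ?thesis if "?S = {}" "ind_i_value \<alpha> \<beta> \<gamma> c = 0"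
    unfolding Ind_i_sum that by simp
  show ?thesis
  proof (cases c)
    case (Ca a)
    then have S: "?S = {(a, a, a)}"
      using c by (auto simp: cls_rep_simps GL3_conj_mat_iff' diag3_eq_mat)
    then show ?thesis
      unfolding Ind_i_sum S by (simp add: Ca cls_rep_simps centraliser_mat index_GL3)
  next
    case (Ca1 a)
    then show ?thesis
      by (intro zero) (simp_all add: cls_rep_simps not_conj_semisimple3(1)[OF semisimple3_diag3])
  next
    case (Ca11 a)
    then show ?thesis
      by (intro zero) (simp_all add: cls_rep_simps not_conj_semisimple3(1)[OF semisimple3_diag3])
  next
    case (Cab a b)
    then have ab: "a \<noteq> b" "a \<noteq> 0" "b \<noteq> 0" using c by auto
    then have S: "?S = {(a, a, b), (a, b, a), (b, a, a)}"
      by (auto simp: Cab cls_rep_simps conj_diag3_Cab)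
    then show ?thesis
      unfolding Ind_i_sum S using ab by (simp add: Cab cls_rep_simps index_centraliser_Cab)
  next
    case (Cab1 a b)
    then have "a \<noteq> b" using c by auto
    then show ?thesis
      using Cab1 by (intro zero) (simp_all add: cls_rep_simps not_conj_semisimple3(2)[OF semisimple3_diag3])
  next
    case (Cabc a b d)
    then have abd: "a \<noteq> b" "a \<noteq> d" "b \<noteq> d" "a \<noteq> 0" "b \<noteq> 0" "d \<noteq> 0" using c by auto
    let ?X = "{(a, b, d), (a, d, b), (b, a, d), (b, d, a), (d, a, b), (d, b, a)}"
    have conj: "GL3_conj (cls_rep F c) (diag3 u v w) \<longleftrightarrow> (u, v, w) \<in> ?X" for u v w
      unfolding Cabc cls_rep_simps by (rule conj_diag3_Cabc[OF abd(1-3)])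
    have nz: "(u, v, w) \<in> ?X \<Longrightarrow> u \<noteq> 0 \<and> v \<noteq> 0 \<and> w \<noteq> 0" for u v w
      using abd by auto
    have "s \<in> ?S \<longleftrightarrow> s \<in> ?X" for s
    proof -
      obtain u v w where s: "s = (u, v, w)" by (cases s)
      show ?thesis
        unfolding s mem_Collect_eq case_prod_conv conj
        by (rule iffI[OF conjunct2 conjI[OF nz]])
    qed
    then have S: "?S = ?X" by (rule set_eqI)
    \<comment> \<open>A regular element: its centraliser is the torus itself.\<close>
    have "of_nat (card (centraliser (diag3 a b d))) / (Q - 1) ^ 3 = 1"
      using abd Q_nonzero by (simp add: centraliser_Cabc of_nat_card_tori)
    then show ?thesis
      unfolding Ind_i_sum S using abd by (simp add: Cabc cls_rep_simps)
  next
    case (Cka \<kappa> a)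
    then show ?thesis using c by (intro zero) (simp_all add: cls_rep_simps conj_block_diag3)
  next
    case (Cz z)
    then show ?thesis using c by (intro zero) (simp_all add: cls_rep_simps conj_mat3_diag3)
  qed
qed

lemma Ind_m_value:
  assumes c: "is_cls F c"
  shows "Ind_m F \<Lambda> \<alpha> (cls_rep F c) = ind_m_value \<Lambda> \<alpha> c"
proof -
  let ?S = "{(x, s). (x \<noteq> 0 \<and> s \<noteq> 0) \<and> GL3_conj (cls_rep F c) (block_diag (mat2 F x) s)}"
  have zero: ?thesis if "?S = {}" "ind_m_value \<Lambda> \<alpha> c = 0"
    unfolding Ind_m_sum that by simp
  show ?thesis
  proof (cases c)
    case (Ca a)
    then have S: "?S = {(emb2 F a, a)}"
      using c by (auto simp: cls_rep_simps GL3_conj_mat_iff' block_eq_mat)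
    then show ?thesis
      unfolding Ind_m_sum S by (simp add: Ca cls_rep_simps centraliser_mat index_GL3)
  next
    case (Ca1 a)
    then show ?thesis
      by (intro zero) (simp_all add: cls_rep_simps not_conj_semisimple3(1)[OF semisimple3_block])
  next
    case (Ca11 a)
    then show ?thesis
      by (intro zero) (simp_all add: cls_rep_simps not_conj_semisimple3(1)[OF semisimple3_block])
  next
    case (Cab a b)
    then have ab: "a \<noteq> b" "a \<noteq> 0" "b \<noteq> 0" using c by auto
    then have S: "?S = {(emb2 F a, b)}"
      by (auto simp: Cab cls_rep_simps conj_diag3_block_Cab)
    then show ?thesis
      unfolding Ind_m_sum S using ab by (simp add: Cab cls_rep_simps index_centraliser_Cab)
  next
    case (Cab1 a b)
    then have "a \<noteq> b" using c by auto
    then show ?thesis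
      using Cab1 by (intro zero) (simp_all add: cls_rep_simps not_conj_semisimple3(2)[OF semisimple3_block])
  next
    case (Cabc a b d)
    then show ?thesis using c by (intro zero) (simp_all add: cls_rep_simps conj_diag3_block_Cabc)
  next
    case (Cka \<kappa> a)
    then have \<kappa>: "\<kappa> \<notin> range (emb2 F)" and a: "a \<noteq> 0" using c by auto
    have nz: "\<kappa> \<noteq> 0" using \<kappa> E2.e_0 by (metis rangeI)
    have S: "?S = {(\<kappa>, a), (\<kappa> ^ q, a)}"
      using nz a by (auto simp: Cka cls_rep_simps conj_block_block[OF \<kappa> a])
    \<comment> \<open>Otherwise the sum over \<open>?S\<close> would have one term instead of
      two.\<close>
    have ne: "\<kappa> \<noteq> \<kappa> ^ q" using \<kappa> by (metis E2.power_q_eq_iff)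
    have "of_nat (card (centraliser (block_diag (mat2 F \<kappa>) a))) / ((Q ^ 2 - 1) * (Q - 1)) = 1"
      using Q_nonzero by (simp add: centraliser_block[OF \<kappa>] of_nat_card_tori)
    then show ?thesis
      unfolding Ind_m_sum S using ne by (simp add: Cka cls_rep_simps)
  next
    case (Cz z)
    then show ?thesis using c by (intro zero) (simp_all add: cls_rep_simps conj_mat3_block)
  qed
qed

lemma Ind_a_value:
  assumes c: "is_cls F c"
  shows "Ind_a F \<phi> (cls_rep F c) = ind_a_value \<phi> c"
proof -
  let ?S = "{z. z \<noteq> 0 \<and> GL3_conj (cls_rep F c) (mat3 F z)}"
  have zero: ?thesis if "?S = {}" "ind_a_value \<phi> c = 0"
    unfolding Ind_a_sum that by simp
  show ?thesis
  proof (cases c)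
    case (Ca a)
    then have S: "?S = {emb3 F a}"
      using c by (auto simp: cls_rep_simps GL3_conj_mat_iff' mat3_mat_iff)
    then show ?thesis
      unfolding Ind_a_sum S by (simp add: Ca cls_rep_simps centraliser_mat index_GL3)
  next
    case (Ca1 a)
    then show ?thesis
      by (intro zero) (simp_all add: cls_rep_simps not_conj_semisimple3(1)[OF semisimple3_mat3])
  next
    case (Ca11 a)
    then show ?thesis
      by (intro zero) (simp_all add: cls_rep_simps not_conj_semisimple3(1)[OF semisimple3_mat3])
  next
    case (Cab a b)
    then show ?thesis using c by (intro zero) (simp_all add: cls_rep_simps conj_diag3_mat3)
  next
    case (Cab1 a b)
    then have "a \<noteq> b" using c by auto
    then show ?thesis
      using Cab1 by (intro zero) (simp_all add: cls_rep_simps not_conj_semisimple3(2)[OF semisimple3_mat3])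
  next
    case (Cabc a b d)
    then show ?thesis using c by (intro zero) (simp_all add: cls_rep_simps conj_diag3_mat3)
  next
    case (Cka \<kappa> a)
    then show ?thesis using c by (intro zero) (simp_all add: cls_rep_simps conj_block_mat3)
  next
    case (Cz z)
    then have z: "z \<notin> range (emb3 F)" using c by auto
    have nz: "z \<noteq> 0" using z E3.e_0 by (metis rangeI)
    have S: "?S = {z, z ^ q, (z ^ q) ^ q}"
      using nz by (auto simp: Cz cls_rep_simps conj_mat3_mat3[OF z] E3.power_q_power_q)
    have "of_nat (card (centraliser (mat3 F z))) / (Q ^ 3 - 1) = 1"
      using Q_nonzero by (simp add: centraliser_mat3[OF z] of_nat_card_tori)
    moreover have "z \<noteq> z ^ q" "z \<noteq> (z ^ q) ^ q" "z ^ q \<noteq> (z ^ q) ^ q"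
      using E3.conjugates_3_distinct[OF card_m z] by metis+
    ultimately show ?thesis
      unfolding Ind_a_sum S by (simp add: Cz cls_rep_simps)
  qed
qed

lemma induced_class_fun:
  assumes "H \<subseteq> GL3"
  shows "induced H \<theta> = class_fun F (\<lambda>c. induced H \<theta> (cls_rep F c))"
  by (rule conj_invariant_class_fun) (erule induced_conj, rule induced_singular[OF assms])

lemma Ind_i_class_fun: "Ind_i \<alpha> \<beta> \<gamma> = class_fun F (ind_i_value \<alpha> \<beta> \<gamma>)"
proof -
  have "Ind_i \<alpha> \<beta> \<gamma> = class_fun F (\<lambda>c. Ind_i \<alpha> \<beta> \<gamma> (cls_rep F c))"
    unfolding Ind_i_def by (rule induced_class_fun) (auto simp: torus_i_def)
  also have "\<dots> = class_fun F (ind_i_value \<alpha> \<beta> \<gamma>)"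
    by (rule class_fun_cong) (rule Ind_i_value)
  finally show ?thesis .
qed

lemma Ind_m_class_fun: "Ind_m F \<Lambda> \<alpha> = class_fun F (ind_m_value \<Lambda> \<alpha>)"
proof -
  have "Ind_m F \<Lambda> \<alpha> = class_fun F (\<lambda>c. Ind_m F \<Lambda> \<alpha> (cls_rep F c))"
    unfolding Ind_m_def by (rule induced_class_fun) (auto simp: torus_m_def block_in_GL3)
  also have "\<dots> = class_fun F (ind_m_value \<Lambda> \<alpha>)"
    by (rule class_fun_cong) (rule Ind_m_value)
  finally show ?thesis .
qed

lemma Ind_a_class_fun: "Ind_a F \<phi> = class_fun F (ind_a_value \<phi>)"
proof -
  have "Ind_a F \<phi> = class_fun F (\<lambda>c. Ind_a F \<phi> (cls_rep F c))"
    unfolding Ind_a_def by (rule induced_class_fun) (auto simp: torus_a_def mat3_in_GL3)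
  also have "\<dots> = class_fun F (ind_a_value \<phi>)"
    by (rule class_fun_cong) (rule Ind_a_value)
  finally show ?thesis .
qed

lemma det_cls_rep:
  "det (cls_rep F (Ca a)) = a * a * a" "det (cls_rep F (Ca1 a)) = a * a * a"
  "det (cls_rep F (Ca11 a)) = a * a * a" "det (cls_rep F (Cab a b)) = a * a * b"
  "det (cls_rep F (Cab1 a b)) = a * a * b" "det (cls_rep F (Cabc a b c)) = a * b * c"
  "det (cls_rep F (Cka \<kappa> a)) = norm2 F \<kappa> * a" "det (cls_rep F (Cz z)) = norm3 F z"
  by (simp_all add: cls_rep_simps det_upper3 det_block det_mat3 mat_diag3)

lemma chi_one_triv: "chi_one triv = class_fun F (\<lambda>c. 1)"
  by (auto simp: chi_one_def class_fun_label triv_def det_GL3 fun_eq_iff)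

text \<open>\<open>triv \<circ> det\<close> is the indicator function of \<open>GL3\<close>, off
  which \<open>class_fun\<close> vanishes.\<close>

lemma q2q_triv: "(triv \<circ> det) * class_fun F v = class_fun F v"
  by (auto simp: class_fun_label triv_def det_GL3 fun_eq_iff)

lemma det_mult_class_fun:
  "mult_char \<alpha> \<Longrightarrow> (\<alpha> \<circ> det) * class_fun F v = class_fun F (\<lambda>c. \<alpha> (det (cls_rep F c)) * v c)"
  using comp_det_class_fun[of \<alpha>] by (simp add: class_fun_mult mult_char_def)

end

section \<open>Tensor products\<close>

lemma mult_char_times: "mult_char \<mu> \<Longrightarrow> mult_char \<nu> \<Longrightarrow> mult_char (\<mu> * \<nu>)"
  by (simp add: mult_char_def)

lemma square_apply: "(f ^ 2) x = f x * f x" for f :: "'a \<Rightarrow> complex"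
  by (simp add: power2_eq_square)

lemma ext_apply: "is_extension e \<alpha> \<omega> \<Longrightarrow> \<omega> (e a) = \<alpha> a"
  by (auto simp: is_extension_def)

context tower_setup
begin

lemma class_fun_eqI:
  assumes "\<And>a. v (Ca a) = w (Ca a)" "\<And>a. v (Ca1 a) = w (Ca1 a)" "\<And>a. v (Ca11 a) = w (Ca11 a)"
    "\<And>a b. v (Cab a b) = w (Cab a b)" "\<And>a b. v (Cab1 a b) = w (Cab1 a b)"
    "\<And>a b c. v (Cabc a b c) = w (Cabc a b c)" "\<And>\<kappa> a. v (Cka \<kappa> a) = w (Cka \<kappa> a)"
    "\<And>z. v (Cz z) = w (Cz z)"
  shows "class_fun F v = class_fun F w"
proof (rule class_fun_cong)
  fix c
  show "v c = w c" by (cases c) (simp_all add: assms)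
qed

text \<open>Collapses each side of an identity into one \<open>class_fun\<close>;
  \<open>value_simps\<close> then evaluates at a label. There \<open>q ^ 2\<close>-th powers are
  rewritten as iterated \<open>q\<close>-th powers, so that three applications of Frobenius
  cancel.\<close>

lemmas chi_values = chi_quad_def chi_split_def chi_cubic_def chi_q3_def chi_q2q_def chi_one_triv
  q2q_triv Let_def q_eq[symmetric] Ind_i_class_fun Ind_m_class_fun Ind_a_class_fun
  class_fun_ops

lemmas value_simps = det_cls_rep mult_char_mult norm2_power_q norm3_power_q
  norm2_e norm3_e pow_q_q_2 pow_q_q_q_3 twist_def square_apply E3.power_q_power_q[symmetric]
  cls.case ind_i_value.simps ind_m_value.simps ind_a_value.simps times_fun_apply o_apply
  mult_char_power

text \<open>On \<open>Cka\<close> the left side vanishes, and the induced character is cancelled by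
  the \<open>chi_quad\<close> term built with the same extension \<open>\<omega>\<^sub>1\<close>.
  Elsewhere only restrictions to the small field enter.\<close>

lemma quad_split_extended:
  assumes "is_extension (emb2 F) (\<gamma> * \<delta>) \<omega>\<^sub>1" "is_extension (emb2 F) (\<beta> * \<delta>) \<omega>\<^sub>2"
    "is_extension (emb2 F) (\<beta> * \<gamma>) \<omega>\<^sub>3"
  shows "chi_quad F \<alpha> \<Lambda> * chi_split F \<beta> \<gamma> \<delta> =
    Ind_m F (\<omega>\<^sub>1 * \<Lambda>) (\<alpha> * \<beta>) + chi_quad F (\<alpha> * \<beta>) (\<omega>\<^sub>1 * \<Lambda>)
    + (chi_quad F (\<alpha> * \<gamma>) (\<omega>\<^sub>2 * \<Lambda>) + chi_quad F (\<alpha> * \<delta>) (\<omega>\<^sub>3 * \<Lambda>)) * chi_q2q F triv"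
  unfolding chi_values
  by (rule class_fun_eqI; simp only: value_simps assms[THEN ext_apply]; algebra)

text \<open>The norm squares elements of the small field, so the second parameter restricts to the
  square of \<open>\<alpha> * (\<Lambda> \<circ> emb2 F)\<close>. Wherever \<open>chi_split\<close>
  is non-zero, the \<open>chi_quad\<close> factor is thus this character of the determinant times a
  number.\<close>

lemma quad_norm_split:
  assumes "mult_char \<alpha>"
  shows "chi_quad F (\<alpha> * (\<Lambda> \<circ> emb2 F)) ((\<alpha> \<circ> norm2 F) * \<Lambda> ^ 2) * chi_split F \<beta> \<gamma> \<delta> =
    Ind_i (\<alpha> * (\<Lambda> \<circ> emb2 F) * \<beta>) (\<alpha> * (\<Lambda> \<circ> emb2 F) * \<gamma>) (\<alpha> * (\<Lambda> \<circ> emb2 F) * \<delta>)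
    - chi_split F (\<alpha> * (\<Lambda> \<circ> emb2 F) * \<beta>) (\<alpha> * (\<Lambda> \<circ> emb2 F) * \<gamma>) (\<alpha> * (\<Lambda> \<circ> emb2 F) * \<delta>)"
  unfolding chi_values
  by (rule class_fun_eqI; simp only: value_simps assms; algebra)

text \<open>On \<open>Cka\<close> a product of two sums over conjugates has four terms: the two
  matching ones form the induced character, the two mixed ones the twisted
  \<open>chi_quad\<close>.\<close>

lemma quad_quad:
  shows "chi_quad F \<alpha> \<Lambda> * chi_quad F \<beta> \<mu> =
    Ind_m F (\<Lambda> * \<mu>) (\<alpha> * \<beta>) - chi_quad F (\<alpha> * \<beta>) (\<Lambda> * twist q \<mu>)"
  unfolding chi_values
  by (rule class_fun_eqI; simp only: value_simps E2.power_q_e; algebra)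

text \<open>The product lives on \<open>Ca\<close>, \<open>Ca1\<close>, \<open>Ca11\<close>, where
  only restrictions to the small field matter. This leaves room for one form with
  \<open>Ind_a\<close> and another with \<open>Ind_m\<close>; in each, the correction cancels the
  induced character on the non-split classes.\<close>

lemma quad_cubic_extended:
  assumes "is_extension (emb3 F) \<alpha> \<omega>\<^sub>1" "is_extension (emb3 F) (\<Lambda> \<circ> emb2 F) \<omega>\<^sub>2"
  shows "chi_quad F \<alpha> \<Lambda> * chi_cubic F \<phi> =
    Ind_a F (\<omega>\<^sub>1 * \<omega>\<^sub>2 * \<phi>) - chi_cubic F (\<omega>\<^sub>1 * \<omega>\<^sub>2 * \<phi>)"
  unfolding chi_values
  by (rule class_fun_eqI; simp only: value_simps assms[THEN ext_apply]; algebra)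

lemma quad_cubic:
  shows "chi_quad F \<alpha> \<Lambda> * chi_cubic F \<phi> =
    Ind_m F \<Lambda> (\<alpha> * (\<phi> \<circ> emb3 F)) + chi_quad F (\<alpha> * (\<phi> \<circ> emb3 F)) \<Lambda> * (chi_one triv - chi_q2q F triv)"
  unfolding chi_values
  by (rule class_fun_eqI; simp only: value_simps; algebra)

text \<open>Apart from the factor \<open>\<delta> \<circ> det\<close>, \<open>chi_q3\<close> is the
  Steinberg character: zero on \<open>Ca1\<close>, \<open>Ca11\<close>, \<open>Cab1\<close>, and
  elsewhere, up to sign, the power of the characteristic in the order of the centraliser. It thereby
  converts \<open>chi_split\<close> into an induced character without a correction; the next two
  products follow the same pattern.\<close>

lemma q3_split:
  assumes "mult_char \<delta>"
  shows "chi_q3 F \<delta> * chi_split F \<alpha> \<beta> \<gamma> = Ind_i (\<alpha> * \<delta>) (\<beta> * \<delta>) (\<gamma> * \<delta>)"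
  unfolding chi_values det_mult_class_fun[OF assms]
  by (rule class_fun_eqI; simp only: value_simps assms; algebra)

lemma q3_cubic:
  assumes "mult_char \<alpha>"
  shows "chi_q3 F \<alpha> * chi_cubic F \<phi> = Ind_a F ((\<alpha> \<circ> norm3 F) * \<phi>)"
  unfolding chi_values det_mult_class_fun[OF assms]
  by (rule class_fun_eqI; simp only: value_simps assms; algebra)

lemma q3_quad:
  assumes "mult_char \<alpha>"
  shows "chi_q3 F \<alpha> * chi_quad F \<beta> \<Lambda> = Ind_m F ((\<alpha> \<circ> norm2 F) * \<Lambda>) (\<alpha> * \<beta>)"
  unfolding chi_values det_mult_class_fun[OF assms]
  by (rule class_fun_eqI; simp only: value_simps assms; algebra)

lemma q3_q3_m:
  assumes "mult_char \<alpha>" "mult_char \<beta>"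
  shows "chi_q3 F \<alpha> * chi_q3 F \<beta> =
    Ind_m F ((\<alpha> * \<beta>) \<circ> norm2 F) (\<alpha> * \<beta>) + chi_q3 F (\<alpha> * \<beta>)"
  unfolding chi_values det_mult_class_fun[OF mult_char_times[OF assms]] assms[THEN det_mult_class_fun]
  by (rule class_fun_eqI; simp only: value_simps assms; algebra)

text \<open>On \<open>Cabc\<close>, \<open>Cka\<close>, \<open>Cz\<close> the factor
  \<open>2 * chi_q2q F triv + chi_one triv\<close> is 5, 1, -1, the regular minus the sign character
  of the symmetric group; times \<open>chi_q3\<close> it is the regular minus the trivial
  one.\<close>

lemma q3_q3_i:
  assumes "mult_char \<alpha>" "mult_char \<beta>"
  shows "chi_q3 F \<alpha> * chi_q3 F \<beta> =
    Ind_i (\<alpha> * \<beta>) (\<alpha> * \<beta>) (\<alpha> * \<beta>) - chi_q3 F (\<alpha> * \<beta>) * (2 * chi_q2q F triv + chi_one triv)"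
  unfolding chi_values det_mult_class_fun[OF mult_char_times[OF assms]] assms[THEN det_mult_class_fun]
  by (rule class_fun_eqI; simp only: value_simps assms; algebra)

lemma q3_q3_a:
  assumes "mult_char \<alpha>" "mult_char \<beta>"
  shows "chi_q3 F \<alpha> * chi_q3 F \<beta> =
    Ind_a F ((\<alpha> * \<beta>) \<circ> norm3 F) + chi_q3 F (\<alpha> * \<beta>) * (chi_q2q F triv - chi_one triv)"
  unfolding chi_values det_mult_class_fun[OF mult_char_times[OF assms]] assms[THEN det_mult_class_fun]
  by (rule class_fun_eqI; simp only: value_simps assms; algebra)

text \<open>On \<open>Cz\<close> the left side vanishes, and the last factor is -1 there, which
  makes the correction cancel the induced character.\<close>

lemma cubic_split_extended:
  assumes "is_extension (emb3 F) (\<alpha> * \<beta> * \<gamma>) \<omega>"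
  shows "chi_cubic F \<phi> * chi_split F \<alpha> \<beta> \<gamma> =
    Ind_a F (\<phi> * \<omega>) + chi_cubic F (\<phi> * \<omega>) * (2 * chi_q2q F triv + chi_one triv)"
  unfolding chi_values
  by (rule class_fun_eqI; simp only: value_simps assms[THEN ext_apply]; algebra)

text \<open>The same cancellation on \<open>Cabc\<close>, where
  \<open>chi_one triv - chi_q2q F triv\<close> is -1.\<close>

lemma cubic_split:
  shows "chi_cubic F \<phi> * chi_split F \<alpha> \<beta> \<gamma> =
    Ind_i \<alpha> \<beta> ((\<phi> \<circ> emb3 F) * \<gamma>)
    + chi_split F \<alpha> \<beta> ((\<phi> \<circ> emb3 F) * \<gamma>) * (chi_one triv - chi_q2q F triv)"
  unfolding chi_values
  by (rule class_fun_eqI; simp only: value_simps; algebra)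

text \<open>On \<open>Cz\<close> the nine products fall into three groups by relative conjugation:
  the induced character and the two twisted terms. The last factor is 0 there.\<close>

lemma cubic_cubic:
  shows "chi_cubic F \<phi> * chi_cubic F \<psi> =
    Ind_a F (\<phi> * \<psi>) + chi_cubic F (\<phi> * twist q \<psi>) + chi_cubic F (\<phi> * twist (q ^ 2) \<psi>)
    - chi_cubic F (\<phi> * \<psi>) * (chi_q2q F triv + chi_one triv)"
  unfolding chi_values
  by (rule class_fun_eqI; simp only: value_simps E3.power_q_e; algebra)

text \<open>On \<open>Cabc\<close> the 36 products fall into six groups by relative permutation: the
  identity gives the induced character, the other five the \<open>chi_split\<close> terms. The last
  factor is 0 there, so its term corrects only the classes with a repeated eigenvalue.\<close>

lemma split_split:
  shows "chi_split F \<alpha> \<beta> \<gamma> * chi_split F \<delta> \<epsilon> \<eta> =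
    Ind_i (\<alpha> * \<delta>) (\<beta> * \<epsilon>) (\<gamma> * \<eta>)
    + (chi_split F (\<alpha> * \<delta>) (\<beta> * \<eta>) (\<gamma> * \<epsilon>)
       + chi_split F (\<alpha> * \<epsilon>) (\<beta> * \<delta>) (\<gamma> * \<eta>)
       + chi_split F (\<alpha> * \<epsilon>) (\<beta> * \<eta>) (\<gamma> * \<delta>)
       + chi_split F (\<alpha> * \<eta>) (\<beta> * \<delta>) (\<gamma> * \<epsilon>)
       + chi_split F (\<alpha> * \<eta>) (\<beta> * \<epsilon>) (\<gamma> * \<delta>))
    + (chi_split F (\<alpha> * \<epsilon>) (\<beta> * \<eta>) (\<gamma> * \<delta>) + chi_split F (\<alpha> * \<eta>) (\<beta> * \<delta>) (\<gamma> * \<epsilon>))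
      * (chi_q2q F triv - 2 * chi_one triv)"
  unfolding chi_values
  by (rule class_fun_eqI; simp only: value_simps; algebra)

end

theorem theorem1:
  fixes F :: "('k::{field,finite}, 'l::{field,finite}, 'm::{field,finite}) tower"
    and q :: nat
    and \<alpha> \<beta> \<gamma> \<delta> \<epsilon> \<eta> :: "'k \<Rightarrow> complex"
    and \<Lambda> \<mu> :: "'l \<Rightarrow> complex"
    and \<phi> \<psi> :: "'m \<Rightarrow> complex"
  assumes "is_tower F" and "q = CARD('k)"
    and "mult_char \<alpha>" "mult_char \<beta>" "mult_char \<gamma>" "mult_char \<delta>" "mult_char \<epsilon>" "mult_char \<eta>"
    and "mult_char \<Lambda>" "mult_char \<mu>"
    and "mult_char \<phi>" "mult_char \<psi>"
  shows "(irr_quad F \<Lambda> \<and> irr_split \<beta> \<gamma> \<delta> \<longrightarrow>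
      (\<forall>\<omega>\<^sub>1 \<omega>\<^sub>2 \<omega>\<^sub>3. is_extension (emb2 F) (\<gamma> * \<delta>) \<omega>\<^sub>1 \<and> is_extension (emb2 F) (\<beta> * \<delta>) \<omega>\<^sub>2
          \<and> is_extension (emb2 F) (\<beta> * \<gamma>) \<omega>\<^sub>3 \<longrightarrow>
        chi_quad F \<alpha> \<Lambda> * chi_split F \<beta> \<gamma> \<delta> =
          Ind_m F (\<omega>\<^sub>1 * \<Lambda>) (\<alpha> * \<beta>) + chi_quad F (\<alpha> * \<beta>) (\<omega>\<^sub>1 * \<Lambda>)
          + (chi_quad F (\<alpha> * \<gamma>) (\<omega>\<^sub>2 * \<Lambda>) + chi_quad F (\<alpha> * \<delta>) (\<omega>\<^sub>3 * \<Lambda>)) * chi_q2q F triv)) \<and>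
    (irr_quad F ((\<alpha> \<circ> norm2 F) * \<Lambda> ^ 2) \<and> irr_split \<beta> \<gamma> \<delta> \<longrightarrow>
      (let \<Lambda>' = \<Lambda> \<circ> emb2 F in
        chi_quad F (\<alpha> * \<Lambda>') ((\<alpha> \<circ> norm2 F) * \<Lambda> ^ 2) * chi_split F \<beta> \<gamma> \<delta> =
          Ind_i (\<alpha> * \<Lambda>' * \<beta>) (\<alpha> * \<Lambda>' * \<gamma>) (\<alpha> * \<Lambda>' * \<delta>)
          - chi_split F (\<alpha> * \<Lambda>' * \<beta>) (\<alpha> * \<Lambda>' * \<gamma>) (\<alpha> * \<Lambda>' * \<delta>))) \<and>
    (irr_quad F \<Lambda> \<and> irr_quad F \<mu> \<longrightarrow>
      chi_quad F \<alpha> \<Lambda> * chi_quad F \<beta> \<mu> =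
        Ind_m F (\<Lambda> * \<mu>) (\<alpha> * \<beta>) - chi_quad F (\<alpha> * \<beta>) (\<Lambda> * twist q \<mu>)) \<and>
    (irr_quad F \<Lambda> \<and> irr_cubic F \<phi> \<longrightarrow>
      (\<forall>\<omega>\<^sub>1 \<omega>\<^sub>2. is_extension (emb3 F) \<alpha> \<omega>\<^sub>1 \<and> is_extension (emb3 F) (\<Lambda> \<circ> emb2 F) \<omega>\<^sub>2 \<longrightarrow>
        chi_quad F \<alpha> \<Lambda> * chi_cubic F \<phi> =
          Ind_a F (\<omega>\<^sub>1 * \<omega>\<^sub>2 * \<phi>) - chi_cubic F (\<omega>\<^sub>1 * \<omega>\<^sub>2 * \<phi>))) \<and>
    (irr_quad F \<Lambda> \<and> irr_cubic F \<phi> \<longrightarrow>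
      (let \<phi>' = \<phi> \<circ> emb3 F in
        chi_quad F \<alpha> \<Lambda> * chi_cubic F \<phi> =
          Ind_m F \<Lambda> (\<alpha> * \<phi>') + chi_quad F (\<alpha> * \<phi>') \<Lambda> * (chi_one triv - chi_q2q F triv))) \<and>
    (irr_split \<alpha> \<beta> \<gamma> \<longrightarrow>
      chi_q3 F \<delta> * chi_split F \<alpha> \<beta> \<gamma> = Ind_i (\<alpha> * \<delta>) (\<beta> * \<delta>) (\<gamma> * \<delta>)) \<and>
    (irr_cubic F \<phi> \<longrightarrow>
      chi_q3 F \<alpha> * chi_cubic F \<phi> = Ind_a F ((\<alpha> \<circ> norm3 F) * \<phi>)) \<and>
    (irr_quad F \<Lambda> \<longrightarrow>
      chi_q3 F \<alpha> * chi_quad F \<beta> \<Lambda> = Ind_m F ((\<alpha> \<circ> norm2 F) * \<Lambda>) (\<alpha> * \<beta>)) \<and>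
    (chi_q3 F \<alpha> * chi_q3 F \<beta> =
      Ind_m F ((\<alpha> * \<beta>) \<circ> norm2 F) (\<alpha> * \<beta>) + chi_q3 F (\<alpha> * \<beta>)) \<and>
    (chi_q3 F \<alpha> * chi_q3 F \<beta> =
      Ind_i (\<alpha> * \<beta>) (\<alpha> * \<beta>) (\<alpha> * \<beta>) - chi_q3 F (\<alpha> * \<beta>) * (2 * chi_q2q F triv + chi_one triv)) \<and>
    (chi_q3 F \<alpha> * chi_q3 F \<beta> =
      Ind_a F ((\<alpha> * \<beta>) \<circ> norm3 F) + chi_q3 F (\<alpha> * \<beta>) * (chi_q2q F triv - chi_one triv)) \<and>
    (irr_cubic F \<phi> \<and> irr_split \<alpha> \<beta> \<gamma> \<longrightarrow>
      (\<forall>\<omega>. is_extension (emb3 F) (\<alpha> * \<beta> * \<gamma>) \<omega> \<longrightarrow>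
        chi_cubic F \<phi> * chi_split F \<alpha> \<beta> \<gamma> =
          Ind_a F (\<phi> * \<omega>) + chi_cubic F (\<phi> * \<omega>) * (2 * chi_q2q F triv + chi_one triv))) \<and>
    (irr_cubic F \<phi> \<and> irr_split \<alpha> \<beta> \<gamma> \<longrightarrow>
      (let \<phi>' = \<phi> \<circ> emb3 F in
        chi_cubic F \<phi> * chi_split F \<alpha> \<beta> \<gamma> =
          Ind_i \<alpha> \<beta> (\<phi>' * \<gamma>) + chi_split F \<alpha> \<beta> (\<phi>' * \<gamma>) * (chi_one triv - chi_q2q F triv))) \<and>
    (irr_cubic F \<phi> \<and> irr_cubic F \<psi> \<longrightarrow>
      chi_cubic F \<phi> * chi_cubic F \<psi> =
        Ind_a F (\<phi> * \<psi>) + chi_cubic F (\<phi> * twist q \<psi>) + chi_cubic F (\<phi> * twist (q ^ 2) \<psi>)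
        - chi_cubic F (\<phi> * \<psi>) * (chi_q2q F triv + chi_one triv)) \<and>
    (irr_split \<alpha> \<beta> \<gamma> \<and> irr_split \<delta> \<epsilon> \<eta> \<longrightarrow>
      chi_split F \<alpha> \<beta> \<gamma> * chi_split F \<delta> \<epsilon> \<eta> =
        Ind_i (\<alpha> * \<delta>) (\<beta> * \<epsilon>) (\<gamma> * \<eta>)
        + (chi_split F (\<alpha> * \<delta>) (\<beta> * \<eta>) (\<gamma> * \<epsilon>)
           + chi_split F (\<alpha> * \<epsilon>) (\<beta> * \<delta>) (\<gamma> * \<eta>)
           + chi_split F (\<alpha> * \<epsilon>) (\<beta> * \<eta>) (\<gamma> * \<delta>)
           + chi_split F (\<alpha> * \<eta>) (\<beta> * \<delta>) (\<gamma> * \<epsilon>)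
           + chi_split F (\<alpha> * \<eta>) (\<beta> * \<epsilon>) (\<gamma> * \<delta>))
        + (chi_split F (\<alpha> * \<epsilon>) (\<beta> * \<eta>) (\<gamma> * \<delta>) + chi_split F (\<alpha> * \<eta>) (\<beta> * \<delta>) (\<gamma> * \<epsilon>))
          * (chi_q2q F triv - 2 * chi_one triv))"
proof -
  interpret tower_setup F q
    using assms(1,2) by unfold_locales
  note chars = assms(3-12)
  note split_split[of \<alpha> \<beta> \<gamma> \<delta> \<epsilon> \<eta>] cubic_cubic[of \<phi> \<psi>] cubic_split[of \<phi> \<alpha> \<beta> \<gamma>]
    cubic_split_extended[of \<alpha> \<beta> \<gamma> _ \<phi>]
    q3_q3_m[OF chars(1,2)] q3_q3_i[OF chars(1,2)] q3_q3_a[OF chars(1,2)]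
    q3_quad[OF chars(1), of \<beta> \<Lambda>] q3_cubic[OF chars(1), of \<phi>] q3_split[OF chars(4), of \<alpha> \<beta> \<gamma>]
    quad_cubic[of \<alpha> \<Lambda> \<phi>] quad_cubic_extended[of \<alpha> _ \<Lambda> _ \<phi>] quad_quad[of \<alpha> \<Lambda> \<beta> \<mu>]
    quad_norm_split[OF chars(1), of \<Lambda> \<beta> \<gamma> \<delta>]
    quad_split_extended[of \<gamma> \<delta> _ \<beta> _ _ \<alpha> \<Lambda>]
  then show ?thesis
    unfolding Let_def by blast
qed

end
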